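(* Let $H$ be a finite-dimensional Hopf algebra with dual $\widehat H$, $X$ an algebra, $\alpha:X\to H^{\mathrm{op}}\otimes X$ a left coaction of $H^{\mathrm{op}}$ and $\beta:X\to\widehat H\otimes X$ a left coaction of $\widehat H$. Write $\alpha(x)=x_{[-1]}^{\mathrm{op}}\otimes x_{[0]}$, $\beta(x)=x^{[-1]}\otimes x^{[0]}$, and consider the opposite coactions $$\beta^{\mathrm{op}}=(\widehat S^{-1}\otimes\mathrm{id})\beta^{\mathrm{co}}:X^{\mathrm{op}}\to\widehat H^{\mathrm{op}}\otimes X^{\mathrm{op}},\quad x^{\mathrm{op}}\mapsto (x^{[-1]})^{\mathrm{op}}\otimes (x^{[0]})^{\mathrm{op}},$$ $$\alpha^{\mathrm{op}}=(S\otimes\mathrm{id})\alpha^{\mathrm{co}}:X^{\mathrm{op}}\to H\otimes X^{\mathrm{op}},\quad x^{\mathrm{op}}\mapsto x_{[-1]}\otimes (x_{[0]})^{\mathrm{op}},$$ which are left coactions of $\widehat H^{\mathrm{op}}$ and $H$ on $X^{\mathrm{op}}$, respectively. Then $(X,\alpha,\beta)$ is a left-left $(H,\widehat H)$-Yetter--Drinfeld algebra if and only if $(X^{\mathrm{op}},\beta^{\mathrm{op}},\alpha^{\mathrm{op}})$ is a left-left $(\widehat H,H)$-Yetter--Drinfeld algebra. Moreover, $(X,\alpha,\beta)$ is braided commutative if and only if $(X^{\mathrm{op}},\beta^{\mathrm{op}},\alpha^{\mathrm{op}})$ is braided commutative.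
   Context: $\Bbbk$ is a field, algebras are unital $\Bbbk$-algebras; for an algebra $Y$, $Y^{\mathrm{op}}$ is the opposite algebra with elements $y^{\mathrm{op}}$. For a finite-dimensional Hopf algebra $K$ with structure maps $\Delta,\varepsilon,S$, $\widehat K$ is the dual Hopf algebra (antipode $\widehat S$), $\mathbf p(k,\theta)=\theta(k)$, with $\mathbf p(k,\theta\theta')=\mathbf p(k_{(1)},\theta)\mathbf p(k_{(2)},\theta')$, $\mathbf p(kk',\theta)=\mathbf p(k,\theta_{(1)})\mathbf p(k',\theta_{(2)})$. The bidual of $H$ is identified with $H$. $K^{\mathrm{op}}$ is the Hopf algebra with opposite product and the same coproduct. ${}^{\circ}U_K=\sum_ik_i^{\mathrm{op}}\otimes\widehat k_i\in K^{\mathrm{op}}\otimes\widehat K$ (dual bases $(k_i)$, $(\widehat k_i)$), which is invertible. $\mathrm{Ad}(W)(z)=WzW^{-1}$; $\Sigma$ is the flip. The co-opposite coactions are $\beta^{\mathrm{co}}(x^{\mathrm{op}})=\widehat S(x^{[-1]})\otimes (x^{[0]})^{\mathrm{op}}$ and $\alpha^{\mathrm{co}}(x^{\mathrm{op}})=S^{-1}(x_{[-1]})^{\mathrm{op}}\otimes (x_{[0]})^{\mathrm{op}}$; in the formulas of the claim $\widehat S^{-1}$ is read as a map $\widehat H^{\mathrm{co}}\to\widehat H^{\mathrm{op}}$, $\omega\mapsto\widehat S^{-1}(\omega)^{\mathrm{op}}$, and $S$ as the map $h^{\mathrm{op}}\mapsto S(h)$. A left coaction of a Hopf algebra $K$ on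 an algebra $Y$ is an algebra homomorphism $\alpha:Y\to K\otimes Y$ with $(\mathrm{id}\otimes\alpha)\alpha=(\Delta_K\otimes\mathrm{id})\alpha$, $(\varepsilon_K\otimes\mathrm{id})\alpha=\mathrm{id}$. A left-left $(K,\widehat K)$-Yetter--Drinfeld algebra is a triple $(Y,\alpha,\beta)$ with left coactions $\alpha:Y\to K^{\mathrm{op}}\otimes Y$ of $K^{\mathrm{op}}$ and $\beta:Y\to\widehat K\otimes Y$ of $\widehat K$ such that $(\mathrm{id}_{\widehat K}\otimes\alpha)\beta=(\Sigma\otimes\mathrm{id}_Y)(\mathrm{Ad}({}^{\circ}U_K)\otimes\mathrm{id}_Y)(\mathrm{id}_{K^{\mathrm{op}}}\otimes\beta)\alpha$. (Used for $K=H$ and $K=\widehat H$.) The Heisenberg algebra $\mathcal H(K)=K\#\widehat K$ is $K\otimes\widehat K$ with product $(k\#\theta)(k'\#\theta')=k\,k'_{(1)}\,\mathbf p(k'_{(2)},\theta_{(1)})\#\theta_{(2)}\theta'$. A left-left $(K,\widehat K)$-Yetter--Drinfeld algebra $(Y,\alpha,\beta)$ is braided commutative if for all $x,y\in Y$, in the tensor product algebra $\mathcal H(K)\otimes Y^{\mathrm{op}}$, $$(x_{[-1]}\#1\otimes x_{[0]}^{\mathrm{op}})(1\#\widehat S(y^{[-1]})\otimes (y^{[0]})^{\mathrm{op}})=(1\#\widehat S(y^{[-1]})\otimes (y^{[0]})^{\mathrm{op}})(x_{[-1]}\#1\otimes x_{[0]}^{\mathrm{op}}),$$ where $\alpha(x)=x_{[-1]}^{\mathrm{op}}\otimes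 x_{[0]}$, $\beta(y)=y^{[-1]}\otimes y^{[0]}$ and $\widehat S$ is the antipode of $\widehat K$ (summations understood). *)

theory Defs
  imports Complex_Main "HOL-Library.Function_Algebras"
begin

section \<open>Vector spaces and bilinear maps\<close>

text \<open>A vector space over the field type \<open>'k\<close> is a subspace (the carrier) of a type that is a vector
  space under a given scalar multiplication; addition is that of the type.  Carriers are needed
  because duals and tensor products depend on the scalar multiplication, so they are not types.\<close>

record ('k, 'a) vspace =
  vcar :: "'a set"
  vscale :: "'k \<Rightarrow> 'a \<Rightarrow> 'a"

definition is_vspace :: "('k::field, 'a::ab_group_add, 'm) vspace_scheme \<Rightarrow> bool" where
  "is_vspace V \<longleftrightarrow> vector_space (vscale V) \<and> module.subspace (vscale V) (vcar V)"

definition finite_dim :: "('k::field, 'a::ab_group_add, 'm) vspace_scheme \<Rightarrow> bool" where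
  "finite_dim V \<longleftrightarrow> (\<exists>B. finite B \<and> module.span (vscale V) B = vcar V)"

definition lin_map ::
    "('k::field, 'a::ab_group_add, 'm) vspace_scheme \<Rightarrow> ('k, 'b::ab_group_add, 'n) vspace_scheme
      \<Rightarrow> ('a \<Rightarrow> 'b) \<Rightarrow> bool" where
  "lin_map V W f \<longleftrightarrow>
     (\<forall>x\<in>vcar V. f x \<in> vcar W) \<and>
     (\<forall>x\<in>vcar V. \<forall>y\<in>vcar V. f (x + y) = f x + f y) \<and>
     (\<forall>c. \<forall>x\<in>vcar V. f (vscale V c x) = vscale W c (f x))"

definition bilin_map ::
    "('k::field, 'a::ab_group_add, 'm) vspace_scheme \<Rightarrow> ('k, 'b::ab_group_add, 'n) vspace_scheme
      \<Rightarrow> ('k, 'c::ab_group_add, 'p) vspace_scheme \<Rightarrow> ('a \<Rightarrow> 'b \<Rightarrow> 'c) \<Rightarrow> bool" where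
  "bilin_map V W U f \<longleftrightarrow>
     (\<forall>v\<in>vcar V. lin_map W U (\<lambda>w. f v w)) \<and> (\<forall>w\<in>vcar W. lin_map V U (\<lambda>v. f v w))"

definition pscale :: "'k::field \<Rightarrow> ('i \<Rightarrow> 'k) \<Rightarrow> 'i \<Rightarrow> 'k" where
  "pscale c f = (\<lambda>i. c * f i)"

section \<open>Tensor products\<close>

text \<open>Over a field, the bilinear forms on \<open>V \<times> W\<close> separate the elements of the tensor product, so the
  latter embeds into the functionals on bilinear forms: \<open>v \<otimes> w\<close> is evaluation at \<open>(v, w)\<close>, and the
  tensor product is the span of these evaluations.  The universal property is proved below
  (\<open>tlift_ten\<close>, \<open>tlift_lin_map\<close>, \<open>lin_map_tensor_eq\<close>).\<close>

type_synonym ('k, 'a, 'b) tensor = "('a \<Rightarrow> 'b \<Rightarrow> 'k) \<Rightarrow> 'k"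

definition ground_vs :: "('k::field, 'k) vspace" where
  "ground_vs = \<lparr>vcar = UNIV, vscale = (*)\<rparr>"

definition ten ::
    "'a::ab_group_add \<Rightarrow> ('k::field, 'a, 'm) vspace_scheme \<Rightarrow> ('k, 'b::ab_group_add, 'n) vspace_scheme
      \<Rightarrow> 'b \<Rightarrow> ('k, 'a, 'b) tensor"
    (\<open>(_ \<otimes>\<^bsub>_,_\<^esub> _)\<close> [71, 0, 0, 70] 70) where
  "v \<otimes>\<^bsub>V,W\<^esub> w = (\<lambda>B. if bilin_map V W ground_vs B then B v w else 0)"

definition tensor_vs ::
    "('k::field, 'a::ab_group_add, 'm) vspace_scheme \<Rightarrow> ('k, 'b::ab_group_add, 'n) vspace_scheme
      \<Rightarrow> ('k, ('k, 'a, 'b) tensor) vspace" where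
  "tensor_vs V W =
     \<lparr>vcar = module.span pscale {v \<otimes>\<^bsub>V,W\<^esub> w | v w. v \<in> vcar V \<and> w \<in> vcar W}, vscale = pscale\<rparr>"

text \<open>The linear extension of a bilinear map \<open>f\<close> to the tensor product.  In Sweedler notation,
  \<open>tlift V W f t\<close> is \<open>f t\<^sub>1 t\<^sub>2\<close> for \<open>t = t\<^sub>1 \<otimes> t\<^sub>2\<close>, summation understood.\<close>

definition tlift ::
    "('k::field, 'a::ab_group_add, 'm) vspace_scheme \<Rightarrow> ('k, 'b::ab_group_add, 'n) vspace_scheme
      \<Rightarrow> ('a \<Rightarrow> 'b \<Rightarrow> 'c::ab_group_add) \<Rightarrow> ('k, 'a, 'b) tensor \<Rightarrow> 'c" where
  "tlift V W f t =
     (THE u. \<exists>ps. set ps \<subseteq> vcar V \<times> vcar W \<and> t = (\<Sum>(v, w)\<leftarrow>ps. v \<otimes>\<^bsub>V,W\<^esub> w) \<and>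
        u = (\<Sum>(v, w)\<leftarrow>ps. f v w))"

lemma vector_space_pscale: "vector_space (pscale :: 'k::field \<Rightarrow> _)"
  by unfold_locales (auto simp: pscale_def algebra_simps fun_eq_iff)

lemma separating_functional:
  assumes "vector_space (s :: 'k::field \<Rightarrow> 'c::ab_group_add \<Rightarrow> 'c)" "d \<noteq> 0"
  shows "\<exists>g :: 'c \<Rightarrow> 'k. Vector_Spaces.linear s (*) g \<and> g d \<noteq> 0"
proof -
  interpret V: vector_space s by fact
  interpret K: vector_space "(*) :: 'k \<Rightarrow> 'k \<Rightarrow> 'k" by unfold_locales (auto simp: algebra_simps)
  interpret P: vector_space_pair s "(*) :: 'k \<Rightarrow> 'k \<Rightarrow> 'k" by unfold_locales
  have "V.independent {d}" using assms(2) by simp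
  then show ?thesis
    using P.linear_independent_extend[of "{d}" "\<lambda>_. 1"] by force
qed

lemma is_vspace_carrier:
  assumes "is_vspace V"
  shows "0 \<in> vcar V" "x \<in> vcar V \<Longrightarrow> y \<in> vcar V \<Longrightarrow> x + y \<in> vcar V"
    "x \<in> vcar V \<Longrightarrow> vscale V c x \<in> vcar V"
proof -
  interpret vector_space "vscale V" using assms unfolding is_vspace_def by simp
  have "subspace (vcar V)" using assms unfolding is_vspace_def by simp
  then show "0 \<in> vcar V" "x \<in> vcar V \<Longrightarrow> y \<in> vcar V \<Longrightarrow> x + y \<in> vcar V"
    "x \<in> vcar V \<Longrightarrow> vscale V c x \<in> vcar V"
    by (auto simp: subspace_0 subspace_add subspace_scale)
qed

lemma is_vspace_tensor_vs: "is_vspace (tensor_vs V W)"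
  unfolding is_vspace_def tensor_vs_def
  by (simp add: vector_space_pscale module.subspace_span module_iff_vector_space)

lemma ten_linear:
  assumes "is_vspace V" "is_vspace W"
  shows "v \<in> vcar V \<Longrightarrow> v' \<in> vcar V \<Longrightarrow> w \<in> vcar W \<Longrightarrow>
      (v + v') \<otimes>\<^bsub>V,W\<^esub> w = (v \<otimes>\<^bsub>V,W\<^esub> w) + (v' \<otimes>\<^bsub>V,W\<^esub> w)"
    and "v \<in> vcar V \<Longrightarrow> w \<in> vcar W \<Longrightarrow> w' \<in> vcar W \<Longrightarrow>
      v \<otimes>\<^bsub>V,W\<^esub> (w + w') = (v \<otimes>\<^bsub>V,W\<^esub> w) + (v \<otimes>\<^bsub>V,W\<^esub> w')"
    and "v \<in> vcar V \<Longrightarrow> w \<in> vcar W \<Longrightarrow> vscale V c v \<otimes>\<^bsub>V,W\<^esub> w = pscale c (v \<otimes>\<^bsub>V,W\<^esub> w)"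
    and "v \<in> vcar V \<Longrightarrow> w \<in> vcar W \<Longrightarrow> v \<otimes>\<^bsub>V,W\<^esub> vscale W c w = pscale c (v \<otimes>\<^bsub>V,W\<^esub> w)"
  by (auto simp: ten_def fun_eq_iff pscale_def bilin_map_def lin_map_def ground_vs_def)

lemma tensor_vs_rep:
  fixes V :: "('k::field, 'a::ab_group_add, 'm) vspace_scheme"
    and W :: "('k, 'b::ab_group_add, 'n) vspace_scheme"
  assumes "is_vspace V" "is_vspace W"
  shows "t \<in> vcar (tensor_vs V W) \<longleftrightarrow>
    (\<exists>ps. set ps \<subseteq> vcar V \<times> vcar W \<and> t = (\<Sum>(v, w)\<leftarrow>ps. v \<otimes>\<^bsub>V,W\<^esub> w))"
    (is "_ \<longleftrightarrow> ?R t")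
proof -
  interpret T: module "pscale :: 'k \<Rightarrow> ('k, 'a, 'b) tensor \<Rightarrow> _"
    using vector_space_pscale by (simp add: module_iff_vector_space)
  show ?thesis
  proof
    assume "t \<in> vcar (tensor_vs V W)"
    then have t: "t \<in> T.span {v \<otimes>\<^bsub>V,W\<^esub> w | v w. v \<in> vcar V \<and> w \<in> vcar W}"
      by (simp add: tensor_vs_def)
    show "?R t"
      using t
    proof (induction rule: T.span_induct_alt)
      case base
      show ?case by (rule exI[of _ "[]"]) simp
    next
      case (step c x y)
      then obtain v w ps where h: "v \<in> vcar V" "w \<in> vcar W" "x = v \<otimes>\<^bsub>V,W\<^esub> w"
        "set ps \<subseteq> vcar V \<times> vcar W" "y = (\<Sum>(v, w)\<leftarrow>ps. v \<otimes>\<^bsub>V,W\<^esub> w)" by blast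
      then show ?case
        by (intro exI[of _ "(vscale V c v, w) # ps"])
          (simp add: ten_linear(3)[OF assms] is_vspace_carrier(3)[OF assms(1)])
    qed
  next
    assume "?R t"
    then obtain ps where ps: "set ps \<subseteq> vcar V \<times> vcar W"
      "t = (\<Sum>(v, w)\<leftarrow>ps. v \<otimes>\<^bsub>V,W\<^esub> w)" by blast
    have "(\<Sum>(v, w)\<leftarrow>ps. v \<otimes>\<^bsub>V,W\<^esub> w) \<in> T.span {v \<otimes>\<^bsub>V,W\<^esub> w | v w. v \<in> vcar V \<and> w \<in> vcar W}"
      using ps(1)
    proof (induction ps)
      case Nil
      show ?case using T.span_zero by (simp del: zero_fun_apply add: zero_fun_def)
    next
      case (Cons p ps)
      obtain v w where p: "p = (v, w)" by (cases p)
      have "v \<otimes>\<^bsub>V,W\<^esub> w \<in> T.span {v \<otimes>\<^bsub>V,W\<^esub> w | v w. v \<in> vcar V \<and> w \<in> vcar W}"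
        using Cons.prems p by (intro T.span_base) auto
      from T.span_add[OF this Cons.IH] show ?case
        using Cons.prems p by (simp del: plus_fun_apply)
    qed
    then show "t \<in> vcar (tensor_vs V W)" using ps(2) by (simp add: tensor_vs_def)
  qed
qed

lemma tlift_sum_list:
  fixes f :: "'a::ab_group_add \<Rightarrow> 'b::ab_group_add \<Rightarrow> 'c::ab_group_add"
    and V :: "('k::field, 'a, 'm) vspace_scheme"
  assumes "is_vspace V" "is_vspace W" "is_vspace U" "bilin_map V W U f"
    and ps: "set ps \<subseteq> vcar V \<times> vcar W"
  shows "tlift V W f (\<Sum>(v, w)\<leftarrow>ps. v \<otimes>\<^bsub>V,W\<^esub> w) = (\<Sum>(v, w)\<leftarrow>ps. f v w)"
proof -
  have "(\<Sum>(v, w)\<leftarrow>qs. f v w) = (\<Sum>(v, w)\<leftarrow>ps. f v w)"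
    if qs: "set qs \<subseteq> vcar V \<times> vcar W"
      and eq: "(\<Sum>(v, w)\<leftarrow>ps. v \<otimes>\<^bsub>V,W\<^esub> w) = (\<Sum>(v, w)\<leftarrow>qs. v \<otimes>\<^bsub>V,W\<^esub> w)" for qs
  proof (rule ccontr)
    assume "\<not> ?thesis"
    then have "(\<Sum>(v, w)\<leftarrow>qs. f v w) - (\<Sum>(v, w)\<leftarrow>ps. f v w) \<noteq> 0" by simp
    moreover have "vector_space (vscale U)" using assms(3) by (simp add: is_vspace_def)
    ultimately obtain g :: "'c \<Rightarrow> 'k" where g: "Vector_Spaces.linear (vscale U) (*) g"
      and ne: "g ((\<Sum>(v, w)\<leftarrow>qs. f v w) - (\<Sum>(v, w)\<leftarrow>ps. f v w)) \<noteq> 0"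
      using separating_functional by blast
    interpret g: Vector_Spaces.linear "vscale U" "(*)" g by fact
    define B where "B = (\<lambda>v w. g (f v w))"
    have B: "bilin_map V W ground_vs B"
      using assms(4) by (auto simp: bilin_map_def lin_map_def B_def ground_vs_def g.add g.scale)
    have ten: "(\<Sum>(v, w)\<leftarrow>rs. v \<otimes>\<^bsub>V,W\<^esub> w) B = g (\<Sum>(v, w)\<leftarrow>rs. f v w)" for rs
    proof (induction rs)
      case (Cons r rs)
      then show ?case using B by (cases r) (simp add: ten_def g.add B_def)
    qed (simp add: g.zero)
    from eq have "g (\<Sum>(v, w)\<leftarrow>ps. f v w) = g (\<Sum>(v, w)\<leftarrow>qs. f v w)"
      by (simp flip: ten)
    with ne show False by (simp add: g.diff)
  qed
  with ps show ?thesis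
    unfolding tlift_def by (intro the_equality) blast+
qed

lemma tlift_ten:
  assumes "is_vspace V" "is_vspace W" "is_vspace U" "bilin_map V W U f" "v \<in> vcar V" "w \<in> vcar W"
  shows "tlift V W f (v \<otimes>\<^bsub>V,W\<^esub> w) = f v w"
  using tlift_sum_list[OF assms(1-4), of "[(v, w)]"] assms(5,6) by simp

lemma tlift_lin_map:
  assumes "is_vspace V" "is_vspace W" "is_vspace U" "bilin_map V W U f"
  shows "lin_map (tensor_vs V W) U (tlift V W f)"
proof -
  note rep = tensor_vs_rep[OF assms(1,2)] and sl = tlift_sum_list[OF assms]
  have fU: "f v w \<in> vcar U" if "v \<in> vcar V" "w \<in> vcar W" for v w
    using assms(4) that by (auto simp: bilin_map_def lin_map_def)
  have sumU: "(\<Sum>(v, w)\<leftarrow>ps. f v w) \<in> vcar U" if "set ps \<subseteq> vcar V \<times> vcar W" for ps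
    using that
    by (induction ps) (auto simp: is_vspace_carrier(1,2)[OF assms(3)] fU)
  have "tlift V W f t \<in> vcar U" if "t \<in> vcar (tensor_vs V W)" for t
    using that sumU sl unfolding rep by auto
  moreover have "tlift V W f (s + t) = tlift V W f s + tlift V W f t"
    if "s \<in> vcar (tensor_vs V W)" "t \<in> vcar (tensor_vs V W)" for s t
  proof -
    obtain ps qs where "set ps \<subseteq> vcar V \<times> vcar W" "s = (\<Sum>(v, w)\<leftarrow>ps. v \<otimes>\<^bsub>V,W\<^esub> w)"
      "set qs \<subseteq> vcar V \<times> vcar W" "t = (\<Sum>(v, w)\<leftarrow>qs. v \<otimes>\<^bsub>V,W\<^esub> w)"
      using \<open>t \<in> _\<close> \<open>s \<in> _\<close> unfolding rep by blast
    then show ?thesis using sl[of ps] sl[of qs] sl[of "ps @ qs"] by simp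
  qed
  moreover have "tlift V W f (pscale c t) = vscale U c (tlift V W f t)"
    if t: "t \<in> vcar (tensor_vs V W)" for c t
  proof -
    interpret U: vector_space "vscale U" using assms(3) by (simp add: is_vspace_def)
    interpret T: vector_space pscale by (rule vector_space_pscale)
    obtain ps where ps: "set ps \<subseteq> vcar V \<times> vcar W" "t = (\<Sum>(v, w)\<leftarrow>ps. v \<otimes>\<^bsub>V,W\<^esub> w)"
      using t unfolding rep by blast
    define qs where "qs = map (\<lambda>(v, w). (vscale V c v, w)) ps"
    have qs: "set qs \<subseteq> vcar V \<times> vcar W"
      using ps(1) by (auto simp: qs_def is_vspace_carrier(3)[OF assms(1)])
    have "(\<Sum>(v, w)\<leftarrow>qs. v \<otimes>\<^bsub>V,W\<^esub> w) = pscale c t"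
      using ps(1) unfolding ps(2) qs_def
      by (induction ps)
        (auto simp: ten_linear(3)[OF assms(1,2)] T.scale_right_distrib)
    moreover have "(\<Sum>(v, w)\<leftarrow>qs. f v w) = vscale U c (\<Sum>(v, w)\<leftarrow>ps. f v w)"
      using ps(1) assms(4) unfolding qs_def
      by (induction ps) (auto simp: U.scale_right_distrib bilin_map_def lin_map_def)
    ultimately show ?thesis using sl[OF ps(1)] sl[OF qs] ps(2) by simp
  qed
  ultimately show ?thesis
    unfolding lin_map_def by (simp add: tensor_vs_def)
qed

lemma lin_map_tensor_eq:
  assumes "is_vspace V" "is_vspace W"
    and "lin_map (tensor_vs V W) U f" "lin_map (tensor_vs V W) U g"
    and eq: "\<And>v w. v \<in> vcar V \<Longrightarrow> w \<in> vcar W \<Longrightarrow> f (v \<otimes>\<^bsub>V,W\<^esub> w) = g (v \<otimes>\<^bsub>V,W\<^esub> w)"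
    and t: "t \<in> vcar (tensor_vs V W)"
  shows "f t = g t"
proof -
  note rep = tensor_vs_rep[OF assms(1,2)]
  obtain ps where ps: "set ps \<subseteq> vcar V \<times> vcar W" "t = (\<Sum>(v, w)\<leftarrow>ps. v \<otimes>\<^bsub>V,W\<^esub> w)"
    using t unfolding rep by blast
  have z: "f 0 = 0" "g 0 = 0"
    using assms(3,4) is_vspace_carrier(1)[OF is_vspace_tensor_vs, of V W]
    unfolding lin_map_def by (metis add_cancel_right_right)+
  show ?thesis
    using ps(1) unfolding ps(2)
  proof (induction ps)
    case (Cons p ps)
    obtain v w where p: "p = (v, w)" by (cases p)
    have "v \<otimes>\<^bsub>V,W\<^esub> w \<in> vcar (tensor_vs V W)"
      unfolding rep using Cons.prems p by (intro exI[of _ "[(v, w)]"]) auto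
    moreover have "(\<Sum>(v, w)\<leftarrow>ps. v \<otimes>\<^bsub>V,W\<^esub> w) \<in> vcar (tensor_vs V W)"
      unfolding rep using Cons.prems by auto
    ultimately show ?case
      using assms(3,4) Cons p eq[of v w] by (simp add: lin_map_def del: plus_fun_apply)
  qed (simp add: z)
qed

definition tmap ::
    "('k::field, 'a::ab_group_add, 'm) vspace_scheme \<Rightarrow> ('k, 'b::ab_group_add, 'n) vspace_scheme
      \<Rightarrow> ('k, 'c::ab_group_add, 'p) vspace_scheme \<Rightarrow> ('k, 'd::ab_group_add, 'q) vspace_scheme
      \<Rightarrow> ('a \<Rightarrow> 'c) \<Rightarrow> ('b \<Rightarrow> 'd) \<Rightarrow> ('k, 'a, 'b) tensor \<Rightarrow> ('k, 'c, 'd) tensor" where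
  "tmap V W V' W' f g = tlift V W (\<lambda>v w. f v \<otimes>\<^bsub>V',W'\<^esub> g w)"

definition tflip ::
    "('k::field, 'a::ab_group_add, 'm) vspace_scheme \<Rightarrow> ('k, 'b::ab_group_add, 'n) vspace_scheme
      \<Rightarrow> ('k, 'a, 'b) tensor \<Rightarrow> ('k, 'b, 'a) tensor" where
  "tflip V W = tlift V W (\<lambda>v w. w \<otimes>\<^bsub>W,V\<^esub> v)"

definition tassoc ::
    "('k::field, 'a::ab_group_add, 'm) vspace_scheme \<Rightarrow> ('k, 'b::ab_group_add, 'n) vspace_scheme
      \<Rightarrow> ('k, 'c::ab_group_add, 'p) vspace_scheme
      \<Rightarrow> ('k, ('k, 'a, 'b) tensor, 'c) tensor \<Rightarrow> ('k, 'a, ('k, 'b, 'c) tensor) tensor" where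
  "tassoc U V W =
     tlift (tensor_vs U V) W (\<lambda>t w. tlift U V (\<lambda>u v. u \<otimes>\<^bsub>U,tensor_vs V W\<^esub> (v \<otimes>\<^bsub>V,W\<^esub> w)) t)"

definition tassoc_inv ::
    "('k::field, 'a::ab_group_add, 'm) vspace_scheme \<Rightarrow> ('k, 'b::ab_group_add, 'n) vspace_scheme
      \<Rightarrow> ('k, 'c::ab_group_add, 'p) vspace_scheme
      \<Rightarrow> ('k, 'a, ('k, 'b, 'c) tensor) tensor \<Rightarrow> ('k, ('k, 'a, 'b) tensor, 'c) tensor" where
  "tassoc_inv U V W =
     tlift U (tensor_vs V W) (\<lambda>u t. tlift V W (\<lambda>v w. (u \<otimes>\<^bsub>U,V\<^esub> v) \<otimes>\<^bsub>tensor_vs U V,W\<^esub> w) t)"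

section \<open>Algebras\<close>

record ('k, 'a) alg = "('k, 'a) vspace" +
  amult :: "'a \<Rightarrow> 'a \<Rightarrow> 'a" (\<open>(_ \<cdot>\<index> _)\<close> [76, 77] 76)
  aone :: "'a" (\<open>\<one>\<index>\<close>)

definition algebra :: "('k::field, 'a::ab_group_add, 'm) alg_scheme \<Rightarrow> bool" where
  "algebra A \<longleftrightarrow> is_vspace A \<and> bilin_map A A A (amult A) \<and> \<one>\<^bsub>A\<^esub> \<in> vcar A \<and>
     (\<forall>x\<in>vcar A. \<forall>y\<in>vcar A. \<forall>z\<in>vcar A. (x \<cdot>\<^bsub>A\<^esub> y) \<cdot>\<^bsub>A\<^esub> z = x \<cdot>\<^bsub>A\<^esub> (y \<cdot>\<^bsub>A\<^esub> z)) \<and>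
     (\<forall>x\<in>vcar A. \<one>\<^bsub>A\<^esub> \<cdot>\<^bsub>A\<^esub> x = x \<and> x \<cdot>\<^bsub>A\<^esub> \<one>\<^bsub>A\<^esub> = x)"

definition alg_hom ::
    "('k::field, 'a::ab_group_add, 'm) alg_scheme \<Rightarrow> ('k, 'b::ab_group_add, 'n) alg_scheme
      \<Rightarrow> ('a \<Rightarrow> 'b) \<Rightarrow> bool" where
  "alg_hom A B f \<longleftrightarrow> lin_map A B f \<and>
     (\<forall>x\<in>vcar A. \<forall>y\<in>vcar A. f (x \<cdot>\<^bsub>A\<^esub> y) = f x \<cdot>\<^bsub>B\<^esub> f y) \<and> f \<one>\<^bsub>A\<^esub> = \<one>\<^bsub>B\<^esub>"

definition ground_alg :: "('k::field, 'k) alg" where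
  "ground_alg = \<lparr>vcar = UNIV, vscale = (*), amult = (*), aone = 1\<rparr>"

definition tensor_alg ::
    "('k::field, 'a::ab_group_add, 'm) alg_scheme \<Rightarrow> ('k, 'b::ab_group_add, 'n) alg_scheme
      \<Rightarrow> ('k, ('k, 'a, 'b) tensor) alg" where
  "tensor_alg A B =
     \<lparr>vcar = vcar (tensor_vs A B), vscale = pscale,
      amult = (\<lambda>s t. tlift A B (\<lambda>a b. tlift A B (\<lambda>a' b'. (a \<cdot>\<^bsub>A\<^esub> a') \<otimes>\<^bsub>A,B\<^esub> (b \<cdot>\<^bsub>B\<^esub> b')) t) s),
      aone = \<one>\<^bsub>A\<^esub> \<otimes>\<^bsub>A,B\<^esub> \<one>\<^bsub>B\<^esub>\<rparr>"

text \<open>The element \<open>x\<^sup>o\<^sup>p\<close> is \<open>x\<close> itself, so \<open>x \<mapsto> x\<^sup>o\<^sup>p\<close> is the identity map, and tensor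
  products of opposite algebras coincide with those of the original ones as vector spaces.\<close>

definition alg_op :: "('k, 'a, 'm) alg_scheme \<Rightarrow> ('k, 'a, 'm) alg_scheme" where
  "alg_op A = A\<lparr>amult := (\<lambda>x y. y \<cdot>\<^bsub>A\<^esub> x)\<rparr>"

definition is_inverse ::
    "('k::field, 'a::ab_group_add, 'm) alg_scheme \<Rightarrow> 'a \<Rightarrow> 'a \<Rightarrow> bool" where
  "is_inverse A w w' \<longleftrightarrow> w \<in> vcar A \<and> w' \<in> vcar A \<and> w \<cdot>\<^bsub>A\<^esub> w' = \<one>\<^bsub>A\<^esub> \<and> w' \<cdot>\<^bsub>A\<^esub> w = \<one>\<^bsub>A\<^esub>"

definition alg_Ad :: "('k::field, 'a::ab_group_add, 'm) alg_scheme \<Rightarrow> 'a \<Rightarrow> 'a \<Rightarrow> 'a" where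
  "alg_Ad A w z = (w \<cdot>\<^bsub>A\<^esub> z) \<cdot>\<^bsub>A\<^esub> (THE w'. is_inverse A w w')"

section \<open>Hopf algebras and their duals\<close>

record ('k, 'a) hopf = "('k, 'a) alg" +
  comult :: "'a \<Rightarrow> ('k, 'a, 'a) tensor"
  counit :: "'a \<Rightarrow> 'k"
  antipode :: "'a \<Rightarrow> 'a"

definition hopf_algebra :: "('k::field, 'a::ab_group_add, 'm) hopf_scheme \<Rightarrow> bool" where
  "hopf_algebra H \<longleftrightarrow>
     algebra H \<and> alg_hom H (tensor_alg H H) (comult H) \<and> alg_hom H ground_alg (counit H) \<and>
     lin_map H H (antipode H) \<and>
     (\<forall>h\<in>vcar H.
        tassoc H H H (tmap H H (tensor_vs H H) H (comult H) id (comult H h))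
          = tmap H H H (tensor_vs H H) id (comult H) (comult H h) \<and>
        tlift H H (\<lambda>a b. vscale H (counit H a) b) (comult H h) = h \<and>
        tlift H H (\<lambda>a b. vscale H (counit H b) a) (comult H h) = h \<and>
        tlift H H (\<lambda>a b. antipode H a \<cdot>\<^bsub>H\<^esub> b) (comult H h) = vscale H (counit H h) \<one>\<^bsub>H\<^esub> \<and>
        tlift H H (\<lambda>a b. a \<cdot>\<^bsub>H\<^esub> antipode H b) (comult H h) = vscale H (counit H h) \<one>\<^bsub>H\<^esub>)"

text \<open>The antipode of the opposite Hopf algebra is the inverse of the antipode, which is bijective
  in finite dimension.\<close>

definition hopf_op :: "('k, 'a, 'm) hopf_scheme \<Rightarrow> ('k, 'a, 'm) hopf_scheme" where
  "hopf_op H = H\<lparr>amult := (\<lambda>x y. y \<cdot>\<^bsub>H\<^esub> x), antipode := inv_into (vcar H) (antipode H)\<rparr>"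

text \<open>Functionals on the carrier are represented by functions that vanish outside of it.  The
  coproduct of \<open>\<theta>\<close> is determined by \<open>\<theta>\<^sub>1(k) \<theta>\<^sub>2(k') = \<theta>(k k')\<close>.\<close>

definition hopf_dual ::
    "('k::field, 'a::ab_group_add, 'm) hopf_scheme \<Rightarrow> ('k, 'a \<Rightarrow> 'k) hopf" where
  "hopf_dual H =
     (let D = \<lparr>vcar = {\<theta>. lin_map H ground_vs \<theta> \<and> (\<forall>k. k \<notin> vcar H \<longrightarrow> \<theta> k = 0)},
               vscale = pscale\<rparr>;
          restr = (\<lambda>f k. if k \<in> vcar H then f k else 0)
      in \<lparr>vcar = vcar D, vscale = vscale D,
          amult = (\<lambda>\<theta> \<theta>'. restr (\<lambda>k. tlift H H (\<lambda>a b. \<theta> a * \<theta>' b) (comult H k))),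
          aone = restr (counit H),
          comult = (\<lambda>\<theta>. THE t. t \<in> vcar (tensor_vs D D) \<and>
             (\<forall>k\<in>vcar H. \<forall>k'\<in>vcar H. tlift D D (\<lambda>\<omega> \<omega>'. \<omega> k * \<omega>' k') t = \<theta> (k \<cdot>\<^bsub>H\<^esub> k'))),
          counit = (\<lambda>\<theta>. \<theta> \<one>\<^bsub>H\<^esub>),
          antipode = (\<lambda>\<theta>. restr (\<lambda>k. \<theta> (antipode H k)))\<rparr>)"

section \<open>Coactions and Yetter--Drinfeld algebras\<close>

definition left_coaction ::
    "('k::field, 'a::ab_group_add, 'm) hopf_scheme \<Rightarrow> ('k, 'y::ab_group_add, 'n) alg_scheme
      \<Rightarrow> ('y \<Rightarrow> ('k, 'a, 'y) tensor) \<Rightarrow> bool" where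
  "left_coaction K Y \<alpha> \<longleftrightarrow>
     alg_hom Y (tensor_alg K Y) \<alpha> \<and>
     (\<forall>y\<in>vcar Y.
        tmap K Y K (tensor_vs K Y) id \<alpha> (\<alpha> y)
          = tassoc K K Y (tmap K Y (tensor_vs K K) Y (comult K) id (\<alpha> y)) \<and>
        tlift K Y (\<lambda>k x. vscale Y (counit K k) x) (\<alpha> y) = y)"

text \<open>In the definitions below, the dual \<open>L\<close> of \<open>K\<close> is passed along with the pairing
  \<open>p :: K \<times> L \<rightarrow> \<k>\<close>.  For \<open>K = H\<close> it is the dual of \<open>H\<close> with the evaluation pairing; for \<open>K\<close> the dual of
  \<open>H\<close>, the identification of the bidual with \<open>H\<close> amounts to taking \<open>L = H\<close> with the flipped pairing.\<close>

definition dual_bases ::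
    "('k::field, 'a::ab_group_add, 'm) vspace_scheme \<Rightarrow> ('k, 'b::ab_group_add, 'n) vspace_scheme
      \<Rightarrow> ('a \<Rightarrow> 'b \<Rightarrow> 'k) \<Rightarrow> 'a set \<Rightarrow> ('a \<Rightarrow> 'b) \<Rightarrow> bool" where
  "dual_bases K L p B d \<longleftrightarrow>
     finite B \<and> \<not> module.dependent (vscale K) B \<and> module.span (vscale K) B = vcar K \<and>
     inj_on d B \<and> \<not> module.dependent (vscale L) (d ` B) \<and> module.span (vscale L) (d ` B) = vcar L \<and>
     (\<forall>b\<in>B. \<forall>b'\<in>B. p b (d b') = (if b = b' then 1 else 0))"

text \<open>The canonical element does not depend on the choice of dual bases.\<close>

definition canonical_elt ::
    "('k::field, 'a::ab_group_add, 'm) vspace_scheme \<Rightarrow> ('k, 'b::ab_group_add, 'n) vspace_scheme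
      \<Rightarrow> ('a \<Rightarrow> 'b \<Rightarrow> 'k) \<Rightarrow> ('k, 'a, 'b) tensor" where
  "canonical_elt K L p = (THE u. \<exists>B d. dual_bases K L p B d \<and> u = (\<Sum>b\<in>B. b \<otimes>\<^bsub>K,L\<^esub> d b))"

definition yetter_drinfeld ::
    "('k::field, 'a::ab_group_add, 'm) hopf_scheme \<Rightarrow> ('k, 'b::ab_group_add, 'n) hopf_scheme
      \<Rightarrow> ('a \<Rightarrow> 'b \<Rightarrow> 'k) \<Rightarrow> ('k, 'y::ab_group_add, 'p) alg_scheme
      \<Rightarrow> ('y \<Rightarrow> ('k, 'a, 'y) tensor) \<Rightarrow> ('y \<Rightarrow> ('k, 'b, 'y) tensor) \<Rightarrow> bool" where
  "yetter_drinfeld K L p Y \<alpha> \<beta> \<longleftrightarrow>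
     left_coaction (hopf_op K) Y \<alpha> \<and> left_coaction L Y \<beta> \<and>
     (let A = tensor_alg (hopf_op K) L; U = canonical_elt (hopf_op K) L p
      in (\<forall>y\<in>vcar Y.
        tmap L Y L (tensor_vs (hopf_op K) Y) id \<alpha> (\<beta> y)
          = tassoc L (hopf_op K) Y
              (tmap A Y (tensor_vs L (hopf_op K)) Y (tflip (hopf_op K) L) id
                (tmap A Y A Y (alg_Ad A U) id
                  (tassoc_inv (hopf_op K) L Y
                    (tmap (hopf_op K) Y (hopf_op K) (tensor_vs L Y) id \<beta> (\<alpha> y)))))))"

definition heisenberg_alg ::
    "('k::field, 'a::ab_group_add, 'm) hopf_scheme \<Rightarrow> ('k, 'b::ab_group_add, 'n) hopf_scheme
      \<Rightarrow> ('a \<Rightarrow> 'b \<Rightarrow> 'k) \<Rightarrow> ('k, ('k, 'a, 'b) tensor) alg" where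
  "heisenberg_alg K L p =
     \<lparr>vcar = vcar (tensor_vs K L), vscale = pscale,
      amult = (\<lambda>s t.
        tlift K L (\<lambda>k \<theta>. tlift K L (\<lambda>k' \<theta>'.
          tlift K K (\<lambda>k1 k2. tlift L L (\<lambda>\<theta>1 \<theta>2.
            pscale (p k2 \<theta>1) ((k \<cdot>\<^bsub>K\<^esub> k1) \<otimes>\<^bsub>K,L\<^esub> (\<theta>2 \<cdot>\<^bsub>L\<^esub> \<theta>')))
          (comult L \<theta>)) (comult K k')) t) s),
      aone = \<one>\<^bsub>K\<^esub> \<otimes>\<^bsub>K,L\<^esub> \<one>\<^bsub>L\<^esub>\<rparr>"

definition braided_commutative ::
    "('k::field, 'a::ab_group_add, 'm) hopf_scheme \<Rightarrow> ('k, 'b::ab_group_add, 'n) hopf_scheme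
      \<Rightarrow> ('a \<Rightarrow> 'b \<Rightarrow> 'k) \<Rightarrow> ('k, 'y::ab_group_add, 'p) alg_scheme
      \<Rightarrow> ('y \<Rightarrow> ('k, 'a, 'y) tensor) \<Rightarrow> ('y \<Rightarrow> ('k, 'b, 'y) tensor) \<Rightarrow> bool" where
  "braided_commutative K L p Y \<alpha> \<beta> \<longleftrightarrow>
     yetter_drinfeld K L p Y \<alpha> \<beta> \<and>
     (let E = heisenberg_alg K L p;
          M = tensor_alg E (alg_op Y);
          a = (\<lambda>x. tmap (hopf_op K) Y E (alg_op Y) (\<lambda>k. k \<otimes>\<^bsub>K,L\<^esub> \<one>\<^bsub>L\<^esub>) id (\<alpha> x));
          b = (\<lambda>y. tmap L Y E (alg_op Y) (\<lambda>\<theta>. \<one>\<^bsub>K\<^esub> \<otimes>\<^bsub>K,L\<^esub> antipode L \<theta>) id (\<beta> y))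
      in (\<forall>x\<in>vcar Y. \<forall>y\<in>vcar Y. a x \<cdot>\<^bsub>M\<^esub> b y = b y \<cdot>\<^bsub>M\<^esub> a x))"

text \<open>The co-opposite \<open>x\<^sup>o\<^sup>p \<mapsto> S\<^sub>K(x\<^sub>-\<^sub>1) \<otimes> x\<^sub>0\<^sup>o\<^sup>p\<close> of a coaction of \<open>K\<close>.  For the opposite of \<open>H\<close> in the
  place of \<open>K\<close>, the antipode \<open>S\<^sub>K\<close> is the inverse of that of \<open>H\<close>.\<close>

definition coop_coaction ::
    "('k::field, 'a::ab_group_add, 'm) hopf_scheme \<Rightarrow> ('k, 'y::ab_group_add, 'n) alg_scheme
      \<Rightarrow> ('y \<Rightarrow> ('k, 'a, 'y) tensor) \<Rightarrow> 'y \<Rightarrow> ('k, 'a, 'y) tensor" where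
  "coop_coaction K Y \<alpha> = (\<lambda>x. tmap K Y K (alg_op Y) (antipode K) id (\<alpha> x))"

definition beta_op ::
    "('k::field, 'a::ab_group_add, 'm) hopf_scheme \<Rightarrow> ('k, 'y::ab_group_add, 'n) alg_scheme
      \<Rightarrow> ('y \<Rightarrow> ('k, 'a \<Rightarrow> 'k, 'y) tensor) \<Rightarrow> 'y \<Rightarrow> ('k, 'a \<Rightarrow> 'k, 'y) tensor" where
  "beta_op H X \<beta> =
     (\<lambda>x. tmap (hopf_dual H) (alg_op X) (hopf_op (hopf_dual H)) (alg_op X)
        (inv_into (vcar (hopf_dual H)) (antipode (hopf_dual H))) id (coop_coaction (hopf_dual H) X \<beta> x))"

definition alpha_op ::
    "('k::field, 'a::ab_group_add, 'm) hopf_scheme \<Rightarrow> ('k, 'y::ab_group_add, 'n) alg_scheme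
      \<Rightarrow> ('y \<Rightarrow> ('k, 'a, 'y) tensor) \<Rightarrow> 'y \<Rightarrow> ('k, 'a, 'y) tensor" where
  "alpha_op H X \<alpha> =
     (\<lambda>x. tmap (hopf_op H) (alg_op X) H (alg_op X) (antipode H) id (coop_coaction (hopf_op H) X \<alpha> x))"

end

theory Submission
  imports Defs
begin

text \<open>Write \<open>L\<close> for the dual of \<open>H\<close>, \<open>S\<close> for both antipodes, and \<open>x\<^sub>1 \<otimes> x\<^sub>2\<close> for coproducts.

  The opposite coactions are \<open>\<alpha>\<close> and \<open>\<beta>\<close> themselves, read with values in the tensor products of the
  opposite algebras: in each of them an antipode and an inverse antipode cancel, because the antipode of
  a finite-dimensional Hopf algebra is bijective.  That they are coactions is then immediate
  (\<open>left_coaction_op\<close>), and the two equivalences compare two readings of the same data.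

  For the Yetter--Drinfeld condition, the flip is an anti-isomorphism from \<open>H\<^sup>o\<^sup>p \<otimes> L\<close> to
  \<open>L\<^sup>o\<^sup>p \<otimes> H\<close> (\<open>tflip_antihom\<close>) and takes the canonical element \<open>U\<close> of the pair \<open>(H, L)\<close> to that of
  \<open>(L, H)\<close> (\<open>canonical_elt_flip\<close>).  An anti-isomorphism turns conjugation by \<open>U\<close> into conjugation by the
  inverse, so one condition says that \<open>Ad(U)\<close> takes \<open>Q\<close> to the flip of \<open>P\<close>, and the other that \<open>Ad(U)\<inverse>\<close>
  takes the flip of \<open>P\<close> to \<open>Q\<close> (\<open>yd_equation_flip\<close>).  This needs \<open>U\<close> to be invertible.  Evaluation of the second
  leg identifies \<open>H\<^sup>o\<^sup>p \<otimes> L\<close> with the linear maps \<open>H \<rightarrow> H\<^sup>o\<^sup>p\<close> under convolution; \<open>U\<close> becomes the identity map,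
  whose convolution inverse is \<open>S\<inverse>\<close> (\<open>canonical_elt_invertible\<close>).

  For braided commutativity, let \<open>\<alpha>(x)\<close> be a sum of terms \<open>k \<otimes> u\<close> and \<open>\<beta>(y)\<close> a sum of terms \<open>\<theta> \<otimes> v\<close>.
  Since antipodes reverse coproducts, a bijective antipode can be cancelled from one leg of the commutation relation
  for \<open>(x, y)\<close>, which leaves the equation
    \<open>k \<otimes> \<theta> \<otimes> v u = \<theta>\<^sub>2(S k\<^sub>2) k\<^sub>1 \<otimes> \<theta>\<^sub>1 \<otimes> u v\<close>
  (\<open>braided_commute_iff\<close>).  The relation for the opposite coactions and \<open>(y, x)\<close> leaves the same
  equation with the first two legs exchanged, because \<open>(S \<theta>)(k) = \<theta>(S k)\<close>.

  The bijectivity of \<open>S\<close> is the theorem of Larson and Sweedler, and the deepest ingredient.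
  For a functional \<open>f\<close>, the functional \<open>\<lambda>(g) = Tr (x \<mapsto> g S\<^sup>2(x\<^sub>1) f(x\<^sub>2))\<close> is an invariant integral
  (\<open>integral_invariant\<close>), and some \<open>f\<close> gives a nonzero \<open>\<lambda>\<close> (\<open>ex_nonzero_integral\<close>).
  Invariance implies \<open>\<lambda>(g) h = 0\<close> for all \<open>g\<close> whenever \<open>S h = 0\<close>
  (\<open>integral_kills_antipode_kernel\<close>), so \<open>S\<close> is injective, and a dimension count makes it bijective.\<close>

section \<open>Linear maps\<close>

lemma is_vspace_cong:
  "vcar V = vcar V' \<Longrightarrow> vscale V = vscale V' \<Longrightarrow> is_vspace V \<longleftrightarrow> is_vspace V'"
  by (simp add: is_vspace_def)

lemma is_vspace_ground [simp]: "is_vspace ground_vs"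
proof -
  have v: "vector_space ((*) :: 'a \<Rightarrow> 'a \<Rightarrow> 'a)"
    by unfold_locales (auto simp: algebra_simps)
  then show ?thesis
    by (simp add: is_vspace_def ground_vs_def module.subspace_UNIV vector_space_def module_def)
qed

lemma lin_mapD:
  assumes "lin_map V W f"
  shows "x \<in> vcar V \<Longrightarrow> f x \<in> vcar W"
    "x \<in> vcar V \<Longrightarrow> y \<in> vcar V \<Longrightarrow> f (x + y) = f x + f y"
    "x \<in> vcar V \<Longrightarrow> f (vscale V c x) = vscale W c (f x)"
  using assms unfolding lin_map_def by auto

lemma lin_mapI:
  assumes "\<And>x. x \<in> vcar V \<Longrightarrow> f x \<in> vcar W"
    "\<And>x y. x \<in> vcar V \<Longrightarrow> y \<in> vcar V \<Longrightarrow> f (x + y) = f x + f y"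
    "\<And>c x. x \<in> vcar V \<Longrightarrow> f (vscale V c x) = vscale W c (f x)"
  shows "lin_map V W f"
  using assms unfolding lin_map_def by auto

lemma lin_map_cong:
  assumes "is_vspace V" "\<And>x. x \<in> vcar V \<Longrightarrow> f x = g x"
  shows "lin_map V W f \<longleftrightarrow> lin_map V W g"
  using assms(2) unfolding lin_map_def by (auto simp: is_vspace_carrier[OF assms(1)])

lemma lin_map_0:
  assumes "is_vspace V" "lin_map V W f"
  shows "f 0 = 0"
  using lin_mapD(2)[OF assms(2), of 0 0] is_vspace_carrier(1)[OF assms(1)] by simp

lemma sum_list_in:
  assumes "is_vspace U" "\<And>x. x \<in> set ps \<Longrightarrow> F x \<in> vcar U"
  shows "(\<Sum>x\<leftarrow>ps. F x) \<in> vcar U"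
  using assms(2) by (induction ps) (auto simp: is_vspace_carrier[OF assms(1)])

lemma sum_in:
  assumes "is_vspace U" "\<And>x. x \<in> B \<Longrightarrow> F x \<in> vcar U"
  shows "(\<Sum>x\<in>B. F x) \<in> vcar U"
  using assms(2) by (induction B rule: infinite_finite_induct) (auto simp: is_vspace_carrier[OF assms(1)])

lemma lin_map_sum_list:
  assumes "is_vspace U" "lin_map U W f" "\<And>x. x \<in> set ps \<Longrightarrow> F x \<in> vcar U"
  shows "f (\<Sum>x\<leftarrow>ps. F x) = (\<Sum>x\<leftarrow>ps. f (F x))"
  using assms(3)
proof (induction ps)
  case Nil
  then show ?case using lin_map_0[OF assms(1,2)] by simp
next
  case (Cons x ps)
  then show ?case
    using lin_mapD(2)[OF assms(2), of "F x" "\<Sum>x\<leftarrow>ps. F x"] sum_list_in[OF assms(1), of ps F] by simp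
qed

lemma lin_map_sum:
  assumes "is_vspace U" "lin_map U W f" "\<And>x. x \<in> B \<Longrightarrow> F x \<in> vcar U"
  shows "f (\<Sum>x\<in>B. F x) = (\<Sum>x\<in>B. f (F x))"
  using assms(3)
proof (induction B rule: infinite_finite_induct)
  case (insert x B)
  then show ?case
    using lin_mapD(2)[OF assms(2), of "F x" "\<Sum>x\<in>B. F x"] sum_in[OF assms(1), of B F] by simp
qed (use lin_map_0[OF assms(1,2)] in auto)

lemma vscale_laws:
  assumes "is_vspace V"
  shows "vscale V c (x + y) = vscale V c x + vscale V c y"
    "vscale V (c + e) x = vscale V c x + vscale V e x"
    "vscale V c (vscale V e x) = vscale V (c * e) x"
    "vscale V 1 x = x" "vscale V 0 x = 0" "vscale V c 0 = 0"
proof -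
  interpret vector_space "vscale V" using assms by (simp add: is_vspace_def)
  show "vscale V c (x + y) = vscale V c x + vscale V c y"
    "vscale V (c + e) x = vscale V c x + vscale V e x"
    "vscale V c (vscale V e x) = vscale V (c * e) x"
    "vscale V 1 x = x" "vscale V 0 x = 0" "vscale V c 0 = 0"
    by (simp_all add: scale_right_distrib scale_left_distrib)
qed

lemma lin_id: "lin_map V V (\<lambda>x. x)"
  by (simp add: lin_map_def)

lemma lin_comp: "lin_map W U f \<Longrightarrow> lin_map V W g \<Longrightarrow> lin_map V U (\<lambda>x. f (g x))"
  by (simp add: lin_map_def)

lemma lin_inv_into:
  assumes V: "is_vspace V" and f: "lin_map V W f" and bij: "bij_betw f (vcar V) (vcar W)"
  shows "lin_map W V (inv_into (vcar V) f)"
proof -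
  let ?g = "inv_into (vcar V) f"
  have g: "?g y \<in> vcar V" "f (?g y) = y" if "y \<in> vcar W" for y
    using bij that by (auto simp: bij_betw_def inv_into_into f_inv_into_f)
  have gf: "?g (f x) = x" if "x \<in> vcar V" for x
    using bij that by (simp add: bij_betw_def)
  show ?thesis
  proof (rule lin_mapI)
    fix x y assume x: "x \<in> vcar W" and y: "y \<in> vcar W"
    have "f (?g x + ?g y) = x + y"
      unfolding lin_mapD(2)[OF f g(1)[OF x] g(1)[OF y]] g(2)[OF x] g(2)[OF y] ..
    then show "?g (x + y) = ?g x + ?g y"
      using gf[OF is_vspace_carrier(2)[OF V g(1)[OF x] g(1)[OF y]]] by simp
  next
    fix c x assume x: "x \<in> vcar W"
    have "f (vscale V c (?g x)) = vscale W c x"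
      unfolding lin_mapD(3)[OF f g(1)[OF x]] g(2)[OF x] ..
    then show "?g (vscale W c x) = vscale V c (?g x)"
      using gf[OF is_vspace_carrier(3)[OF V g(1)[OF x], of c]] by simp
  qed (rule g)
qed

lemma lin_add:
  assumes "is_vspace W" "lin_map V W f" "lin_map V W g"
  shows "lin_map V W (\<lambda>x. f x + g x)"
  using assms(2,3) unfolding lin_map_def
  by (auto simp: is_vspace_carrier[OF assms(1)] vscale_laws[OF assms(1)])

lemma lin_sum_list:
  assumes "is_vspace W" "\<And>i. i \<in> set ps \<Longrightarrow> lin_map V W (\<lambda>x. F x i)"
  shows "lin_map V W (\<lambda>x. \<Sum>i\<leftarrow>ps. F x i)"
  using assms(2)
proof (induction ps)
  case Nil
  then show ?case by (auto intro!: lin_mapI simp: is_vspace_carrier[OF assms(1)] vscale_laws[OF assms(1)])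
next
  case (Cons i ps)
  then show ?case by (simp add: lin_add[OF assms(1)])
qed

lemma lin_sum:
  assumes "is_vspace W" "\<And>i. i \<in> B \<Longrightarrow> lin_map V W (\<lambda>x. F x i)"
  shows "lin_map V W (\<lambda>x. \<Sum>i\<in>B. F x i)"
proof (cases "finite B")
  case True
  then obtain ps where "B = set ps" "distinct ps" using finite_distinct_list by blast
  then show ?thesis using lin_sum_list[OF assms(1), of ps V F] assms(2)
    by (simp add: sum_list_distinct_conv_sum_set)
next
  case False
  then show ?thesis by (auto intro!: lin_mapI simp: is_vspace_carrier[OF assms(1)] vscale_laws[OF assms(1)])
qed

lemma lin_scale_left:
  assumes "is_vspace W" "lin_map V ground_vs g" "w \<in> vcar W"
  shows "lin_map V W (\<lambda>x. vscale W (g x) w)"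
  using assms(2,3) unfolding lin_map_def ground_vs_def
  by (auto simp: vscale_laws[OF assms(1)] is_vspace_carrier[OF assms(1)])

lemma lin_scale_right:
  assumes "is_vspace W" "lin_map V W g"
  shows "lin_map V W (\<lambda>x. vscale W c (g x))"
  using assms(2) unfolding lin_map_def
  by (auto simp: vscale_laws[OF assms(1)] is_vspace_carrier[OF assms(1)] mult.commute)

lemma lin_times_left:
  "lin_map V ground_vs g \<Longrightarrow> lin_map V ground_vs (\<lambda>x. g x * c)"
  "lin_map V ground_vs g \<Longrightarrow> lin_map V ground_vs (\<lambda>x. c * g x)"
  by (auto simp: lin_map_def ground_vs_def algebra_simps)

lemma bilin_mapI:
  assumes "\<And>v. v \<in> vcar V \<Longrightarrow> lin_map W U (\<lambda>w. f v w)"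
    "\<And>w. w \<in> vcar W \<Longrightarrow> lin_map V U (\<lambda>v. f v w)"
  shows "bilin_map V W U f"
  using assms by (simp add: bilin_map_def)

lemma bilin_mapD:
  assumes "bilin_map V W U f"
  shows "v \<in> vcar V \<Longrightarrow> lin_map W U (\<lambda>w. f v w)" "w \<in> vcar W \<Longrightarrow> lin_map V U (\<lambda>v. f v w)"
    "v \<in> vcar V \<Longrightarrow> w \<in> vcar W \<Longrightarrow> f v w \<in> vcar U"
  using assms by (auto simp: bilin_map_def lin_map_def)

section \<open>Sums over tensors\<close>

lemma ten_cong:
  assumes "vcar V = vcar V'" "vscale V = vscale V'" "vcar W = vcar W'" "vscale W = vscale W'"
  shows "v \<otimes>\<^bsub>V,W\<^esub> w = v \<otimes>\<^bsub>V',W'\<^esub> w"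
  using assms by (simp add: ten_def bilin_map_def lin_map_def)

lemma tensor_vs_cong:
  assumes "vcar V = vcar V'" "vscale V = vscale V'" "vcar W = vcar W'" "vscale W = vscale W'"
  shows "tensor_vs V W = tensor_vs V' W'"
  using assms by (simp add: tensor_vs_def ten_cong[OF assms])

lemma tlift_cong:
  assumes "vcar V = vcar V'" "vscale V = vscale V'" "vcar W = vcar W'" "vscale W = vscale W'"
  shows "tlift V W = tlift V' W'"
  using assms by (simp add: tlift_def ten_cong[OF assms] fun_eq_iff)

lemma vscale_tensor_vs [simp]: "vscale (tensor_vs V W) = pscale"
  by (simp add: tensor_vs_def)

lemma ten_in:
  assumes "is_vspace V" "is_vspace W" "v \<in> vcar V" "w \<in> vcar W"
  shows "v \<otimes>\<^bsub>V,W\<^esub> w \<in> vcar (tensor_vs V W)"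
  unfolding tensor_vs_rep[OF assms(1,2)] using assms(3,4) by (intro exI[of _ "[(v, w)]"]) auto

lemma lin_ten_left:
  assumes "is_vspace W" "is_vspace Z" "lin_map V W g" "z \<in> vcar Z"
  shows "lin_map V (tensor_vs W Z) (\<lambda>x. g x \<otimes>\<^bsub>W,Z\<^esub> z)"
  using assms(3,4) unfolding lin_map_def
  by (auto simp: ten_linear[OF assms(1,2)] ten_in[OF assms(1,2)] simp del: plus_fun_apply)

lemma lin_ten_right:
  assumes "is_vspace W" "is_vspace Z" "lin_map V Z g" "w \<in> vcar W"
  shows "lin_map V (tensor_vs W Z) (\<lambda>x. w \<otimes>\<^bsub>W,Z\<^esub> g x)"
  using assms(3,4) unfolding lin_map_def
  by (auto simp: ten_linear[OF assms(1,2)] ten_in[OF assms(1,2)] simp del: plus_fun_apply)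

lemma bilin_ten: "is_vspace V \<Longrightarrow> is_vspace W \<Longrightarrow> bilin_map V W (tensor_vs V W) (\<lambda>v w. v \<otimes>\<^bsub>V,W\<^esub> w)"
  by (intro bilin_mapI lin_ten_left lin_ten_right lin_id)

text \<open>A tensor is handled as a sum over some decomposition of it into pure tensors.  For a bilinear summand
  this is the linear extension (\<open>tlift_tsum\<close>) and does not depend on the decomposition.  For every
  summand it is a finite sum, so that such sums can be interchanged, and linear maps pulled through them,
  before any bilinearity is known.  This is what makes Sweedler notation usable as a calculus.\<close>

definition trep ::
    "('k::field, 'a::ab_group_add, 'm) vspace_scheme \<Rightarrow> ('k, 'b::ab_group_add, 'n) vspace_scheme
      \<Rightarrow> ('k, 'a, 'b) tensor \<Rightarrow> ('a \<times> 'b) list" where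
  "trep V W t = (SOME ps. set ps \<subseteq> vcar V \<times> vcar W \<and> t = (\<Sum>(v, w)\<leftarrow>ps. v \<otimes>\<^bsub>V,W\<^esub> w))"

definition tsum ::
    "('k::field, 'a::ab_group_add, 'm) vspace_scheme \<Rightarrow> ('k, 'b::ab_group_add, 'n) vspace_scheme
      \<Rightarrow> ('k, 'a, 'b) tensor \<Rightarrow> ('a \<Rightarrow> 'b \<Rightarrow> 'c::ab_group_add) \<Rightarrow> 'c" where
  "tsum V W t F = (\<Sum>(v, w)\<leftarrow>trep V W t. F v w)"

lemma tsum_space_cong:
  assumes "vcar V = vcar V'" "vscale V = vscale V'" "vcar W = vcar W'" "vscale W = vscale W'"
  shows "tsum V W = tsum V' W'"
  using assms by (simp add: tsum_def trep_def ten_cong[OF assms] fun_eq_iff)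

lemma trep:
  assumes "is_vspace V" "is_vspace W" "t \<in> vcar (tensor_vs V W)"
  shows "set (trep V W t) \<subseteq> vcar V \<times> vcar W" "(\<Sum>(v, w)\<leftarrow>trep V W t. v \<otimes>\<^bsub>V,W\<^esub> w) = t"
  using someI_ex[OF assms(3)[unfolded tensor_vs_rep[OF assms(1,2)]]] unfolding trep_def by simp_all

lemma tlift_tsum:
  assumes "is_vspace V" "is_vspace W" "t \<in> vcar (tensor_vs V W)" "is_vspace U" "bilin_map V W U F"
  shows "tlift V W F t = tsum V W t F"
  using tlift_sum_list[OF assms(1,2,4,5) trep(1)[OF assms(1-3)]] trep(2)[OF assms(1-3)]
  by (simp add: tsum_def)

lemma tsum_ten:
  assumes "is_vspace V" "is_vspace W" "t \<in> vcar (tensor_vs V W)"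
  shows "tsum V W t (\<lambda>v w. v \<otimes>\<^bsub>V,W\<^esub> w) = t"
  using trep(2)[OF assms] by (simp add: tsum_def)

lemma tsum_cong:
  assumes "is_vspace V" "is_vspace W" "t \<in> vcar (tensor_vs V W)"
    "\<And>v w. v \<in> vcar V \<Longrightarrow> w \<in> vcar W \<Longrightarrow> F v w = G v w"
  shows "tsum V W t F = tsum V W t G"
  unfolding tsum_def using trep(1)[OF assms(1-3)] assms(4)
  by (intro arg_cong[of _ _ sum_list] map_cong) auto

lemma tsum_in:
  assumes "is_vspace V" "is_vspace W" "t \<in> vcar (tensor_vs V W)" "is_vspace U"
    "\<And>v w. v \<in> vcar V \<Longrightarrow> w \<in> vcar W \<Longrightarrow> F v w \<in> vcar U"
  shows "tsum V W t F \<in> vcar U"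
  unfolding tsum_def using trep(1)[OF assms(1-3)] assms(5)
  by (intro sum_list_in[OF assms(4)]) auto

lemma lin_map_tsum:
  assumes "lin_map U U' f" "is_vspace V" "is_vspace W" "t \<in> vcar (tensor_vs V W)" "is_vspace U"
    "\<And>v w. v \<in> vcar V \<Longrightarrow> w \<in> vcar W \<Longrightarrow> F v w \<in> vcar U"
  shows "f (tsum V W t F) = tsum V W t (\<lambda>v w. f (F v w))"
proof -
  have "f (tsum V W t F) = (\<Sum>x\<leftarrow>trep V W t. f (case x of (v, w) \<Rightarrow> F v w))"
    unfolding tsum_def using trep(1)[OF assms(2-4)] assms(6)
    by (intro lin_map_sum_list[OF assms(5,1)]) auto
  then show ?thesis by (simp add: tsum_def case_prod_unfold)
qed

lemma sum_list_sum_list_swap: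
  "(\<Sum>x\<leftarrow>xs. \<Sum>y\<leftarrow>ys. f x y) = (\<Sum>y\<leftarrow>ys. \<Sum>x\<leftarrow>xs. (f x y :: 'a::ab_group_add))"
  by (induction xs) (simp_all add: sum_list_addf)

lemma tsum_swap:
  "tsum V W t (\<lambda>a b. tsum V' W' s (\<lambda>c e. F a b c e)) = tsum V' W' s (\<lambda>c e. tsum V W t (\<lambda>a b. F a b c e))"
  unfolding tsum_def case_prod_unfold by (rule sum_list_sum_list_swap)

lemma tsum_sum:
  "tsum V W t (\<lambda>a b. \<Sum>i\<in>B. F a b i) = (\<Sum>i\<in>B. tsum V W t (\<lambda>a b. F a b i))"
proof (induction B rule: infinite_finite_induct)
  case (insert x B)
  then show ?case by (simp add: tsum_def case_prod_unfold sum_list_addf)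
qed (simp_all add: tsum_def case_prod_unfold)

lemma lin_tsum:
  assumes "is_vspace V" "is_vspace W" "is_vspace U" "bilin_map V W U F"
  shows "lin_map (tensor_vs V W) U (\<lambda>t. tsum V W t F)"
proof -
  have "lin_map (tensor_vs V W) U (tlift V W F) \<longleftrightarrow> lin_map (tensor_vs V W) U (\<lambda>t. tsum V W t F)"
    by (rule lin_map_cong[OF is_vspace_tensor_vs]) (rule tlift_tsum[OF assms(1,2) _ assms(3,4)])
  then show ?thesis using tlift_lin_map[OF assms] by simp
qed

lemma tsum_pure:
  assumes "is_vspace V" "is_vspace W" "is_vspace U" "bilin_map V W U F" "v \<in> vcar V" "w \<in> vcar W"
  shows "tsum V W (v \<otimes>\<^bsub>V,W\<^esub> w) F = F v w"
  using tlift_tsum[OF assms(1,2) ten_in[OF assms(1,2,5,6)] assms(3,4)] tlift_ten[OF assms] by simp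

lemma lin_tsum_param:
  assumes "is_vspace U" "is_vspace V" "is_vspace W" "t \<in> vcar (tensor_vs V W)"
    "\<And>a b. a \<in> vcar V \<Longrightarrow> b \<in> vcar W \<Longrightarrow> lin_map Z U (\<lambda>x. F x a b)"
  shows "lin_map Z U (\<lambda>x. tsum V W t (\<lambda>a b. F x a b))"
  unfolding tsum_def using trep(1)[OF assms(2-4)] assms(5)
  by (intro lin_sum_list[OF assms(1)]) auto

lemma tsum_tsum:
  assumes "is_vspace V" "is_vspace W" "t \<in> vcar (tensor_vs V W)"
    "is_vspace V'" "is_vspace W'" "is_vspace U" "bilin_map V' W' U G"
    "\<And>v w. v \<in> vcar V \<Longrightarrow> w \<in> vcar W \<Longrightarrow> F v w \<in> vcar (tensor_vs V' W')"
  shows "tsum V' W' (tsum V W t F) G = tsum V W t (\<lambda>v w. tsum V' W' (F v w) G)"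
  by (rule lin_map_tsum[OF lin_tsum[OF assms(4-7)] assms(1-3) is_vspace_tensor_vs assms(8)])

lemma tmap_tsum:
  assumes "is_vspace V" "is_vspace W" "t \<in> vcar (tensor_vs V W)" "is_vspace V'" "is_vspace W'"
    "lin_map V V' f" "lin_map W W' g"
  shows "tmap V W V' W' f g t = tsum V W t (\<lambda>v w. f v \<otimes>\<^bsub>V',W'\<^esub> g w)"
  unfolding tmap_def using assms(6,7)
  by (intro tlift_tsum[OF assms(1-3) is_vspace_tensor_vs[of V' W']] bilin_mapI lin_ten_left lin_ten_right assms)
    (auto simp: lin_mapD)

section \<open>Algebras\<close>

lemma lin_map_space_cong:
  assumes "vcar V = vcar V'" "vscale V = vscale V'" "vcar W = vcar W'" "vscale W = vscale W'"
  shows "lin_map V W f \<longleftrightarrow> lin_map V' W' f"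
  using assms by (simp add: lin_map_def)

lemma algebraD:
  assumes "algebra A"
  shows "is_vspace A" "bilin_map A A A (amult A)" "\<one>\<^bsub>A\<^esub> \<in> vcar A"
    "x \<in> vcar A \<Longrightarrow> y \<in> vcar A \<Longrightarrow> z \<in> vcar A \<Longrightarrow> (x \<cdot>\<^bsub>A\<^esub> y) \<cdot>\<^bsub>A\<^esub> z = x \<cdot>\<^bsub>A\<^esub> (y \<cdot>\<^bsub>A\<^esub> z)"
    "x \<in> vcar A \<Longrightarrow> \<one>\<^bsub>A\<^esub> \<cdot>\<^bsub>A\<^esub> x = x" "x \<in> vcar A \<Longrightarrow> x \<cdot>\<^bsub>A\<^esub> \<one>\<^bsub>A\<^esub> = x"
    "x \<in> vcar A \<Longrightarrow> y \<in> vcar A \<Longrightarrow> x \<cdot>\<^bsub>A\<^esub> y \<in> vcar A"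
    "x \<in> vcar A \<Longrightarrow> y \<in> vcar A \<Longrightarrow> vscale A c x \<cdot>\<^bsub>A\<^esub> y = vscale A c (x \<cdot>\<^bsub>A\<^esub> y)"
    "x \<in> vcar A \<Longrightarrow> y \<in> vcar A \<Longrightarrow> x \<cdot>\<^bsub>A\<^esub> vscale A c y = vscale A c (x \<cdot>\<^bsub>A\<^esub> y)"
  using assms unfolding algebra_def bilin_map_def lin_map_def by blast+

text \<open>Products in a tensor product are computed from bilinearity alone, so the formulas below also apply
  when one of the factors is the smash product of a Heisenberg algebra, known through its product formula.\<close>

definition bilin_algebra :: "('k::field, 'a::ab_group_add, 'm) alg_scheme \<Rightarrow> bool" where
  "bilin_algebra A \<longleftrightarrow> is_vspace A \<and> bilin_map A A A (amult A)"

lemma bilin_algebra: "algebra A \<Longrightarrow> bilin_algebra A"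
  by (simp add: bilin_algebra_def algebra_def)

lemma bilin_algebraD:
  assumes "bilin_algebra A"
  shows "is_vspace A" "bilin_map A A A (amult A)" "x \<in> vcar A \<Longrightarrow> y \<in> vcar A \<Longrightarrow> x \<cdot>\<^bsub>A\<^esub> y \<in> vcar A"
  using assms unfolding bilin_algebra_def by (auto dest: bilin_mapD)

lemma lin_mult_left:
  assumes "bilin_algebra A" "lin_map V A g" "c \<in> vcar A"
  shows "lin_map V A (\<lambda>x. g x \<cdot>\<^bsub>A\<^esub> c)"
  using bilin_mapD(2)[OF bilin_algebraD(2)[OF assms(1)] assms(3)] assms(2) by (rule lin_comp)

lemma lin_mult_right:
  assumes "bilin_algebra A" "lin_map V A g" "c \<in> vcar A"
  shows "lin_map V A (\<lambda>x. c \<cdot>\<^bsub>A\<^esub> g x)"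
  using bilin_mapD(1)[OF bilin_algebraD(2)[OF assms(1)] assms(3)] assms(2) by (rule lin_comp)

lemma algebra_cong:
  assumes "vcar A = vcar B" "vscale A = vscale B" "\<one>\<^bsub>A\<^esub> = \<one>\<^bsub>B\<^esub>"
    "\<And>x y. x \<in> vcar A \<Longrightarrow> y \<in> vcar A \<Longrightarrow> x \<cdot>\<^bsub>A\<^esub> y = x \<cdot>\<^bsub>B\<^esub> y"
    and "algebra A"
  shows "algebra B"
proof -
  note A = algebraD[OF assms(5)]
  have c: "x + y \<in> vcar A" "vscale A c x \<in> vcar A" if "x \<in> vcar A" "y \<in> vcar A" for c x y
    using that is_vspace_carrier[OF A(1)] by auto
  have eq: "x \<cdot>\<^bsub>B\<^esub> y = x \<cdot>\<^bsub>A\<^esub> y" if "x \<in> vcar A" "y \<in> vcar A" for x y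
    using assms(4)[OF that] by simp
  have "bilin_map A A A (amult B)"
    using A(2) unfolding bilin_map_def lin_map_def by (simp add: eq c)
  then have "bilin_map B B B (amult B)"
    unfolding bilin_map_def lin_map_def assms(1,2) .
  moreover have "is_vspace B" using A(1) unfolding is_vspace_def assms(1,2) .
  ultimately show ?thesis
    using A(3-7) unfolding algebra_def assms(1)[symmetric] assms(3)[symmetric] by (simp add: eq)
qed

lemma algebra_ground: "algebra (ground_alg :: ('k::field, 'k) alg)"
proof -
  have "is_vspace (ground_alg :: ('k, 'k) alg) \<longleftrightarrow> is_vspace (ground_vs :: ('k, 'k) vspace)"
    by (rule is_vspace_cong) (simp_all add: ground_alg_def ground_vs_def)
  then have "is_vspace (ground_alg :: ('k, 'k) alg)" by simp
  then show ?thesis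
    by (simp add: algebra_def bilin_map_def lin_map_def algebra_simps) (simp add: ground_alg_def algebra_simps)
qed

text \<open>Identities for the antipode, and the uniqueness of inverses, come down to this fact applied in a
  convolution algebra.\<close>

lemma left_inverse_eq_right_inverse:
  assumes "algebra A" "f \<in> vcar A" "m \<in> vcar A" "g \<in> vcar A"
    "f \<cdot>\<^bsub>A\<^esub> m = \<one>\<^bsub>A\<^esub>" "m \<cdot>\<^bsub>A\<^esub> g = \<one>\<^bsub>A\<^esub>"
  shows "f = g"
  using algebraD(4-6)[OF assms(1)] assms(2-6) by metis

subsection \<open>Opposite algebras\<close>

lemma alg_op_simps [simp]:
  "vcar (alg_op A) = vcar A" "vscale (alg_op A) = vscale A" "\<one>\<^bsub>alg_op A\<^esub> = \<one>\<^bsub>A\<^esub>"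
  "x \<cdot>\<^bsub>alg_op A\<^esub> y = y \<cdot>\<^bsub>A\<^esub> x" "alg_op (alg_op A) = A"
  by (simp_all add: alg_op_def)

lemma hopf_op_simps [simp]:
  "vcar (hopf_op A) = vcar A" "vscale (hopf_op A) = vscale A" "\<one>\<^bsub>hopf_op A\<^esub> = \<one>\<^bsub>A\<^esub>"
  "x \<cdot>\<^bsub>hopf_op A\<^esub> y = y \<cdot>\<^bsub>A\<^esub> x" "comult (hopf_op A) = comult A" "counit (hopf_op A) = counit A"
  by (simp_all add: hopf_op_def)

lemma algebra_hopf_op: "algebra A \<Longrightarrow> algebra (hopf_op A)"
  by (auto simp: algebra_def bilin_map_def lin_map_def is_vspace_def)

lemma algebra_alg_op: "algebra A \<Longrightarrow> algebra (alg_op A)"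
  by (auto simp: algebra_def bilin_map_def lin_map_def is_vspace_def)

subsection \<open>Tensor products of algebras\<close>

lemma tensor_alg_simps [simp]:
  "vcar (tensor_alg A B) = vcar (tensor_vs A B)" "vscale (tensor_alg A B) = pscale"
  "\<one>\<^bsub>tensor_alg A B\<^esub> = \<one>\<^bsub>A\<^esub> \<otimes>\<^bsub>A,B\<^esub> \<one>\<^bsub>B\<^esub>"
  by (simp_all add: tensor_alg_def)

lemma is_vspace_tensor_alg [simp]: "is_vspace (tensor_alg A B)"
  using is_vspace_tensor_vs[of A B] is_vspace_cong[of "tensor_alg A B" "tensor_vs A B"] by simp

lemma lin_map_tensor_alg: "lin_map V (tensor_alg A B) f \<longleftrightarrow> lin_map V (tensor_vs A B) f"
  by (rule lin_map_space_cong) auto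

context
  fixes A :: "('k::field, 'a::ab_group_add, 'm) alg_scheme"
    and B :: "('k, 'b::ab_group_add, 'n) alg_scheme"
  assumes A: "bilin_algebra A" and B: "bilin_algebra B"
begin

lemmas AB_vs = bilin_algebraD(1)[OF A] bilin_algebraD(1)[OF B]

lemma tensor_mult_bilin:
  assumes "a \<in> vcar A" "b \<in> vcar B"
  shows "bilin_map A B (tensor_vs A B) (\<lambda>a' b'. (a \<cdot>\<^bsub>A\<^esub> a') \<otimes>\<^bsub>A,B\<^esub> (b \<cdot>\<^bsub>B\<^esub> b'))"
    "bilin_map A B (tensor_vs A B) (\<lambda>a' b'. (a' \<cdot>\<^bsub>A\<^esub> a) \<otimes>\<^bsub>A,B\<^esub> (b' \<cdot>\<^bsub>B\<^esub> b))"
  using assms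
  by (auto intro!: bilin_mapI lin_ten_left lin_ten_right lin_mult_left lin_mult_right lin_id A B AB_vs
      simp: bilin_algebraD[OF A] bilin_algebraD[OF B])

lemma tensor_mult_bilin2:
  assumes "t \<in> vcar (tensor_vs A B)"
  shows "bilin_map A B (tensor_vs A B)
    (\<lambda>a b. tsum A B t (\<lambda>a' b'. (a \<cdot>\<^bsub>A\<^esub> a') \<otimes>\<^bsub>A,B\<^esub> (b \<cdot>\<^bsub>B\<^esub> b')))"
  using assms
  by (auto intro!: bilin_mapI lin_tsum_param lin_ten_left lin_ten_right lin_mult_left lin_mult_right lin_id A B AB_vs
      is_vspace_tensor_vs simp: bilin_algebraD[OF A] bilin_algebraD[OF B])

lemma tensor_mult:
  assumes "s \<in> vcar (tensor_vs A B)" "t \<in> vcar (tensor_vs A B)"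
  shows "s \<cdot>\<^bsub>tensor_alg A B\<^esub> t
    = tsum A B s (\<lambda>a b. tsum A B t (\<lambda>a' b'. (a \<cdot>\<^bsub>A\<^esub> a') \<otimes>\<^bsub>A,B\<^esub> (b \<cdot>\<^bsub>B\<^esub> b')))"
proof -
  have *: "tlift A B (\<lambda>a' b'. (a \<cdot>\<^bsub>A\<^esub> a') \<otimes>\<^bsub>A,B\<^esub> (b \<cdot>\<^bsub>B\<^esub> b')) t
    = tsum A B t (\<lambda>a' b'. (a \<cdot>\<^bsub>A\<^esub> a') \<otimes>\<^bsub>A,B\<^esub> (b \<cdot>\<^bsub>B\<^esub> b'))" if "a \<in> vcar A" "b \<in> vcar B" for a b
    by (rule tlift_tsum[OF AB_vs assms(2) is_vspace_tensor_vs tensor_mult_bilin(1)[OF that]])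
  let ?F = "\<lambda>a b. tlift A B (\<lambda>a' b'. (a \<cdot>\<^bsub>A\<^esub> a') \<otimes>\<^bsub>A,B\<^esub> (b \<cdot>\<^bsub>B\<^esub> b')) t"
  have "lin_map A (tensor_vs A B) (\<lambda>a. ?F a b)" if "b \<in> vcar B" for b
    using bilin_mapD(2)[OF tensor_mult_bilin2[OF assms(2)] that] that
    by (subst lin_map_cong[OF AB_vs(1) *]) auto
  moreover have "lin_map B (tensor_vs A B) (\<lambda>b. ?F a b)" if "a \<in> vcar A" for a
    using bilin_mapD(1)[OF tensor_mult_bilin2[OF assms(2)] that] that
    by (subst lin_map_cong[OF AB_vs(2) *]) auto
  ultimately have "bilin_map A B (tensor_vs A B) ?F"
    by (intro bilin_mapI)
  then have "s \<cdot>\<^bsub>tensor_alg A B\<^esub> t = tsum A B s ?F"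
    by (simp add: tensor_alg_def tlift_tsum[OF AB_vs assms(1) is_vspace_tensor_vs])
  also have "\<dots> = tsum A B s (\<lambda>a b. tsum A B t (\<lambda>a' b'. (a \<cdot>\<^bsub>A\<^esub> a') \<otimes>\<^bsub>A,B\<^esub> (b \<cdot>\<^bsub>B\<^esub> b')))"
    by (rule tsum_cong[OF AB_vs assms(1)]) (rule *)
  finally show ?thesis .
qed

lemma tensor_mult_in:
  assumes "s \<in> vcar (tensor_vs A B)" "t \<in> vcar (tensor_vs A B)"
  shows "s \<cdot>\<^bsub>tensor_alg A B\<^esub> t \<in> vcar (tensor_vs A B)"
  using assms
  by (simp add: tensor_mult) 
    (auto intro!: tsum_in AB_vs is_vspace_tensor_vs ten_in simp: bilin_algebraD[OF A] bilin_algebraD[OF B])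

lemma tensor_mult_ten:
  assumes "a \<in> vcar A" "b \<in> vcar B" "a' \<in> vcar A" "b' \<in> vcar B"
  shows "(a \<otimes>\<^bsub>A,B\<^esub> b) \<cdot>\<^bsub>tensor_alg A B\<^esub> (a' \<otimes>\<^bsub>A,B\<^esub> b') = (a \<cdot>\<^bsub>A\<^esub> a') \<otimes>\<^bsub>A,B\<^esub> (b \<cdot>\<^bsub>B\<^esub> b')"
proof -
  note t = ten_in[OF AB_vs assms(1,2)] ten_in[OF AB_vs assms(3,4)]
  show ?thesis
    unfolding tensor_mult[OF t]
      tsum_pure[OF AB_vs is_vspace_tensor_vs tensor_mult_bilin2[OF t(2)] assms(1,2)]
      tsum_pure[OF AB_vs is_vspace_tensor_vs tensor_mult_bilin(1)[OF assms(1,2)] assms(3,4)] ..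
qed

lemma tensor_mult_bilin_map: "bilin_map (tensor_vs A B) (tensor_vs A B) (tensor_vs A B) (amult (tensor_alg A B))"
proof (rule bilin_mapI)
  fix t assume t: "t \<in> vcar (tensor_vs A B)"
  show "lin_map (tensor_vs A B) (tensor_vs A B) (\<lambda>s. s \<cdot>\<^bsub>tensor_alg A B\<^esub> t)"
    by (subst lin_map_cong[OF is_vspace_tensor_vs tensor_mult], assumption, rule t)
      (rule lin_tsum[OF AB_vs is_vspace_tensor_vs tensor_mult_bilin2[OF t]])
  show "lin_map (tensor_vs A B) (tensor_vs A B) (\<lambda>s. t \<cdot>\<^bsub>tensor_alg A B\<^esub> s)"
    by (subst lin_map_cong[OF is_vspace_tensor_vs tensor_mult], rule t, assumption)
      (intro lin_tsum_param[OF is_vspace_tensor_vs AB_vs t] lin_tsum[OF AB_vs is_vspace_tensor_vs]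
        tensor_mult_bilin)
qed

lemma tensor_eq_on_pure:
  assumes "\<And>a b. a \<in> vcar A \<Longrightarrow> b \<in> vcar B \<Longrightarrow> f (a \<otimes>\<^bsub>A,B\<^esub> b) = g (a \<otimes>\<^bsub>A,B\<^esub> b)"
    "lin_map (tensor_vs A B) U f" "lin_map (tensor_vs A B) U g" "t \<in> vcar (tensor_vs A B)"
  shows "f t = g t"
  using lin_map_tensor_eq[OF AB_vs assms(2,3,1,4)] .

end

lemma algebra_tensor_alg:
  assumes A: "algebra A" and B: "algebra B"
  shows "algebra (tensor_alg A B)"
proof -
  note b = bilin_algebra[OF A] bilin_algebra[OF B]
  note AB_vs = algebraD(1)[OF A] algebraD(1)[OF B]
  note tensor_mult_in = tensor_mult_in[OF b] and tensor_mult_ten = tensor_mult_ten[OF b]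
    and tensor_mult_bilin_map = tensor_mult_bilin_map[OF b] and tensor_eq_on_pure = tensor_eq_on_pure[OF b]
  let ?T = "tensor_alg A B" and ?V = "tensor_vs A B"
  note in_ = ten_in[OF AB_vs] algebraD[OF A] algebraD[OF B] tensor_mult_in
  note bil = bilin_mapD[OF tensor_mult_bilin_map]
  have lr: "lin_map ?V ?V (\<lambda>s. g s \<cdot>\<^bsub>?T\<^esub> t)" "lin_map ?V ?V (\<lambda>s. t \<cdot>\<^bsub>?T\<^esub> g s)"
    if "t \<in> vcar ?V" "lin_map ?V ?V g" for t g
    using lin_comp[OF bil(2) that(2)] lin_comp[OF bil(1) that(2)] that(1) by auto
  have assoc: "(s \<cdot>\<^bsub>?T\<^esub> t) \<cdot>\<^bsub>?T\<^esub> r = s \<cdot>\<^bsub>?T\<^esub> (t \<cdot>\<^bsub>?T\<^esub> r)"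
    if s: "s \<in> vcar ?V" and t: "t \<in> vcar ?V" and r: "r \<in> vcar ?V" for s t r
  proof (rule tensor_eq_on_pure[where f = "\<lambda>s. (s \<cdot>\<^bsub>?T\<^esub> t) \<cdot>\<^bsub>?T\<^esub> r", OF _ _ _ s])
    fix a b assume ab: "a \<in> vcar A" "b \<in> vcar B"
    show "((a \<otimes>\<^bsub>A,B\<^esub> b) \<cdot>\<^bsub>?T\<^esub> t) \<cdot>\<^bsub>?T\<^esub> r = (a \<otimes>\<^bsub>A,B\<^esub> b) \<cdot>\<^bsub>?T\<^esub> (t \<cdot>\<^bsub>?T\<^esub> r)"
    proof (rule tensor_eq_on_pure[where f = "\<lambda>t. ((a \<otimes>\<^bsub>A,B\<^esub> b) \<cdot>\<^bsub>?T\<^esub> t) \<cdot>\<^bsub>?T\<^esub> r", OF _ _ _ t])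
      fix a' b' assume ab': "a' \<in> vcar A" "b' \<in> vcar B"
      show "((a \<otimes>\<^bsub>A,B\<^esub> b) \<cdot>\<^bsub>?T\<^esub> (a' \<otimes>\<^bsub>A,B\<^esub> b')) \<cdot>\<^bsub>?T\<^esub> r
          = (a \<otimes>\<^bsub>A,B\<^esub> b) \<cdot>\<^bsub>?T\<^esub> ((a' \<otimes>\<^bsub>A,B\<^esub> b') \<cdot>\<^bsub>?T\<^esub> r)"
        by (rule tensor_eq_on_pure[where t = r, OF _ _ _ r])
          (use ab ab' in \<open>auto intro!: lr lin_id simp: in_ tensor_mult_ten\<close>)
    qed (use ab r in \<open>auto intro!: lr lin_id simp: in_\<close>)
  qed (use t r in \<open>auto intro!: lr lin_id simp: in_\<close>)
  have one: "\<one>\<^bsub>?T\<^esub> \<cdot>\<^bsub>?T\<^esub> s = s \<and> s \<cdot>\<^bsub>?T\<^esub> \<one>\<^bsub>?T\<^esub> = s" if s: "s \<in> vcar ?V" for s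
    by (intro conjI, rule tensor_eq_on_pure[where t = s, OF _ _ _ s, of "\<lambda>s. \<one>\<^bsub>?T\<^esub> \<cdot>\<^bsub>?T\<^esub> s"],
        (auto intro!: lr lin_id simp: in_ tensor_mult_ten)[3],
        rule tensor_eq_on_pure[where t = s, OF _ _ _ s, of "\<lambda>s. s \<cdot>\<^bsub>?T\<^esub> \<one>\<^bsub>?T\<^esub>"],
        (auto intro!: lr lin_id simp: in_ tensor_mult_ten)[3])
  show ?thesis
    using assoc one tensor_mult_bilin_map
    by (simp add: algebra_def in_ bilin_map_def lin_map_def)
qed

section \<open>Hopf algebras\<close>

locale hopf_alg =
  fixes H :: "('k::field, 'h::ab_group_add, 'm) hopf_scheme"
  assumes hopf: "hopf_algebra H"
begin

text \<open>In Sweedler notation, \<open>sw h F\<close> is \<open>F h\<^sub>1 h\<^sub>2\<close>.\<close>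

abbreviation sw :: "'h \<Rightarrow> ('h \<Rightarrow> 'h \<Rightarrow> 'c::ab_group_add) \<Rightarrow> 'c" where
  "sw h F \<equiv> tsum H H (comult H h) F"

abbreviation product :: "'h \<Rightarrow> 'h \<Rightarrow> 'h" (infixl \<open>\<bullet>\<close> 76) where
  "x \<bullet> y \<equiv> amult H x y"

lemma alg: "algebra H"
  using hopf by (simp add: hopf_algebra_def)

lemmas balg = bilin_algebra[OF alg]

lemma vs [simp]: "is_vspace H"
  using algebraD(1)[OF alg] .

lemmas carrier = is_vspace_carrier[OF vs]
lemmas mult = algebraD(3-9)[OF alg]

lemma one_in [simp]: "\<one>\<^bsub>H\<^esub> \<in> vcar H"
  and mult_in [simp]: "x \<in> vcar H \<Longrightarrow> y \<in> vcar H \<Longrightarrow> x \<bullet> y \<in> vcar H"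
  and mult_1 [simp]: "x \<in> vcar H \<Longrightarrow> \<one>\<^bsub>H\<^esub> \<bullet> x = x" "x \<in> vcar H \<Longrightarrow> x \<bullet> \<one>\<^bsub>H\<^esub> = x"
  using mult by auto

lemma lin_counit: "lin_map H ground_vs (counit H)"
  using hopf lin_map_space_cong[of H H ground_alg ground_vs "counit H"]
  by (simp add: hopf_algebra_def alg_hom_def ground_alg_def ground_vs_def)

lemma counit_mult: "x \<in> vcar H \<Longrightarrow> y \<in> vcar H \<Longrightarrow> counit H (x \<bullet> y) = counit H x * counit H y"
  and counit_one [simp]: "counit H \<one>\<^bsub>H\<^esub> = 1"
  using hopf by (simp_all add: hopf_algebra_def alg_hom_def ground_alg_def)

lemma lin_comult: "lin_map H (tensor_vs H H) (comult H)"
  using hopf by (simp add: hopf_algebra_def alg_hom_def lin_map_tensor_alg)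

lemma comult_in [simp]: "x \<in> vcar H \<Longrightarrow> comult H x \<in> vcar (tensor_vs H H)"
  using lin_mapD(1)[OF lin_comult] .

lemma comult_mult: "x \<in> vcar H \<Longrightarrow> y \<in> vcar H \<Longrightarrow>
    comult H (x \<bullet> y) = comult H x \<cdot>\<^bsub>tensor_alg H H\<^esub> comult H y"
  and comult_one: "comult H \<one>\<^bsub>H\<^esub> = \<one>\<^bsub>H\<^esub> \<otimes>\<^bsub>H,H\<^esub> \<one>\<^bsub>H\<^esub>"
  using hopf by (simp_all add: hopf_algebra_def alg_hom_def)

lemma lin_antipode: "lin_map H H (antipode H)"
  using hopf by (simp add: hopf_algebra_def)

lemma antipode_in [simp]: "x \<in> vcar H \<Longrightarrow> antipode H x \<in> vcar H"
  using lin_mapD(1)[OF lin_antipode] .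

lemma sw_cong:
  assumes "h \<in> vcar H" "\<And>a b. a \<in> vcar H \<Longrightarrow> b \<in> vcar H \<Longrightarrow> F a b = G a b"
  shows "sw h F = sw h G"
  by (rule tsum_cong[OF vs vs comult_in]) (use assms in auto)

lemma sw_in:
  assumes "is_vspace U" "h \<in> vcar H" "\<And>a b. a \<in> vcar H \<Longrightarrow> b \<in> vcar H \<Longrightarrow> F a b \<in> vcar U"
  shows "sw h F \<in> vcar U"
  by (rule tsum_in[OF vs vs comult_in]) (use assms in auto)

lemma lin_sw_param:
  assumes "is_vspace U" "h \<in> vcar H"
    "\<And>a b. a \<in> vcar H \<Longrightarrow> b \<in> vcar H \<Longrightarrow> lin_map Z U (\<lambda>x. F x a b)"
  shows "lin_map Z U (\<lambda>x. sw h (\<lambda>a b. F x a b))"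
  by (rule lin_tsum_param[OF _ vs vs comult_in]) (use assms in auto)

lemma lin_sw_arg:
  assumes "is_vspace U" "lin_map Z H g" "bilin_map H H U F"
  shows "lin_map Z U (\<lambda>x. sw (g x) F)"
  by (rule lin_comp[OF lin_tsum[OF vs vs assms(1,3)] lin_comp[OF lin_comult assms(2)]])

lemma lin_map_sw:
  assumes "lin_map U U' f" "h \<in> vcar H" "is_vspace U"
    "\<And>a b. a \<in> vcar H \<Longrightarrow> b \<in> vcar H \<Longrightarrow> F a b \<in> vcar U"
  shows "f (sw h F) = sw h (\<lambda>a b. f (F a b))"
  by (rule lin_map_tsum[OF assms(1) vs vs comult_in]) (use assms in auto)

lemma sw_ten: "h \<in> vcar H \<Longrightarrow> sw h (\<lambda>a b. a \<otimes>\<^bsub>H,H\<^esub> b) = comult H h"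
  by (simp add: tsum_ten)

lemma lin_antipode_comp: "lin_map Z H g \<Longrightarrow> lin_map Z H (\<lambda>x. antipode H (g x))"
  and lin_counit_comp: "lin_map Z H g \<Longrightarrow> lin_map Z ground_vs (\<lambda>x. counit H (g x))"
  by (rule lin_comp[OF lin_antipode], assumption, rule lin_comp[OF lin_counit], assumption)

lemmas lin_rules = bilin_mapI lin_id lin_antipode_comp lin_counit_comp lin_mult_left[OF balg]
  lin_mult_right[OF balg] lin_sw_param lin_sw_arg lin_ten_left lin_ten_right lin_scale_left
  lin_scale_right lin_times_left is_vspace_tensor_vs

lemma sw_mult:
  assumes "is_vspace U" "bilin_map H H U F" "g \<in> vcar H" "h \<in> vcar H"
  shows "sw (g \<bullet> h) F = sw g (\<lambda>a b. sw h (\<lambda>a' b'. F (a \<bullet> a') (b \<bullet> b')))"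
proof -
  have 1: "tsum H H (sw h (\<lambda>a' b'. (a \<bullet> a') \<otimes>\<^bsub>H,H\<^esub> (b \<bullet> b'))) F
    = sw h (\<lambda>a' b'. F (a \<bullet> a') (b \<bullet> b'))" if "a \<in> vcar H" "b \<in> vcar H" for a b
    using that assms(4)
    by (subst tsum_tsum[OF vs vs comult_in vs vs assms(1,2)])
      (auto intro!: ten_in sw_cong tsum_pure[OF vs vs assms(1,2)])
  show ?thesis
    unfolding comult_mult[OF assms(3,4)] tensor_mult[OF balg balg comult_in[OF assms(3)] comult_in[OF assms(4)]]
    using assms(3,4)
    by (subst tsum_tsum[OF vs vs comult_in vs vs assms(1,2)])
      (auto intro!: ten_in sw_cong sw_in is_vspace_tensor_vs simp: 1)
qed

lemma sw_one:
  assumes "is_vspace U" "bilin_map H H U F"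
  shows "sw \<one>\<^bsub>H\<^esub> F = F \<one>\<^bsub>H\<^esub> \<one>\<^bsub>H\<^esub>"
  by (simp add: comult_one tsum_pure[OF vs vs assms])

text \<open>A trilinear \<open>F\<close> extends to a linear map on \<open>H \<otimes> (H \<otimes> H)\<close>; the two sides are its values on
  the two forms of the iterated coproduct.\<close>

lemma coassoc:
  assumes "h \<in> vcar H" and U: "is_vspace U"
    and F1: "\<And>b c. b \<in> vcar H \<Longrightarrow> c \<in> vcar H \<Longrightarrow> lin_map H U (\<lambda>a. F a b c)"
    and F2: "\<And>a c. a \<in> vcar H \<Longrightarrow> c \<in> vcar H \<Longrightarrow> lin_map H U (\<lambda>b. F a b c)"
    and F3: "\<And>a b. a \<in> vcar H \<Longrightarrow> b \<in> vcar H \<Longrightarrow> lin_map H U (\<lambda>c. F a b c)"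
  shows "sw h (\<lambda>a c. sw a (\<lambda>a b. F a b c)) = sw h (\<lambda>a b. sw b (\<lambda>b c. F a b c))"
proof -
  let ?T = "tensor_vs H H" and ?G = "\<lambda>t. tsum H (tensor_vs H H) t (\<lambda>a s. tsum H H s (F a))"
  have bF: "bilin_map H H U (F a)" if "a \<in> vcar H" for a
    using F2 F3 that by (intro bilin_mapI)
  have bG: "bilin_map H ?T U (\<lambda>a s. tsum H H s (F a))"
    by (rule bilin_mapI, erule lin_tsum[OF vs vs U bF], erule lin_tsum_param[OF U vs vs], erule (1) F1)
  have lG: "lin_map (tensor_vs H ?T) U ?G"
    by (rule lin_tsum[OF vs is_vspace_tensor_vs U bG])
  have pure: "?G (a \<otimes>\<^bsub>H,?T\<^esub> s) = tsum H H s (F a)" if "a \<in> vcar H" "s \<in> vcar ?T" for a s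
    by (rule tsum_pure[OF vs is_vspace_tensor_vs U bG that])
  have pure2: "?G (a \<otimes>\<^bsub>H,?T\<^esub> (b \<otimes>\<^bsub>H,H\<^esub> c)) = F a b c" if "a \<in> vcar H" "b \<in> vcar H" "c \<in> vcar H" for a b c
    using that by (simp add: pure ten_in tsum_pure[OF vs vs U bF])
  have R: "tmap H H H ?T id (comult H) (comult H h) = sw h (\<lambda>a b. a \<otimes>\<^bsub>H,?T\<^esub> comult H b)"
    using assms(1) lin_id[of H]
    by (subst tmap_tsum) (auto simp: id_def is_vspace_tensor_vs intro: lin_comult)
  have gR: "?G (sw h (\<lambda>a b. a \<otimes>\<^bsub>H,?T\<^esub> comult H b)) = sw h (\<lambda>a b. sw b (\<lambda>b c. F a b c))"
    using assms(1)
    by (subst lin_map_sw[OF lG]) (auto intro!: sw_cong simp: pure is_vspace_tensor_vs ten_in)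
  let ?A = "\<lambda>t c. tsum H H t (\<lambda>a b. a \<otimes>\<^bsub>H,?T\<^esub> (b \<otimes>\<^bsub>H,H\<^esub> c))"
  have bA: "bilin_map H H (tensor_vs H ?T) (\<lambda>a b. a \<otimes>\<^bsub>H,?T\<^esub> (b \<otimes>\<^bsub>H,H\<^esub> c))" if "c \<in> vcar H" for c
    using that by (auto intro!: lin_rules ten_in)
  have bA2: "bilin_map ?T H (tensor_vs H ?T) ?A"
    by (rule bilin_mapI, rule lin_tsum_param[OF is_vspace_tensor_vs vs vs])
      (auto intro!: lin_rules ten_in lin_tsum[OF vs vs is_vspace_tensor_vs bA])
  have ta: "tassoc H H H t = tsum ?T H t ?A" if "t \<in> vcar (tensor_vs ?T H)" for t
  proof -
    have *: "tlift H H (\<lambda>a b. a \<otimes>\<^bsub>H,?T\<^esub> (b \<otimes>\<^bsub>H,H\<^esub> c)) s = ?A s c"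
      if "s \<in> vcar ?T" "c \<in> vcar H" for s c
      by (rule tlift_tsum[OF vs vs that(1) is_vspace_tensor_vs bA[OF that(2)]])
    have "bilin_map ?T H (tensor_vs H ?T) (\<lambda>s c. tlift H H (\<lambda>a b. a \<otimes>\<^bsub>H,?T\<^esub> (b \<otimes>\<^bsub>H,H\<^esub> c)) s)"
      by (rule bilin_mapI)
        (subst lin_map_cong[OF vs *], assumption, assumption, erule bilin_mapD(1)[OF bA2],
         subst lin_map_cong[OF is_vspace_tensor_vs *], assumption, assumption, erule bilin_mapD(2)[OF bA2])
    then show ?thesis
      unfolding tassoc_def
      by (subst tlift_tsum[OF is_vspace_tensor_vs vs that is_vspace_tensor_vs])
        (auto intro!: tsum_cong[OF is_vspace_tensor_vs vs that] simp: *)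
  qed
  have L: "tassoc H H H (tmap H H ?T H (comult H) id (comult H h))
      = sw h (\<lambda>a c. ?A (comult H a) c)"
  proof -
    have "tmap H H ?T H (comult H) id (comult H h) = sw h (\<lambda>a b. comult H a \<otimes>\<^bsub>?T,H\<^esub> b)"
      using assms(1) lin_id[of H]
      by (subst tmap_tsum) (auto simp: id_def is_vspace_tensor_vs intro: lin_comult)
    moreover have "sw h (\<lambda>a b. comult H a \<otimes>\<^bsub>?T,H\<^esub> b) \<in> vcar (tensor_vs ?T H)"
      using assms(1) by (auto intro!: sw_in ten_in is_vspace_tensor_vs)
    ultimately show ?thesis using assms(1)
      by (simp add: ta)
        (subst tsum_tsum[OF vs vs comult_in is_vspace_tensor_vs vs is_vspace_tensor_vs bA2],
         auto intro!: sw_cong tsum_pure[OF is_vspace_tensor_vs vs is_vspace_tensor_vs bA2] ten_in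
           is_vspace_tensor_vs)
  qed
  have gL: "?G (sw h (\<lambda>a c. ?A (comult H a) c)) = sw h (\<lambda>a c. sw a (\<lambda>a b. F a b c))"
    using assms(1)
    by (subst lin_map_sw[OF lG])
      (auto intro!: sw_cong sw_in simp: pure2 is_vspace_tensor_vs ten_in lin_map_sw[OF lG])
  have "tassoc H H H (tmap H H ?T H (comult H) id (comult H h)) = tmap H H H ?T id (comult H) (comult H h)"
    using hopf assms(1) by (simp add: hopf_algebra_def)
  then have "?G (sw h (\<lambda>a c. ?A (comult H a) c)) = ?G (sw h (\<lambda>a b. a \<otimes>\<^bsub>H,?T\<^esub> comult H b))"
    unfolding L R by simp
  then show ?thesis unfolding gL gR .
qed

lemma counit_left:
  assumes "h \<in> vcar H" "lin_map H U f"
  shows "sw h (\<lambda>a b. vscale U (counit H a) (f b)) = f h"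
proof -
  have "sw h (\<lambda>a b. vscale H (counit H a) b) = h"
    using hopf assms(1)
    by (subst tlift_tsum[symmetric, of _ _ _ H]) (auto simp: hopf_algebra_def intro!: lin_rules)
  then have "f h = f (sw h (\<lambda>a b. vscale H (counit H a) b))" by simp
  also have "\<dots> = sw h (\<lambda>a b. vscale U (counit H a) (f b))"
    using assms
    by (subst lin_map_sw[OF assms(2,1) vs]) (auto intro!: sw_cong simp: carrier lin_mapD(3)[OF assms(2)])
  finally show ?thesis by simp
qed

lemma counit_right:
  assumes "h \<in> vcar H" "lin_map H U f"
  shows "sw h (\<lambda>a b. vscale U (counit H b) (f a)) = f h"
proof -
  have "sw h (\<lambda>a b. vscale H (counit H b) a) = h"
    using hopf assms(1)
    by (subst tlift_tsum[symmetric, of _ _ _ H]) (auto simp: hopf_algebra_def intro!: lin_rules)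
  then have "f h = f (sw h (\<lambda>a b. vscale H (counit H b) a))" by simp
  also have "\<dots> = sw h (\<lambda>a b. vscale U (counit H b) (f a))"
    using assms
    by (subst lin_map_sw[OF assms(2,1) vs]) (auto intro!: sw_cong simp: carrier lin_mapD(3)[OF assms(2)])
  finally show ?thesis by simp
qed

lemma antipode_left:
  assumes "h \<in> vcar H" "lin_map H U f"
  shows "sw h (\<lambda>a b. f (antipode H a \<bullet> b)) = vscale U (counit H h) (f \<one>\<^bsub>H\<^esub>)"
proof -
  have "sw h (\<lambda>a b. antipode H a \<bullet> b) = vscale H (counit H h) \<one>\<^bsub>H\<^esub>"
    using hopf assms(1)
    by (subst tlift_tsum[symmetric, of _ _ _ H]) (auto simp: hopf_algebra_def intro!: lin_rules)
  then show ?thesis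
    using lin_map_sw[OF assms(2,1) vs, of "\<lambda>a b. antipode H a \<bullet> b"] lin_mapD(3)[OF assms(2) one_in]
    by simp
qed

lemma antipode_right:
  assumes "h \<in> vcar H" "lin_map H U f"
  shows "sw h (\<lambda>a b. f (a \<bullet> antipode H b)) = vscale U (counit H h) (f \<one>\<^bsub>H\<^esub>)"
proof -
  have "sw h (\<lambda>a b. a \<bullet> antipode H b) = vscale H (counit H h) \<one>\<^bsub>H\<^esub>"
    using hopf assms(1)
    by (subst tlift_tsum[symmetric, of _ _ _ H]) (auto simp: hopf_algebra_def intro!: lin_rules)
  then show ?thesis
    using lin_map_sw[OF assms(2,1) vs, of "\<lambda>a b. a \<bullet> antipode H b"] lin_mapD(3)[OF assms(2) one_in]
    by simp
qed

lemma antipode_one: "antipode H \<one>\<^bsub>H\<^esub> = \<one>\<^bsub>H\<^esub>"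
proof -
  have "bilin_map H H H (\<lambda>a b. antipode H a \<bullet> b)"
    by (auto intro!: lin_rules)
  then show ?thesis
    using antipode_left[OF one_in lin_id] sw_one[OF vs, of "\<lambda>a b. antipode H a \<bullet> b"]
    by (simp add: vscale_laws[OF vs])
qed

end

section \<open>Convolution\<close>

lemma tsum_apply: "tsum V W t F x = tsum V W t (\<lambda>a b. F a b x)"
proof -
  have "(\<Sum>p\<leftarrow>ps. F (fst p) (snd p)) x = (\<Sum>p\<leftarrow>ps. F (fst p) (snd p) x)" for ps
    by (induction ps) auto
  then show ?thesis by (simp add: tsum_def case_prod_unfold)
qed

text \<open>Linear maps are represented by functions that vanish outside of the carrier, so that equality of
  elements is equality of functions.  For the ground field in the place of \<open>A\<close> this is the dual
  algebra, and for \<open>H\<^sup>o\<^sup>p\<close> the home of the canonical element.\<close>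

definition conv_alg ::
    "('k::field, 'a::ab_group_add, 'm) hopf_scheme \<Rightarrow> ('k, 'b::ab_group_add, 'n) alg_scheme
      \<Rightarrow> ('k, 'a \<Rightarrow> 'b) alg" where
  "conv_alg C A =
     \<lparr>vcar = {f. lin_map C A f \<and> (\<forall>k. k \<notin> vcar C \<longrightarrow> f k = 0)},
      vscale = (\<lambda>c f k. vscale A c (f k)),
      amult = (\<lambda>f g k. if k \<in> vcar C then tsum C C (comult C k) (\<lambda>a b. f a \<cdot>\<^bsub>A\<^esub> g b) else 0),
      aone = (\<lambda>k. if k \<in> vcar C then vscale A (counit C k) \<one>\<^bsub>A\<^esub> else 0)\<rparr>"

lemma conv_alg_simps [simp]:
  "f \<in> vcar (conv_alg C A) \<longleftrightarrow> lin_map C A f \<and> (\<forall>k. k \<notin> vcar C \<longrightarrow> f k = 0)"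
  "vscale (conv_alg C A) c f = (\<lambda>k. vscale A c (f k))"
  "k \<in> vcar C \<Longrightarrow> (f \<cdot>\<^bsub>conv_alg C A\<^esub> g) k = tsum C C (comult C k) (\<lambda>a b. f a \<cdot>\<^bsub>A\<^esub> g b)"
  "k \<notin> vcar C \<Longrightarrow> (f \<cdot>\<^bsub>conv_alg C A\<^esub> g) k = 0"
  "\<one>\<^bsub>conv_alg C A\<^esub> = (\<lambda>k. if k \<in> vcar C then vscale A (counit C k) \<one>\<^bsub>A\<^esub> else 0)"
  by (auto simp: conv_alg_def)

context hopf_alg
begin

abbreviation restr :: "('h \<Rightarrow> 'c::ab_group_add) \<Rightarrow> 'h \<Rightarrow> 'c" where
  "restr f \<equiv> (\<lambda>h. if h \<in> vcar H then f h else 0)"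

lemma lin_restr: "lin_map H W (restr f) \<longleftrightarrow> lin_map H W f"
  by (rule lin_map_cong) auto

lemma is_vspace_conv:
  assumes "is_vspace A"
  shows "is_vspace (conv_alg H A)"
  unfolding is_vspace_def
proof
  interpret A: vector_space "vscale A" using assms by (simp add: is_vspace_def)
  show v: "vector_space (vscale (conv_alg H A))"
    by unfold_locales (auto simp: fun_eq_iff A.scale_right_distrib A.scale_left_distrib)
  interpret C: vector_space "vscale (conv_alg H A)" by (rule v)
  show "C.subspace (vcar (conv_alg H A))"
  proof (rule C.subspaceI)
    show "0 \<in> vcar (conv_alg H A)"
      by (auto intro!: lin_mapI simp: is_vspace_carrier[OF assms])
    show "x + y \<in> vcar (conv_alg H A)" if "x \<in> vcar (conv_alg H A)" "y \<in> vcar (conv_alg H A)" for x y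
      using that lin_add[OF assms, of H x y] by (simp add: plus_fun_def)
    show "vscale (conv_alg H A) c x \<in> vcar (conv_alg H A)" if "x \<in> vcar (conv_alg H A)" for c x
      using that by (auto intro: lin_scale_right[OF assms])
  qed
qed

lemma lin_into_conv:
  assumes V: "is_vspace V" and F: "\<And>x. x \<in> vcar V \<Longrightarrow> F x \<in> vcar (conv_alg H A)"
    and lin: "\<And>h. h \<in> vcar H \<Longrightarrow> lin_map V A (\<lambda>x. F x h)"
    and A: "is_vspace A"
  shows "lin_map V (conv_alg H A) F"
proof (rule lin_mapI)
  note out = F[unfolded conv_alg_simps, THEN conjunct2, rule_format]
  show "F (x + y) = F x + F y" if "x \<in> vcar V" "y \<in> vcar V" for x y
  proof
    fix h show "F (x + y) h = (F x + F y) h"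
      using that lin_mapD(2)[OF lin, of h x y] out[OF _, of _ h] is_vspace_carrier(2)[OF V]
      by (cases "h \<in> vcar H") simp_all
  qed
  show "F (vscale V c x) = vscale (conv_alg H A) c (F x)" if "x \<in> vcar V" for c x
  proof
    fix h show "F (vscale V c x) h = vscale (conv_alg H A) c (F x) h"
      using that lin_mapD(3)[OF lin, of h x c] out[OF _, of _ h] is_vspace_carrier(3)[OF V]
      by (cases "h \<in> vcar H") (simp_all add: vscale_laws[OF A])
  qed
qed (rule F)

lemma sw_conv:
  assumes "algebra A" "lin_map H A f" "lin_map H A g"
  shows "bilin_map H H A (\<lambda>a b. f a \<cdot>\<^bsub>A\<^esub> g b)"
  using assms(2,3) by (intro bilin_mapI lin_mult_left lin_mult_right bilin_algebra[OF assms(1)]) (auto dest: lin_mapD)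

lemma algebra_conv:
  assumes A: "algebra A"
  shows "algebra (conv_alg H A)"
proof -
  let ?C = "conv_alg H A"
  note AD = algebraD[OF A]
  have V: "is_vspace ?C" by (rule is_vspace_conv[OF AD(1)])
  have lin: "lin_map H A (f \<cdot>\<^bsub>?C\<^esub> g)" if "lin_map H A f" "lin_map H A g" for f g
    by (subst lin_map_cong[OF vs conv_alg_simps(3)], assumption)
      (intro lin_sw_arg lin_id sw_conv A AD that)
  have cl: "f \<cdot>\<^bsub>?C\<^esub> g \<in> vcar ?C" if "f \<in> vcar ?C" "g \<in> vcar ?C" for f g
    using lin[of f g] that by auto
  have one: "\<one>\<^bsub>?C\<^esub> \<in> vcar ?C"
    by (auto simp: lin_restr intro!: lin_rules AD)
  have assoc: "(f \<cdot>\<^bsub>?C\<^esub> g) \<cdot>\<^bsub>?C\<^esub> k = f \<cdot>\<^bsub>?C\<^esub> (g \<cdot>\<^bsub>?C\<^esub> k)"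
    if f: "f \<in> vcar ?C" and g: "g \<in> vcar ?C" and k: "k \<in> vcar ?C" for f g k
  proof
    fix h
    note fgk = lin_mapD(1)[of H A f] lin_mapD(1)[of H A g] lin_mapD(1)[of H A k]
    show "((f \<cdot>\<^bsub>?C\<^esub> g) \<cdot>\<^bsub>?C\<^esub> k) h = (f \<cdot>\<^bsub>?C\<^esub> (g \<cdot>\<^bsub>?C\<^esub> k)) h"
    proof (cases "h \<in> vcar H")
      case h: True
      have "((f \<cdot>\<^bsub>?C\<^esub> g) \<cdot>\<^bsub>?C\<^esub> k) h = sw h (\<lambda>a c. sw a (\<lambda>a b. f a \<cdot>\<^bsub>A\<^esub> g b) \<cdot>\<^bsub>A\<^esub> k c)"
        using h by (auto intro!: sw_cong)
      also have "\<dots> = sw h (\<lambda>a c. sw a (\<lambda>a b. (f a \<cdot>\<^bsub>A\<^esub> g b) \<cdot>\<^bsub>A\<^esub> k c))"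
      proof (rule sw_cong[OF h])
        fix a c assume ac: "a \<in> vcar H" "c \<in> vcar H"
        then show "sw a (\<lambda>a b. f a \<cdot>\<^bsub>A\<^esub> g b) \<cdot>\<^bsub>A\<^esub> k c = sw a (\<lambda>a b. (f a \<cdot>\<^bsub>A\<^esub> g b) \<cdot>\<^bsub>A\<^esub> k c)"
          using f g k fgk AD
          by (intro lin_map_sw[where f = "\<lambda>x. x \<cdot>\<^bsub>A\<^esub> k c" and U = A and U' = A] lin_mult_left[OF bilin_algebra[OF A]] lin_id) auto
      qed
      also have "\<dots> = sw h (\<lambda>a b. sw b (\<lambda>b c. (f a \<cdot>\<^bsub>A\<^esub> g b) \<cdot>\<^bsub>A\<^esub> k c))"
        using h f g k fgk AD
        by (intro coassoc[where U = A] lin_mult_left[OF bilin_algebra[OF A]] lin_mult_right[OF bilin_algebra[OF A]]) auto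
      also have "\<dots> = sw h (\<lambda>a b. f a \<cdot>\<^bsub>A\<^esub> sw b (\<lambda>b c. g b \<cdot>\<^bsub>A\<^esub> k c))"
      proof (rule sw_cong[OF h])
        fix a b assume ab: "a \<in> vcar H" "b \<in> vcar H"
        have "f a \<cdot>\<^bsub>A\<^esub> sw b (\<lambda>b c. g b \<cdot>\<^bsub>A\<^esub> k c) = sw b (\<lambda>b c. f a \<cdot>\<^bsub>A\<^esub> (g b \<cdot>\<^bsub>A\<^esub> k c))"
          using f g k fgk AD ab
          by (intro lin_map_sw[where f = "\<lambda>x. f a \<cdot>\<^bsub>A\<^esub> x" and U = A and U' = A] lin_mult_right[OF bilin_algebra[OF A]] lin_id) auto
        also have "\<dots> = sw b (\<lambda>b c. (f a \<cdot>\<^bsub>A\<^esub> g b) \<cdot>\<^bsub>A\<^esub> k c)"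
          using f g k fgk ab AD(4) by (auto intro!: sw_cong)
        finally show "sw b (\<lambda>b c. (f a \<cdot>\<^bsub>A\<^esub> g b) \<cdot>\<^bsub>A\<^esub> k c) = f a \<cdot>\<^bsub>A\<^esub> sw b (\<lambda>b c. g b \<cdot>\<^bsub>A\<^esub> k c)" by simp
      qed
      also have "\<dots> = (f \<cdot>\<^bsub>?C\<^esub> (g \<cdot>\<^bsub>?C\<^esub> k)) h"
        using h by (auto intro!: sw_cong)
      finally show ?thesis .
    qed simp
  qed
  have unit: "\<one>\<^bsub>?C\<^esub> \<cdot>\<^bsub>?C\<^esub> f = f \<and> f \<cdot>\<^bsub>?C\<^esub> \<one>\<^bsub>?C\<^esub> = f" if f: "f \<in> vcar ?C" for f
  proof (intro conjI ext)
    fix h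
    have fin: "f a \<in> vcar A" if "a \<in> vcar H" for a using f lin_mapD(1)[of H A f] that by simp
    show "(\<one>\<^bsub>?C\<^esub> \<cdot>\<^bsub>?C\<^esub> f) h = f h"
    proof (cases "h \<in> vcar H")
      case h: True
      have "(\<one>\<^bsub>?C\<^esub> \<cdot>\<^bsub>?C\<^esub> f) h = sw h (\<lambda>a b. vscale A (counit H a) (f b))"
        using h fin AD by (auto intro!: sw_cong)
      then show ?thesis using counit_left[OF h, of A f] f by simp
    qed (use f in simp)
    show "(f \<cdot>\<^bsub>?C\<^esub> \<one>\<^bsub>?C\<^esub>) h = f h"
    proof (cases "h \<in> vcar H")
      case h: True
      have "(f \<cdot>\<^bsub>?C\<^esub> \<one>\<^bsub>?C\<^esub>) h = sw h (\<lambda>a b. vscale A (counit H b) (f a))"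
        using h fin AD by (auto intro!: sw_cong)
      then show ?thesis using counit_right[OF h, of A f] f by simp
    qed (use f in simp)
  qed
  have bil: "bilin_map ?C ?C ?C (amult ?C)"
  proof (rule bilin_mapI)
    fix f assume f: "f \<in> vcar ?C"
    have ev: "lin_map ?C A (\<lambda>g. g b)" if "b \<in> vcar H" for b
      using that by (intro lin_mapI) (auto dest: lin_mapD)
    have fin: "f a \<in> vcar A" if "a \<in> vcar H" for a using f lin_mapD(1)[of H A f] that by simp
    show "lin_map ?C ?C (\<lambda>g. f \<cdot>\<^bsub>?C\<^esub> g)"
    proof (rule lin_into_conv[OF V cl[OF f] _ AD(1)])
      show "lin_map ?C A (\<lambda>g. (f \<cdot>\<^bsub>?C\<^esub> g) h)" if h: "h \<in> vcar H" for h
        unfolding conv_alg_simps(3)[OF h]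
        by (intro lin_sw_param[OF AD(1) h] lin_mult_right[OF bilin_algebra[OF A]] ev fin)
    qed
    show "lin_map ?C ?C (\<lambda>g. g \<cdot>\<^bsub>?C\<^esub> f)"
    proof (rule lin_into_conv[OF V cl[OF _ f] _ AD(1)])
      show "lin_map ?C A (\<lambda>g. (g \<cdot>\<^bsub>?C\<^esub> f) h)" if h: "h \<in> vcar H" for h
        unfolding conv_alg_simps(3)[OF h]
        by (intro lin_sw_param[OF AD(1) h] lin_mult_left[OF bilin_algebra[OF A]] ev fin)
    qed
  qed
  show ?thesis
    unfolding algebra_def using V bil one assoc unit by blast
qed

text \<open>Two maps agree if they are a left and a right convolution inverse of the same map \<open>m\<close>.  Both
  anti-homomorphism properties of the antipode are instances, each for a suitable target algebra.\<close>

lemma conv_inverse_unique: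
  assumes A: "algebra A" and lin: "lin_map H A f" "lin_map H A m" "lin_map H A g"
    and fm: "\<And>h. h \<in> vcar H \<Longrightarrow> sw h (\<lambda>a b. f a \<cdot>\<^bsub>A\<^esub> m b) = vscale A (counit H h) \<one>\<^bsub>A\<^esub>"
    and mg: "\<And>h. h \<in> vcar H \<Longrightarrow> sw h (\<lambda>a b. m a \<cdot>\<^bsub>A\<^esub> g b) = vscale A (counit H h) \<one>\<^bsub>A\<^esub>"
    and h: "h \<in> vcar H"
  shows "f h = g h"
proof -
  let ?C = "conv_alg H A"
  have eq: "restr u \<cdot>\<^bsub>?C\<^esub> restr v = \<one>\<^bsub>?C\<^esub>"
    if "\<And>h. h \<in> vcar H \<Longrightarrow> sw h (\<lambda>a b. u a \<cdot>\<^bsub>A\<^esub> v b) = vscale A (counit H h) \<one>\<^bsub>A\<^esub>" for u v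
  proof
    fix k
    have "sw k (\<lambda>a b. restr u a \<cdot>\<^bsub>A\<^esub> restr v b) = sw k (\<lambda>a b. u a \<cdot>\<^bsub>A\<^esub> v b)" if "k \<in> vcar H"
      using that by (auto intro!: sw_cong)
    then show "(restr u \<cdot>\<^bsub>?C\<^esub> restr v) k = \<one>\<^bsub>?C\<^esub> k"
      using that by (cases "k \<in> vcar H") auto
  qed
  have "restr f = restr g"
    by (rule left_inverse_eq_right_inverse[OF algebra_conv[OF A] _ _ _ eq[OF fm] eq[OF mg]])
      (use lin in \<open>auto simp: lin_restr\<close>)
  then show ?thesis using h by (metis (full_types))
qed

section \<open>The antipode is an anti-homomorphism\<close>

text \<open>In the convolution algebra of maps from \<open>H\<close> into the convolution algebra of \<open>H\<close>, both
  \<open>g \<mapsto> (h \<mapsto> S(g h))\<close> and \<open>g \<mapsto> (h \<mapsto> S(h) S(g))\<close> are inverse to \<open>g \<mapsto> (h \<mapsto> g h)\<close>.\<close>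

lemma antipode_mult:
  assumes g: "g \<in> vcar H" and h: "h \<in> vcar H"
  shows "antipode H (g \<bullet> h) = antipode H h \<bullet> antipode H g"
proof -
  let ?C = "conv_alg H H" and ?S = "antipode H"
  let ?f = "\<lambda>g. restr (\<lambda>h. ?S (g \<bullet> h))" and ?m = "\<lambda>g. restr (\<lambda>h. g \<bullet> h)"
    and ?k = "\<lambda>g. restr (\<lambda>h. ?S h \<bullet> ?S g)"
  have lin: "lin_map H ?C (\<lambda>g. restr (F g))" if F: "bilin_map H H H F" for F
    using bilin_mapD(1,2)[OF F] by (intro lin_into_conv vs) (auto simp: lin_restr)
  have "?f g = ?k g"
  proof (rule conv_inverse_unique[OF algebra_conv[OF alg], where m = ?m, OF _ _ _ _ _ g])
    fix g assume g: "g \<in> vcar H"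
    show "sw g (\<lambda>a b. ?f a \<cdot>\<^bsub>?C\<^esub> ?m b) = vscale ?C (counit H g) \<one>\<^bsub>?C\<^esub>"
    proof
      fix h
      show "sw g (\<lambda>a b. ?f a \<cdot>\<^bsub>?C\<^esub> ?m b) h = vscale ?C (counit H g) \<one>\<^bsub>?C\<^esub> h"
      proof (cases "h \<in> vcar H")
        case h: True
        have "sw g (\<lambda>a b. ?f a \<cdot>\<^bsub>?C\<^esub> ?m b) h
            = sw g (\<lambda>a b. sw h (\<lambda>c e. ?S (a \<bullet> c) \<bullet> (b \<bullet> e)))"
          unfolding tsum_apply using g h by (auto intro!: sw_cong)
        also have "\<dots> = sw (g \<bullet> h) (\<lambda>x y. ?S x \<bullet> y)"
          using g h by (intro sw_mult[symmetric, of H]) (auto intro!: lin_rules)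
        also have "\<dots> = vscale H (counit H (g \<bullet> h)) \<one>\<^bsub>H\<^esub>"
          using g h by (intro antipode_left lin_id) auto
        finally show ?thesis using g h by (simp add: counit_mult vscale_laws[OF vs])
      next
        case False
        then show ?thesis unfolding tsum_apply by (simp add: vscale_laws[OF vs] tsum_def case_prod_unfold)
      qed
    qed
    show "sw g (\<lambda>a b. ?m a \<cdot>\<^bsub>?C\<^esub> ?k b) = vscale ?C (counit H g) \<one>\<^bsub>?C\<^esub>"
    proof
      fix h
      show "sw g (\<lambda>a b. ?m a \<cdot>\<^bsub>?C\<^esub> ?k b) h = vscale ?C (counit H g) \<one>\<^bsub>?C\<^esub> h"
      proof (cases "h \<in> vcar H")
        case h: True
        have "sw g (\<lambda>a b. ?m a \<cdot>\<^bsub>?C\<^esub> ?k b) h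
            = sw g (\<lambda>a b. sw h (\<lambda>c e. (\<lambda>x. a \<bullet> (x \<bullet> ?S b)) (c \<bullet> ?S e)))"
          unfolding tsum_apply using g h by (auto intro!: sw_cong simp: mult(2))
        also have "\<dots> = sw g (\<lambda>a b. (\<lambda>x. vscale H (counit H h) x) (a \<bullet> ?S b))"
        proof (rule sw_cong[OF g])
          fix a b assume "a \<in> vcar H" "b \<in> vcar H"
          then show "sw h (\<lambda>c e. (\<lambda>x. a \<bullet> (x \<bullet> ?S b)) (c \<bullet> ?S e))
              = (\<lambda>x. vscale H (counit H h) x) (a \<bullet> ?S b)"
            using h by (intro trans[OF antipode_right[OF h, where U = H]]) (auto intro!: lin_rules)
        qed
        also have "\<dots> = vscale H (counit H g) (vscale H (counit H h) \<one>\<^bsub>H\<^esub>)"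
          using g h by (intro antipode_right) (auto intro!: lin_rules)
        finally show ?thesis using g h by simp
      next
        case False
        then show ?thesis unfolding tsum_apply by (simp add: vscale_laws[OF vs] tsum_def case_prod_unfold)
      qed
    qed
  qed (auto intro!: lin lin_rules)
  then show ?thesis using h by (metis (full_types))
qed

text \<open>With values in \<open>H \<otimes> H\<close>, both sides are convolution inverses of the coproduct, the left one because
  the coproduct is multiplicative.\<close>

lemma comult_antipode:
  assumes h: "h \<in> vcar H"
  shows "comult H (antipode H h) = sw h (\<lambda>a b. antipode H b \<otimes>\<^bsub>H,H\<^esub> antipode H a)"
proof -
  let ?T = "tensor_alg H H" and ?S = "antipode H"
  note T = algebra_tensor_alg[OF alg alg]
  note lin_T = lin_mult_left[OF bilin_algebra[OF T]] lin_mult_right[OF bilin_algebra[OF T]]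
  let ?g = "\<lambda>h. sw h (\<lambda>a b. ?S b \<otimes>\<^bsub>H,H\<^esub> ?S a)"
  have bilg: "bilin_map H H (tensor_vs H H) (\<lambda>a b. ?S b \<otimes>\<^bsub>H,H\<^esub> ?S a)"
    by (auto intro!: lin_rules)
  have ling: "lin_map H (tensor_vs H H) ?g"
    by (rule lin_sw_arg[OF is_vspace_tensor_vs lin_id bilg])
  show ?thesis
  proof (rule conv_inverse_unique[OF T, where m = "comult H" and f = "\<lambda>h. comult H (?S h)" and g = ?g, OF _ _ _ _ _ h])
    show "lin_map H ?T (\<lambda>h. comult H (?S h))" "lin_map H ?T (comult H)" "lin_map H ?T ?g"
      unfolding lin_map_tensor_alg using lin_comp[OF lin_comult lin_antipode] lin_comult ling by auto
    fix h assume h: "h \<in> vcar H"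
    have "sw h (\<lambda>a b. comult H (?S a) \<cdot>\<^bsub>?T\<^esub> comult H b) = sw h (\<lambda>a b. comult H (?S a \<bullet> b))"
      using h by (intro sw_cong) (auto simp: comult_mult)
    also have "\<dots> = pscale (counit H h) \<one>\<^bsub>?T\<^esub>"
      using antipode_left[OF h lin_comult] by (simp add: comult_one)
    finally show "sw h (\<lambda>a b. comult H (?S a) \<cdot>\<^bsub>?T\<^esub> comult H b) = vscale ?T (counit H h) \<one>\<^bsub>?T\<^esub>"
      by simp
    \<comment> \<open>The inner factors cancel first: in \<open>h\<^sub>1 S(h\<^sub>4) \<otimes> h\<^sub>2 S(h\<^sub>3)\<close> the second leg collapses.\<close>
    let ?P = "\<lambda>a b c e. (a \<bullet> ?S e) \<otimes>\<^bsub>H,H\<^esub> (b \<bullet> ?S c)"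
    have P: "lin_map H (tensor_vs H H) (\<lambda>x. ?P x b c e)" "lin_map H (tensor_vs H H) (\<lambda>x. ?P b x c e)"
      "lin_map H (tensor_vs H H) (\<lambda>x. ?P b c x e)" "lin_map H (tensor_vs H H) (\<lambda>x. ?P b c e x)"
      if "b \<in> vcar H" "c \<in> vcar H" "e \<in> vcar H" for b c e
      using that by (auto intro!: lin_rules)
    have "sw h (\<lambda>a b. comult H a \<cdot>\<^bsub>?T\<^esub> ?g b) = sw h (\<lambda>a c. sw a (\<lambda>a b. sw c (\<lambda>c e. ?P a b c e)))"
    proof (rule sw_cong[OF h])
      fix a c assume ac: "a \<in> vcar H" "c \<in> vcar H"
      have "comult H a \<cdot>\<^bsub>?T\<^esub> ?g c = sw a (\<lambda>a b. a \<otimes>\<^bsub>H,H\<^esub> b) \<cdot>\<^bsub>?T\<^esub> ?g c"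
        using ac by (simp add: sw_ten)
      also have "\<dots> = sw a (\<lambda>a b. (a \<otimes>\<^bsub>H,H\<^esub> b) \<cdot>\<^bsub>?T\<^esub> ?g c)"
        using ac lin_mapD(1)[OF ling]
        by (intro lin_map_sw[where f = "\<lambda>x. x \<cdot>\<^bsub>?T\<^esub> ?g c" and U = ?T and U' = ?T] lin_T lin_id) (auto intro!: ten_in)
      also have "\<dots> = sw a (\<lambda>a b. sw c (\<lambda>c e. (a \<otimes>\<^bsub>H,H\<^esub> b) \<cdot>\<^bsub>?T\<^esub> (?S e \<otimes>\<^bsub>H,H\<^esub> ?S c)))"
        using ac 
        by (intro sw_cong lin_map_sw[where U = ?T and U' = ?T] lin_T lin_id) (auto intro!: ten_in)
      also have "\<dots> = sw a (\<lambda>a b. sw c (\<lambda>c e. ?P a b c e))"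
        using ac by (intro sw_cong) (auto simp: tensor_mult_ten[OF balg balg])
      finally show "comult H a \<cdot>\<^bsub>?T\<^esub> ?g c = sw a (\<lambda>a b. sw c (\<lambda>c e. ?P a b c e))" .
    qed
    also have "\<dots> = sw h (\<lambda>a b. sw b (\<lambda>b c. sw c (\<lambda>c e. ?P a b c e)))"
      using h P by (intro coassoc[where U = "tensor_vs H H"] lin_sw_param lin_sw_arg lin_id bilin_mapI is_vspace_tensor_vs)
    also have "\<dots> = sw h (\<lambda>a b. sw b (\<lambda>u e. sw u (\<lambda>b c. ?P a b c e)))"
      using h P by (intro sw_cong coassoc[where U = "tensor_vs H H", symmetric] is_vspace_tensor_vs)
    also have "\<dots> = sw h (\<lambda>a b. sw b (\<lambda>u e. pscale (counit H u) ((a \<bullet> ?S e) \<otimes>\<^bsub>H,H\<^esub> \<one>\<^bsub>H\<^esub>)))"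
      using h 
      by (intro sw_cong trans[OF antipode_right[where U = "tensor_vs H H" and f = "\<lambda>x. _ \<otimes>\<^bsub>H,H\<^esub> x"]])
        (auto intro!: lin_rules)
    also have "\<dots> = sw h (\<lambda>a b. (a \<bullet> ?S b) \<otimes>\<^bsub>H,H\<^esub> \<one>\<^bsub>H\<^esub>)"
      using h 
      by (intro sw_cong counit_left[where U = "tensor_vs H H" and f = "\<lambda>e. (_ \<bullet> ?S e) \<otimes>\<^bsub>H,H\<^esub> \<one>\<^bsub>H\<^esub>", simplified])
        (auto intro!: lin_rules)
    also have "\<dots> = pscale (counit H h) \<one>\<^bsub>?T\<^esub>"
      by (rule trans[OF antipode_right[OF h, where U = "tensor_vs H H" and f = "\<lambda>x. x \<otimes>\<^bsub>H,H\<^esub> \<one>\<^bsub>H\<^esub>"]])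
        (auto intro!: lin_rules)
    finally show "sw h (\<lambda>a b. comult H a \<cdot>\<^bsub>?T\<^esub> ?g b) = vscale ?T (counit H h) \<one>\<^bsub>?T\<^esub>" by simp
  qed
qed

lemma sw_antipode:
  assumes "h \<in> vcar H" "is_vspace U" "bilin_map H H U F"
  shows "sw (antipode H h) F = sw h (\<lambda>a b. F (antipode H b) (antipode H a))"
  unfolding comult_antipode[OF assms(1)]
  using assms(1)
  by (subst tsum_tsum[OF vs vs comult_in vs vs assms(2,3)])
    (auto intro!: ten_in sw_cong tsum_pure[OF vs vs assms(2,3)])

end

section \<open>Dual bases\<close>

lemma dual_bases_expand:
  fixes K :: "('k::field, 'a::ab_group_add, 'm) vspace_scheme"
    and L :: "('k, 'b::ab_group_add, 'n) vspace_scheme"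
  assumes "is_vspace K" "is_vspace L" "bilin_map K L ground_vs p" "dual_bases K L p B d"
  shows "finite B" "\<And>b. b \<in> B \<Longrightarrow> b \<in> vcar K" "\<And>b. b \<in> B \<Longrightarrow> d b \<in> vcar L"
    "k \<in> vcar K \<Longrightarrow> (\<Sum>b\<in>B. vscale K (p k (d b)) b) = k"
    "l \<in> vcar L \<Longrightarrow> (\<Sum>b\<in>B. vscale L (p b l) (d b)) = l"
proof -
  interpret K: vector_space "vscale K" using assms(1) by (simp add: is_vspace_def)
  interpret L: vector_space "vscale L" using assms(2) by (simp add: is_vspace_def)
  note D = assms(4)[unfolded dual_bases_def]
  show fin: "finite B" using D by simp
  have sp: "K.span B = vcar K" "L.span (d ` B) = vcar L" and inj: "inj_on d B"
    and dual: "\<And>b b'. b \<in> B \<Longrightarrow> b' \<in> B \<Longrightarrow> p b (d b') = (if b = b' then 1 else 0)"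
    using D by auto
  show B: "b \<in> vcar K" if "b \<in> B" for b using K.span_base[OF that] sp by simp
  show dB: "d b \<in> vcar L" if "b \<in> B" for b using L.span_base[of "d b" "d ` B"] that sp by simp
  show "(\<Sum>b\<in>B. vscale K (p k (d b)) b) = k" if k: "k \<in> vcar K"
  proof -
    obtain u where u: "k = (\<Sum>b\<in>B. vscale K (u b) b)"
      using k unfolding sp(1)[symmetric] K.span_finite[OF fin] by blast
    have "p k (d b) = u b" if b: "b \<in> B" for b
    proof -
      have l: "lin_map K ground_vs (\<lambda>k. p k (d b))" using assms(3) dB[OF b] by (rule bilin_mapD)
      have "p k (d b) = (\<Sum>c\<in>B. p (vscale K (u c) c) (d b))"
        unfolding u by (rule lin_map_sum[OF assms(1) l]) (use B is_vspace_carrier[OF assms(1)] in auto)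
      also have "\<dots> = (\<Sum>c\<in>B. if c = b then u b else 0)"
        using b dual lin_mapD(3)[OF l] B by (intro sum.cong) (auto simp: ground_vs_def)
      finally show ?thesis using fin b by simp
    qed
    then show ?thesis using u by simp
  qed
  show "(\<Sum>b\<in>B. vscale L (p b l) (d b)) = l" if l: "l \<in> vcar L"
  proof -
    obtain u where "l = (\<Sum>b\<in>d ` B. vscale L (u b) b)"
      using l unfolding sp(2)[symmetric] L.span_finite[OF finite_imageI[OF fin]] by blast
    then have u: "l = (\<Sum>b\<in>B. vscale L (u (d b)) (d b))"
      by (simp add: sum.reindex[OF inj])
    have "p b l = u (d b)" if b: "b \<in> B" for b
    proof -
      have l: "lin_map L ground_vs (p b)" using assms(3) B[OF b] by (rule bilin_mapD)
      have "p b l = (\<Sum>c\<in>B. p b (vscale L (u (d c)) (d c)))"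
        unfolding u by (rule lin_map_sum[OF assms(2) l]) (use dB is_vspace_carrier[OF assms(2)] in auto)
      also have "\<dots> = (\<Sum>c\<in>B. if c = b then u (d b) else 0)"
        using b dual lin_mapD(3)[OF l] dB by (intro sum.cong) (auto simp: ground_vs_def)
      finally show ?thesis using fin b by simp
    qed
    then show ?thesis using u by simp
  qed
qed

lemma dual_simps [simp]:
  "vcar (hopf_dual H) = {\<theta>. lin_map H ground_vs \<theta> \<and> (\<forall>k. k \<notin> vcar H \<longrightarrow> \<theta> k = 0)}"
  "vscale (hopf_dual H) = pscale"
  by (simp_all add: hopf_dual_def Let_def)

lemma is_vspace_dual: "is_vspace (hopf_dual H)"
  unfolding is_vspace_def
proof
  show v: "vector_space (vscale (hopf_dual H))"
    by (simp add: vector_space_pscale)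
  interpret C: vector_space "vscale (hopf_dual H)" by (rule v)
  show "C.subspace (vcar (hopf_dual H))"
    by (rule C.subspaceI) (auto simp: lin_map_def ground_vs_def pscale_def algebra_simps)
qed

lemma bilin_evaluation: "bilin_map H (hopf_dual H) ground_vs (\<lambda>h \<theta>. \<theta> h)"
  by (auto intro!: bilin_mapI simp: lin_map_def ground_vs_def pscale_def)

locale fd_hopf_alg = hopf_alg +
  assumes fd: "finite_dim H"
begin

abbreviation L :: "('a, 'b \<Rightarrow> 'a) hopf" where "L \<equiv> hopf_dual H"

text \<open>The functionals dual to a basis are its coordinate functions, cut off outside of the carrier.\<close>

lemma ex_dual_bases: "\<exists>B d. dual_bases H L (\<lambda>h \<theta>. \<theta> h) B d"
proof -
  interpret V: vector_space "vscale H" using vs by (simp add: is_vspace_def)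
  interpret D: vector_space "pscale :: 'a \<Rightarrow> ('b \<Rightarrow> 'a) \<Rightarrow> _" by (rule vector_space_pscale)
  obtain B0 where B0: "finite B0" "V.span B0 = vcar H" using fd unfolding finite_dim_def by blast
  obtain B where B: "B \<subseteq> B0" "V.independent B" "B0 \<subseteq> V.span B"
    using V.maximal_independent_subset[of B0] by blast
  have fin: "finite B" using B0(1) B(1) finite_subset by blast
  have sp: "V.span B = vcar H"
    using B(1,3) B0(2) V.span_mono[of B B0] V.span_mono[of B0 "V.span B"] by (auto simp: V.span_span)
  have BH: "b \<in> vcar H" if "b \<in> B" for b using V.span_base[OF that] sp by simp
  define d where "d b = restr (\<lambda>h. V.representation B h b)" for b
  have dL: "d b \<in> vcar L" for b
    using V.representation_add[OF B(2)] V.representation_scale[OF B(2)]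
    by (auto simp: d_def lin_map_def ground_vs_def sp carrier)
  have dual: "d b' b = (if b = b' then 1 else 0)" if "b \<in> B" "b' \<in> B" for b b'
    using V.representation_basis[OF B(2) that(1)] BH that by (auto simp: d_def)
  have inj: "inj_on d B"
    by (rule inj_onI) (metis dual zero_neq_one)
  have exp: "\<theta> = (\<Sum>b\<in>B. pscale (\<theta> b) (d b))" if t: "\<theta> \<in> vcar L" for \<theta>
  proof
    fix h
    have ev: "(\<Sum>b\<in>B. pscale (\<theta> b) (d b)) h = (\<Sum>b\<in>B. \<theta> b * d b h)"
      by (induction B rule: infinite_finite_induct) (auto simp: pscale_def)
    show "\<theta> h = (\<Sum>b\<in>B. pscale (\<theta> b) (d b)) h"
    proof (cases "h \<in> vcar H")
      case True
      have l: "lin_map H ground_vs \<theta>" using t by simp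
      have "\<theta> h = \<theta> (\<Sum>b\<in>B. vscale H (V.representation B h b) b)"
        using True sp V.sum_representation_eq[OF B(2) _ fin order.refl, of h] by simp
      also have "\<dots> = (\<Sum>b\<in>B. \<theta> (vscale H (V.representation B h b) b))"
        by (rule lin_map_sum[OF vs l]) (use BH carrier in auto)
      also have "\<dots> = (\<Sum>b\<in>B. \<theta> b * d b h)"
        using lin_mapD(3)[OF l] BH True by (intro sum.cong) (auto simp: ground_vs_def d_def)
      finally show ?thesis unfolding ev .
    next
      case False
      then show ?thesis unfolding ev using t by (simp add: d_def)
    qed
  qed
  have spL: "D.span (d ` B) = vcar L"
  proof
    have "D.subspace (vcar L)" using is_vspace_dual[of H] by (simp add: is_vspace_def)
    then show "D.span (d ` B) \<subseteq> vcar L" using dL by (intro D.span_minimal) blast+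
    show "vcar L \<subseteq> D.span (d ` B)"
      using exp by (metis (no_types, lifting) D.span_base D.span_scale D.span_sum imageI subsetI)
  qed
  have indep: "D.independent (d ` B)"
  proof (rule D.independent_if_scalars_zero)
    fix u x assume z: "(\<Sum>x\<in>d ` B. pscale (u x) x) = 0" and x: "x \<in> d ` B"
    then obtain b where b: "b \<in> B" "x = d b" by blast
    have "(\<Sum>x\<in>d ` B. pscale (u x) x) b = (\<Sum>x\<in>B. u (d x) * d x b)"
      unfolding sum.reindex[OF inj] comp_def using fin
      by (induction B rule: infinite_finite_induct) (auto simp: pscale_def)
    also have "\<dots> = (\<Sum>c\<in>B. if c = b then u x else 0)"
      using b dual by (intro sum.cong) auto
    finally show "u x = 0" using z b fin by simp
  qed (use fin in simp)
  have "dual_bases H L (\<lambda>h \<theta>. \<theta> h) B d"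
    using fin B(2) sp inj indep spL dual by (simp add: dual_bases_def)
  then show ?thesis by blast
qed

section \<open>Bijectivity of the antipode\<close>

text \<open>Integrals are constructed as traces, with respect to a fixed pair of dual bases.\<close>

context
  fixes B d
  assumes dual: "dual_bases H L (\<lambda>h \<theta>. \<theta> h) B d"
begin

lemmas expand_id = dual_bases_expand[OF vs is_vspace_dual bilin_evaluation dual]

lemma lin_d: "b \<in> B \<Longrightarrow> lin_map H ground_vs (d b)"
  using expand_id(3) by simp

lemma expand:
  assumes "lin_map H U F" "h \<in> vcar H"
  shows "(\<Sum>b\<in>B. vscale U (d b h) (F b)) = F h"
proof -
  have "F h = F (\<Sum>b\<in>B. vscale H (d b h) b)" using expand_id(4)[OF assms(2)] by simp
  also have "\<dots> = (\<Sum>b\<in>B. F (vscale H (d b h) b))"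
    by (rule lin_map_sum[OF vs assms(1)]) (use carrier expand_id(2) in auto)
  also have "\<dots> = (\<Sum>b\<in>B. vscale U (d b h) (F b))"
    using lin_mapD(3)[OF assms(1)] expand_id(2) by (intro sum.cong) auto
  finally show ?thesis by simp
qed

lemma expand_ground:
  assumes "lin_map H ground_vs F" "h \<in> vcar H"
  shows "(\<Sum>b\<in>B. d b h * F b) = F h"
  using expand[OF assms] by (simp add: ground_vs_def)

definition trace :: "('b \<Rightarrow> 'b) \<Rightarrow> 'a" where
  "trace u = (\<Sum>b\<in>B. d b (u b))"

lemma trace_cong: "(\<And>x. x \<in> vcar H \<Longrightarrow> u x = v x) \<Longrightarrow> trace u = trace v"
  unfolding trace_def using expand_id(2) by (intro sum.cong) auto

lemma trace_cyclic:
  assumes u: "lin_map H H u" and v: "lin_map H H v"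
  shows "trace (\<lambda>x. u (v x)) = trace (\<lambda>x. v (u x))"
proof -
  have "trace (\<lambda>x. u (v x)) = (\<Sum>b\<in>B. \<Sum>c\<in>B. d c (v b) * d b (u c))"
    unfolding trace_def
    using lin_comp[OF lin_d u] lin_mapD(1)[OF v] expand_id(2)
    by (intro sum.cong expand_ground[symmetric]) auto
  also have "\<dots> = (\<Sum>c\<in>B. \<Sum>b\<in>B. d b (u c) * d c (v b))"
    by (subst sum.swap) (simp add: mult.commute)
  also have "\<dots> = trace (\<lambda>x. v (u x))"
    unfolding trace_def
    using lin_comp[OF lin_d v] lin_mapD(1)[OF u] expand_id(2)
    by (intro sum.cong expand_ground) auto
  finally show ?thesis .
qed

lemma trace_sum:
  assumes "\<And>i x. i \<in> I \<Longrightarrow> x \<in> vcar H \<Longrightarrow> u i x \<in> vcar H"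
  shows "trace (\<lambda>x. \<Sum>i\<in>I. u i x) = (\<Sum>i\<in>I. trace (u i))"
proof -
  have "trace (\<lambda>x. \<Sum>i\<in>I. u i x) = (\<Sum>b\<in>B. \<Sum>i\<in>I. d b (u i b))"
    unfolding trace_def using assms expand_id(2)
    by (intro sum.cong refl lin_map_sum[OF vs lin_d]) auto
  then show ?thesis unfolding trace_def by (subst (asm) sum.swap)
qed

lemma functionals_separate:
  assumes "x \<in> vcar H" "y \<in> vcar H" "\<And>b. b \<in> B \<Longrightarrow> d b x = d b y"
  shows "x = y"
proof -
  have "(\<Sum>b\<in>B. vscale H (d b x) b) = (\<Sum>b\<in>B. vscale H (d b y) b)"
    using assms(3) by (intro sum.cong) auto
  then show ?thesis using expand_id(4) assms(1,2) by metis
qed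

context
  fixes f
  assumes f: "lin_map H ground_vs f"
begin

text \<open>The integral of \<open>g\<close> is the trace of this operator \<open>x \<mapsto> g S\<^sup>2(x\<^sub>1) f(x\<^sub>2)\<close>.  The square of the
  antipode is what makes the insertion of \<open>S\<^sup>2(x\<^sub>2) S(x\<^sub>1) = \<epsilon>(x)\<close> in the proof of invariance possible.\<close>

definition twist :: "'b \<Rightarrow> 'b \<Rightarrow> 'b" where
  "twist g x = sw x (\<lambda>a b. vscale H (f b) (g \<bullet> antipode H (antipode H a)))"

definition integral :: "'b \<Rightarrow> 'a" where
  "integral g = trace (twist g)"

lemma bilin_twist: "bilin_map H H H (\<lambda>x g. twist g x)"
  unfolding twist_def by (auto intro!: lin_rules lin_comp[OF f] simp: carrier)

lemma lin_twist: "x \<in> vcar H \<Longrightarrow> lin_map H H (\<lambda>g. twist g x)" "g \<in> vcar H \<Longrightarrow> lin_map H H (twist g)"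
  using bilin_mapD[OF bilin_twist] by auto

lemma twist_in: "x \<in> vcar H \<Longrightarrow> g \<in> vcar H \<Longrightarrow> twist g x \<in> vcar H"
  using bilin_mapD[OF bilin_twist] by auto

lemma lin_integral: "lin_map H ground_vs integral"
  unfolding integral_def trace_def
  using lin_twist(1) expand_id(2)
  by (intro lin_sum is_vspace_ground lin_comp[OF lin_d]) auto

definition contract :: "('b \<Rightarrow> 'a) \<Rightarrow> 'b \<Rightarrow> 'b" where
  "contract \<phi> x = sw x (\<lambda>a b. vscale H (\<phi> a) b)"

lemma lin_contract: "lin_map H ground_vs \<phi> \<Longrightarrow> lin_map H H (contract \<phi>)"
  unfolding contract_def by (auto intro!: lin_rules lin_comp[of H ground_vs \<phi>] simp: carrier)

lemma contract_in: "lin_map H ground_vs \<phi> \<Longrightarrow> x \<in> vcar H \<Longrightarrow> contract \<phi> x \<in> vcar H"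
  using lin_mapD(1)[OF lin_contract] .

lemma lin_contract_param:
  assumes "\<And>a. a \<in> vcar H \<Longrightarrow> lin_map H ground_vs (\<lambda>y. \<Phi> y a)" "x \<in> vcar H"
  shows "lin_map H H (\<lambda>y. contract (\<Phi> y) x)"
  unfolding contract_def using assms by (auto intro!: lin_rules)

lemma bilin_antipode_flip:
  assumes "is_vspace U" "bilin_map H H U F"
  shows "bilin_map H H U (\<lambda>x y. F (antipode H y) (antipode H x))"
  using bilin_mapD[OF assms(2)]
  by (auto intro!: bilin_mapI lin_comp[OF bilin_mapD(1)[OF assms(2)] lin_antipode] 
     lin_comp[OF bilin_mapD(2)[OF assms(2)] lin_antipode])

lemma sw_antipode2:
  assumes "h \<in> vcar H" "is_vspace U" "bilin_map H H U F"
  shows "sw (antipode H (antipode H h)) F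
    = sw h (\<lambda>a b. F (antipode H (antipode H a)) (antipode H (antipode H b)))"
  using assms(1)
  by (simp add: sw_antipode[OF _ assms(2,3)]
      sw_antipode[OF _ assms(2) bilin_antipode_flip[OF assms(2,3)]])

text \<open>The coefficient \<open>\<phi>(g\<^sub>1)\<close> is \<open>\<phi>(g\<^sub>1 S\<^sup>2(x\<^sub>2) S(x\<^sub>1))\<close>, up to a counit.  Splitting it along
  \<open>\<phi>(y z) = \<Sum>\<^sub>c \<phi>(y c) d\<^sub>c(z)\<close> leaves one factor that acts after the twist and one that acts before it.\<close>

lemma contract_twist:
  assumes \<phi>: "lin_map H ground_vs \<phi>" and g: "g \<in> vcar H" and x: "x \<in> vcar H"
  shows "(\<Sum>c\<in>B. contract (\<lambda>y. \<phi> (y \<bullet> c)) (twist g (contract (\<lambda>y. d c (antipode H y)) x)))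
    = sw g (\<lambda>p q. vscale H (\<phi> p) (twist q x))"
proof -
  let ?S = "antipode H"
  let ?\<phi> = "\<lambda>y x. \<phi> (x \<bullet> y)"
  have l\<phi>: "lin_map H ground_vs (\<lambda>x. ?\<phi> y x)" "lin_map H ground_vs (\<lambda>x. ?\<phi> x y)" if "y \<in> vcar H" for y
    using that by (auto intro!: lin_comp[OF \<phi>] lin_rules)
  have lc: "lin_map H H (\<lambda>x. contract (?\<phi> y) (twist g x))" if "y \<in> vcar H" for y
    using that g by (intro lin_comp[OF lin_contract[OF l\<phi>(1)] lin_twist(2)])
  have 1: "contract (?\<phi> c) (twist g (contract (\<lambda>y. d c (?S y)) x))
     = sw x (\<lambda>x1 x2. vscale H (d c (?S x1)) (contract (?\<phi> c) (twist g x2)))" if c: "c \<in> B" for c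
    unfolding contract_def[of "\<lambda>y. d c (?S y)"]
    using x expand_id(2)[OF c]
    by (subst lin_map_sw[OF lc x vs])
      (auto intro!: sw_cong simp: carrier lin_mapD(3)[OF lc])
  have 2: "contract (?\<phi> y) (twist g x) =
     sw g (\<lambda>p q. sw x (\<lambda>a b. sw a (\<lambda>a1 a2. 
       vscale H (f b) (vscale H (\<phi> ((p \<bullet> ?S (?S a1)) \<bullet> y)) (q \<bullet> ?S (?S a2))))))"
    if y: "y \<in> vcar H" and x: "x \<in> vcar H" for x y
  proof -
    let ?F = "\<lambda>u v. vscale H (\<phi> (u \<bullet> y)) v"
    have F: "bilin_map H H H ?F" using y by (auto intro!: lin_rules lin_comp[OF \<phi>])
    have pF: "bilin_map H H H (\<lambda>u v. ?F (p \<bullet> u) (q \<bullet> v))" if "p \<in> vcar H" "q \<in> vcar H" for p q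
      using y that by (auto intro!: lin_rules lin_comp[OF \<phi>])
    have "contract (?\<phi> y) (twist g x) = sw x (\<lambda>a b. vscale H (f b) (contract (?\<phi> y) (g \<bullet> ?S (?S a))))"
      unfolding twist_def using g x
      by (subst lin_map_sw[OF lin_contract[OF l\<phi>(1)[OF y]] x vs])
        (auto intro!: sw_cong simp: carrier lin_mapD(3)[OF lin_contract[OF l\<phi>(1)[OF y]]])
    also have "\<dots> = sw x (\<lambda>a b. sw g (\<lambda>p q. sw a (\<lambda>a1 a2. vscale H (f b) (?F (p \<bullet> ?S (?S a1)) (q \<bullet> ?S (?S a2))))))"
    proof (rule sw_cong[OF x])
      fix a b assume ab: "a \<in> vcar H" "b \<in> vcar H"
      have "contract (?\<phi> y) (g \<bullet> ?S (?S a)) = sw g (\<lambda>p q. sw (?S (?S a)) (\<lambda>u v. ?F (p \<bullet> u) (q \<bullet> v)))"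
        unfolding contract_def using g ab by (intro sw_mult[OF vs F]) auto
      also have "\<dots> = sw g (\<lambda>p q. sw a (\<lambda>a1 a2. ?F (p \<bullet> ?S (?S a1)) (q \<bullet> ?S (?S a2))))"
        using g ab by (intro sw_cong sw_antipode2[OF _ vs pF]) auto
      finally have *: "contract (?\<phi> y) (g \<bullet> ?S (?S a)) = \<dots>" .
      show "vscale H (f b) (contract (?\<phi> y) (g \<bullet> ?S (?S a)))
        = sw g (\<lambda>p q. sw a (\<lambda>a1 a2. vscale H (f b) (?F (p \<bullet> ?S (?S a1)) (q \<bullet> ?S (?S a2)))))"
        unfolding * using g ab
        by (subst lin_map_sw[where f = "vscale H (f b)" and U = H and U' = H])
          (auto intro!: lin_scale_right[OF vs] lin_id sw_cong sw_in[OF vs] carrier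
             lin_map_sw[where U = H and U' = H])
    qed
    also have "\<dots> = sw g (\<lambda>p q. sw x (\<lambda>a b. sw a (\<lambda>a1 a2. vscale H (f b) (?F (p \<bullet> ?S (?S a1)) (q \<bullet> ?S (?S a2))))))"
      by (rule tsum_swap)
    finally show ?thesis .
  qed
  have "(\<Sum>c\<in>B. contract (?\<phi> c) (twist g (contract (\<lambda>y. d c (?S y)) x)))
    = (\<Sum>c\<in>B. sw x (\<lambda>x1 x2. vscale H (d c (?S x1)) (contract (?\<phi> c) (twist g x2))))"
    using 1 by (intro sum.cong) auto
  also have "\<dots> = sw x (\<lambda>x1 x2. \<Sum>c\<in>B. vscale H (d c (?S x1)) (contract (?\<phi> c) (twist g x2)))"
    by (simp add: tsum_sum)
  also have "\<dots> = sw x (\<lambda>x1 x2. contract (?\<phi> (?S x1)) (twist g x2))"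
    using x g
    by (intro sw_cong expand[where U = H] lin_contract_param l\<phi> twist_in) auto
  also have "\<dots> = sw x (\<lambda>x1 x2. sw g (\<lambda>p q. sw x2 (\<lambda>a b. sw a (\<lambda>a1 a2. 
       vscale H (f b) (vscale H (\<phi> ((p \<bullet> ?S (?S a1)) \<bullet> ?S x1)) (q \<bullet> ?S (?S a2)))))))"
    using x by (intro sw_cong 2) auto
  also have "\<dots> = sw g (\<lambda>p q. sw x (\<lambda>x1 x2. sw x2 (\<lambda>a b. sw a (\<lambda>a1 a2. 
       vscale H (f b) (vscale H (\<phi> ((p \<bullet> ?S (?S a1)) \<bullet> ?S x1)) (q \<bullet> ?S (?S a2)))))))"
    by (rule tsum_swap)
  also have "\<dots> = sw g (\<lambda>p q. vscale H (\<phi> p) (twist q x))"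
  proof (rule sw_cong[OF g])
    fix p q assume pq: "p \<in> vcar H" "q \<in> vcar H"
    let ?K = "\<lambda>x1 a1 a2 b. vscale H (f b) (vscale H (\<phi> ((p \<bullet> ?S (?S a1)) \<bullet> ?S x1)) (q \<bullet> ?S (?S a2)))"
    have "sw x (\<lambda>x1 x2. sw x2 (\<lambda>a b. sw a (\<lambda>a1 a2. ?K x1 a1 a2 b)))
      = sw x (\<lambda>x1 x2. sw x2 (\<lambda>a1 v. sw v (\<lambda>a2 b. ?K x1 a1 a2 b)))"
      using x pq by (intro sw_cong coassoc[OF _ vs]) (auto intro!: lin_rules lin_comp[OF \<phi>] lin_comp[OF f] simp: carrier)
    also have "\<dots> = sw x (\<lambda>x1 x2. sw x2 (\<lambda>a1 v. vscale H (\<phi> (p \<bullet> ?S (x1 \<bullet> ?S a1))) (twist q v)))"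
    proof (intro sw_cong)
      fix x1 x2 a1 v assume i: "x1 \<in> vcar H" "x2 \<in> vcar H" "a1 \<in> vcar H" "v \<in> vcar H"
      have "vscale H (\<phi> (p \<bullet> ?S (x1 \<bullet> ?S a1))) (twist q v)
        = sw v (\<lambda>a2 b. vscale H (\<phi> (p \<bullet> ?S (x1 \<bullet> ?S a1))) (vscale H (f b) (q \<bullet> ?S (?S a2))))"
        unfolding twist_def using i pq
        by (intro lin_map_sw[where U = H and U' = H] lin_scale_right[OF vs] lin_id) (auto intro!: carrier)
      also have "\<dots> = sw v (\<lambda>a2 b. ?K x1 a1 a2 b)"
        using i pq by (intro sw_cong) (auto simp: antipode_mult mult(2) vscale_laws[OF vs] mult.commute)
      finally show "sw v (\<lambda>a2 b. ?K x1 a1 a2 b) = vscale H (\<phi> (p \<bullet> ?S (x1 \<bullet> ?S a1))) (twist q v)" by simp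
    qed (use x in auto)
    also have "\<dots> = sw x (\<lambda>u v. sw u (\<lambda>x1 a1. vscale H (\<phi> (p \<bullet> ?S (x1 \<bullet> ?S a1))) (twist q v)))"
      using x pq by (intro coassoc[OF _ vs, symmetric])
        (auto intro!: lin_rules lin_comp[OF \<phi>] lin_twist twist_in simp: carrier)
    also have "\<dots> = sw x (\<lambda>u v. vscale H (counit H u) (vscale H (\<phi> p) (twist q v)))"
      using x pq
      by (intro sw_cong trans[OF antipode_right[where U = H and f = "\<lambda>z. vscale H (\<phi> (p \<bullet> ?S z)) (twist q _)"]])
       (auto intro!: lin_rules lin_comp[OF \<phi>] twist_in simp: antipode_one)
    also have "\<dots> = vscale H (\<phi> p) (twist q x)"
      using x pq by (intro counit_left[where U = H] lin_scale_right[OF vs] lin_twist) auto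
    finally show "sw x (\<lambda>x1 x2. sw x2 (\<lambda>a b. sw a (\<lambda>a1 a2. ?K x1 a1 a2 b))) = vscale H (\<phi> p) (twist q x)" .
  qed
  finally show ?thesis .
qed

text \<open>In this order, which they acquire under cyclic permutation, the two factors of \<open>contract_twist\<close>
  compose to \<open>\<phi>(x\<^sub>1 S(x\<^sub>2)) x\<^sub>3\<close>, which is a multiple of \<open>x\<close>.\<close>

lemma contract_contract:
  assumes \<phi>: "lin_map H ground_vs \<phi>" and x: "x \<in> vcar H"
  shows "(\<Sum>c\<in>B. contract (\<lambda>y. d c (antipode H y)) (contract (\<lambda>y. \<phi> (y \<bullet> c)) x)) = vscale H (\<phi> \<one>\<^bsub>H\<^esub>) x"
proof -
  let ?S = "antipode H"
  have ld: "lin_map H ground_vs (\<lambda>y. d c (?S y))" if "c \<in> B" for c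
    by (rule lin_comp[OF lin_d[OF that] lin_antipode])
  have "(\<Sum>c\<in>B. contract (\<lambda>y. d c (?S y)) (contract (\<lambda>y. \<phi> (y \<bullet> c)) x))
    = (\<Sum>c\<in>B. sw x (\<lambda>x1 x2. vscale H (\<phi> (x1 \<bullet> c)) (contract (\<lambda>y. d c (?S y)) x2)))"
    unfolding contract_def[of "\<lambda>y. \<phi> (y \<bullet> _)"] using x
    by (intro sum.cong refl, subst lin_map_sw[OF lin_contract[OF ld] x vs])
      (auto intro!: sw_cong simp: carrier lin_mapD(3)[OF lin_contract[OF ld]])
  also have "\<dots> = (\<Sum>c\<in>B. sw x (\<lambda>x1 x2. sw x2 (\<lambda>y z. vscale H (\<phi> (x1 \<bullet> c)) (vscale H (d c (?S y)) z))))"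
    unfolding contract_def using x
    by (intro sum.cong refl sw_cong lin_map_sw[where U = H and U' = H] lin_scale_right[OF vs] lin_id)
      (auto intro!: carrier)
  also have "\<dots> = sw x (\<lambda>x1 x2. sw x2 (\<lambda>y z. \<Sum>c\<in>B. vscale H (d c (?S y)) (vscale H (\<phi> (x1 \<bullet> c)) z)))"
    by (simp add: tsum_sum vscale_laws[OF vs] mult.commute)
  also have "\<dots> = sw x (\<lambda>x1 x2. sw x2 (\<lambda>y z. vscale H (\<phi> (x1 \<bullet> ?S y)) z))"
    using x by (intro sw_cong expand[where U = H]) (auto intro!: lin_rules lin_comp[OF \<phi>])
  also have "\<dots> = sw x (\<lambda>u z. sw u (\<lambda>x1 y. vscale H (\<phi> (x1 \<bullet> ?S y)) z))"
    using x by (intro coassoc[OF _ vs, symmetric]) (auto intro!: lin_rules lin_comp[OF \<phi>])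
  also have "\<dots> = sw x (\<lambda>u z. vscale H (counit H u) (vscale H (\<phi> \<one>\<^bsub>H\<^esub>) z))"
    using x by (intro sw_cong antipode_right[where U = H and f = "\<lambda>w. vscale H (\<phi> w) _"])
      (auto intro!: lin_rules lin_comp[OF \<phi>])
  also have "\<dots> = vscale H (\<phi> \<one>\<^bsub>H\<^esub>) x"
    using x by (intro counit_left[where U = H] lin_scale_right[OF vs] lin_id)
  finally show ?thesis .
qed

text \<open>Invariance tested on functionals: \<open>contract_twist\<close> writes the left-hand side as a sum of traces, and
  cyclicity of the trace brings the two contractions next to each other.\<close>

lemma integral_functional_invariant:
  assumes \<phi>: "lin_map H ground_vs \<phi>" and g: "g \<in> vcar H"
  shows "sw g (\<lambda>p q. \<phi> p * integral q) = \<phi> \<one>\<^bsub>H\<^esub> * integral g"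
proof -
  let ?S = "antipode H"
  have ld: "lin_map H ground_vs (\<lambda>y. d c (?S y))" if "c \<in> B" for c
    by (rule lin_comp[OF lin_d[OF that] lin_antipode])
  have l\<phi>: "lin_map H ground_vs (\<lambda>x. \<phi> (x \<bullet> c))" if "c \<in> B" for c
    using expand_id(2)[OF that] by (auto intro!: lin_comp[OF \<phi>] lin_rules)
  have "sw g (\<lambda>p q. \<phi> p * integral q) = sw g (\<lambda>p q. \<Sum>b\<in>B. d b (vscale H (\<phi> p) (twist q b)))"
    unfolding integral_def trace_def sum_distrib_left
    using g expand_id(2) twist_in lin_mapD(3)[OF lin_d]
    by (intro sw_cong sum.cong) (auto simp: ground_vs_def)
  also have "\<dots> = trace (\<lambda>x. sw g (\<lambda>p q. vscale H (\<phi> p) (twist q x)))"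
    unfolding tsum_sum trace_def
    using g expand_id(2) twist_in 
    by (intro sum.cong refl lin_map_sw[OF lin_d g vs, symmetric]) (auto intro!: carrier)
  also have "\<dots> = trace (\<lambda>x. \<Sum>c\<in>B. contract (\<lambda>y. \<phi> (y \<bullet> c)) (twist g (contract (\<lambda>y. d c (?S y)) x)))"
    using contract_twist[OF \<phi> g] by (intro trace_cong) simp
  also have "\<dots> = (\<Sum>c\<in>B. trace (\<lambda>x. contract (\<lambda>y. \<phi> (y \<bullet> c)) (twist g (contract (\<lambda>y. d c (?S y)) x))))"
    using g by (intro trace_sum contract_in twist_in ld l\<phi>)
  also have "\<dots> = (\<Sum>c\<in>B. trace (\<lambda>x. twist g (contract (\<lambda>y. d c (?S y)) (contract (\<lambda>y. \<phi> (y \<bullet> c)) x))))"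
    using g by (intro sum.cong refl trace_cyclic[where u = "contract _"] lin_contract ld l\<phi>
        lin_comp[OF lin_twist(2) lin_contract])
  also have "\<dots> = trace (\<lambda>x. \<Sum>c\<in>B. twist g (contract (\<lambda>y. d c (?S y)) (contract (\<lambda>y. \<phi> (y \<bullet> c)) x)))"
    using g by (intro trace_sum[symmetric] contract_in twist_in ld l\<phi>)
  also have "\<dots> = trace (\<lambda>x. vscale H (\<phi> \<one>\<^bsub>H\<^esub>) (twist g x))"
  proof (rule trace_cong)
    fix x assume x: "x \<in> vcar H"
    have "(\<Sum>c\<in>B. twist g (contract (\<lambda>y. d c (?S y)) (contract (\<lambda>y. \<phi> (y \<bullet> c)) x)))
      = twist g (\<Sum>c\<in>B. contract (\<lambda>y. d c (?S y)) (contract (\<lambda>y. \<phi> (y \<bullet> c)) x))"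
      using x by (intro lin_map_sum[OF vs lin_twist(2)[OF g], symmetric] contract_in ld l\<phi>)
    then show "(\<Sum>c\<in>B. twist g (contract (\<lambda>y. d c (?S y)) (contract (\<lambda>y. \<phi> (y \<bullet> c)) x)))
      = vscale H (\<phi> \<one>\<^bsub>H\<^esub>) (twist g x)"
      using x by (simp add: contract_contract[OF \<phi>] lin_mapD(3)[OF lin_twist(2)[OF g]])
  qed
  also have "\<dots> = \<phi> \<one>\<^bsub>H\<^esub> * integral g"
    unfolding integral_def trace_def sum_distrib_left
    using g expand_id(2) twist_in lin_mapD(3)[OF lin_d]
    by (intro sum.cong) (auto simp: ground_vs_def)
  finally show ?thesis .
qed

lemma integral_invariant:
  assumes g: "g \<in> vcar H"
  shows "sw g (\<lambda>p q. vscale H (integral q) p) = vscale H (integral g) \<one>\<^bsub>H\<^esub>"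
proof (rule functionals_separate)
  fix b assume b: "b \<in> B"
  have "d b (sw g (\<lambda>p q. vscale H (integral q) p)) = sw g (\<lambda>p q. d b (vscale H (integral q) p))"
    using g by (intro lin_map_sw[OF lin_d[OF b] g vs]) (auto simp: carrier)
  also have "\<dots> = sw g (\<lambda>p q. d b p * integral q)"
    using g lin_mapD(3)[OF lin_d[OF b]] by (intro sw_cong) (auto simp: ground_vs_def)
  finally show "d b (sw g (\<lambda>p q. vscale H (integral q) p)) = d b (vscale H (integral g) \<one>\<^bsub>H\<^esub>)"
    using integral_functional_invariant[OF lin_d[OF b] g] lin_mapD(3)[OF lin_d[OF b]]
    by (simp add: ground_vs_def)
qed (use g in \<open>auto intro!: sw_in carrier\<close>)

end

text \<open>Invariance at \<open>g S(h\<^sub>1)\<close>, multiplied by \<open>h\<^sub>2\<close>: the factors \<open>S(h\<^sub>2) h\<^sub>3\<close> that appear on the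
  other side cancel.\<close>

lemma integral_antipode:
  assumes l: "lin_map H ground_vs l"
    and inv: "\<And>g. g \<in> vcar H \<Longrightarrow> sw g (\<lambda>p q. vscale H (l q) p) = vscale H (l g) \<one>\<^bsub>H\<^esub>"
    and g: "g \<in> vcar H" and h: "h \<in> vcar H"
  shows "sw h (\<lambda>a b. vscale H (l (g \<bullet> antipode H a)) b)
    = sw g (\<lambda>p q. vscale H (l (q \<bullet> antipode H h)) p)"
proof -
  let ?S = "antipode H"
  note lr = lin_rules lin_comp[OF l]
  have "sw h (\<lambda>a b. vscale H (l (g \<bullet> ?S a)) b)
    = sw h (\<lambda>u c. sw g (\<lambda>p q. sw u (\<lambda>a b. vscale H (l (q \<bullet> ?S a)) (p \<bullet> (?S b \<bullet> c)))))"
  proof (rule sw_cong[OF h])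
    fix u c assume uc: "u \<in> vcar H" "c \<in> vcar H"
    let ?F = "\<lambda>p q. vscale H (l q) (p \<bullet> c)"
    have F: "bilin_map H H H ?F" using uc by (auto intro!: lr simp: carrier)
    have pF: "bilin_map H H H (\<lambda>x y. ?F (p \<bullet> x) (q \<bullet> y))" if "p \<in> vcar H" "q \<in> vcar H" for p q
      using uc that by (auto intro!: lr simp: carrier)
    have "vscale H (l (g \<bullet> ?S u)) c = vscale H (l (g \<bullet> ?S u)) \<one>\<^bsub>H\<^esub> \<bullet> c"
      using uc by (simp add: mult(6))
    also have "\<dots> = sw (g \<bullet> ?S u) (\<lambda>p q. vscale H (l q) p) \<bullet> c"
      using uc g by (simp add: inv)
    also have "\<dots> = sw (g \<bullet> ?S u) (\<lambda>p q. vscale H (l q) p \<bullet> c)"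
      using uc g by (intro lin_map_sw[where U = H and U' = H] lin_mult_left[OF balg] lin_id) (auto simp: carrier)
    also have "\<dots> = sw (g \<bullet> ?S u) ?F"
      using uc g by (intro sw_cong) (auto simp: mult(6))
    also have "\<dots> = sw g (\<lambda>p q. sw (?S u) (\<lambda>x y. ?F (p \<bullet> x) (q \<bullet> y)))"
      using uc g by (intro sw_mult[OF vs F]) auto
    also have "\<dots> = sw g (\<lambda>p q. sw u (\<lambda>a b. ?F (p \<bullet> ?S b) (q \<bullet> ?S a)))"
      using uc g by (intro sw_cong sw_antipode[OF _ vs pF]) auto
    also have "\<dots> = sw g (\<lambda>p q. sw u (\<lambda>a b. vscale H (l (q \<bullet> ?S a)) (p \<bullet> (?S b \<bullet> c))))"
      using uc g by (intro sw_cong) (auto simp: mult(2))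
    finally show "vscale H (l (g \<bullet> ?S u)) c
      = sw g (\<lambda>p q. sw u (\<lambda>a b. vscale H (l (q \<bullet> ?S a)) (p \<bullet> (?S b \<bullet> c))))" .
  qed
  also have "\<dots> = sw g (\<lambda>p q. sw h (\<lambda>u c. sw u (\<lambda>a b. vscale H (l (q \<bullet> ?S a)) (p \<bullet> (?S b \<bullet> c)))))"
    by (rule tsum_swap)
  also have "\<dots> = sw g (\<lambda>p q. sw h (\<lambda>a v. sw v (\<lambda>b c. vscale H (l (q \<bullet> ?S a)) (p \<bullet> (?S b \<bullet> c)))))"
    using g h by (intro sw_cong coassoc[OF _ vs]) (auto intro!: lr simp: carrier)
  also have "\<dots> = sw g (\<lambda>p q. sw h (\<lambda>a v. vscale H (counit H v) (vscale H (l (q \<bullet> ?S a)) p)))"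
    using g h
    by (intro sw_cong trans[OF antipode_left[where U = H and f = "\<lambda>w. vscale H (l (_ \<bullet> ?S _)) (_ \<bullet> w)"]])
      (auto intro!: lr simp: carrier)
  also have "\<dots> = sw g (\<lambda>p q. vscale H (l (q \<bullet> ?S h)) p)"
    using g h by (intro sw_cong counit_right[where U = H]) (auto intro!: lr simp: carrier)
  finally show ?thesis .
qed

text \<open>The identity \<open>l(g) h = l(g S\<^sup>2(h\<^sub>2) S(h\<^sub>1)) h\<^sub>3\<close> holds for every \<open>h\<close>.  Expanding \<open>h\<^sub>2\<close> in the
  basis, its right-hand side becomes a sum of linear images of \<open>l(k S(h\<^sub>1)) h\<^sub>2\<close> for various \<open>k\<close>, and these
  vanish by \<open>integral_antipode\<close>.\<close>

lemma integral_kills_antipode_kernel: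
  assumes l: "lin_map H ground_vs l"
    and inv: "\<And>g. g \<in> vcar H \<Longrightarrow> sw g (\<lambda>p q. vscale H (l q) p) = vscale H (l g) \<one>\<^bsub>H\<^esub>"
    and g: "g \<in> vcar H" and h: "h \<in> vcar H" and Sh: "antipode H h = 0"
  shows "vscale H (l g) h = 0"
proof -
  let ?S = "antipode H"
  note lr = lin_rules lin_comp[OF l]
  have l0: "l 0 = 0" by (rule lin_map_0[OF vs l])
  have zero: "sw h (\<lambda>a b. vscale H (l (k \<bullet> ?S a)) b) = 0" if k: "k \<in> vcar H" for k
  proof -
    have "q \<bullet> 0 = 0" if "q \<in> vcar H" for q
      using that by (intro lin_map_0[OF vs lin_mult_right[OF balg lin_id]])
    then have "sw k (\<lambda>p q. vscale H (l (q \<bullet> ?S h)) p) = sw k (\<lambda>p q. 0)"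
      using k by (intro sw_cong) (auto simp: Sh l0 vscale_laws[OF vs])
    then show ?thesis
      by (simp add: integral_antipode[OF l inv k h]) (simp add: tsum_def case_prod_unfold)
  qed
  let ?T = "\<lambda>b v. sw v (\<lambda>y z. vscale H (d b y) z)"
  have T: "lin_map H H (?T b)" if "b \<in> B" for b
    using that by (auto intro!: lr lin_comp[OF lin_d] simp: carrier)
  have "vscale H (l g) h = sw h (\<lambda>u c. vscale H (counit H u) (vscale H (l g) c))"
    using h by (intro counit_left[where U = H, symmetric] lin_scale_right[OF vs] lin_id)
  also have "\<dots> = sw h (\<lambda>u c. sw u (\<lambda>a b. vscale H (l (g \<bullet> ?S (a \<bullet> ?S b))) c))"
    using g h
    by (intro sw_cong trans[OF _ antipode_right[where U = H and f = "\<lambda>w. vscale H (l (g \<bullet> ?S w)) _", symmetric]])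
     (auto intro!: lr simp: carrier antipode_one)
  also have "\<dots> = sw h (\<lambda>a v. sw v (\<lambda>b c. vscale H (l (g \<bullet> ?S (a \<bullet> ?S b))) c))"
    using g h by (intro coassoc[OF _ vs]) (auto intro!: lr simp: carrier)
  also have "\<dots> = sw h (\<lambda>a v. sw v (\<lambda>y c. \<Sum>b\<in>B. vscale H (d b y) (vscale H (l (g \<bullet> ?S (a \<bullet> ?S b))) c)))"
    using g h by (intro sw_cong expand[where U = H, symmetric]) (auto intro!: lr simp: carrier)
  also have "\<dots> = (\<Sum>b\<in>B. sw h (\<lambda>a v. ?T b (vscale H (l ((g \<bullet> ?S (?S b)) \<bullet> ?S a)) v)))"
  proof -
    have "sw v (\<lambda>y c. vscale H (d b y) (vscale H (l (g \<bullet> ?S (a \<bullet> ?S b))) c))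
      = ?T b (vscale H (l ((g \<bullet> ?S (?S b)) \<bullet> ?S a)) v)"
      if "b \<in> B" "a \<in> vcar H" "v \<in> vcar H" for a b v
    proof -
      have "?T b (vscale H (l ((g \<bullet> ?S (?S b)) \<bullet> ?S a)) v)
        = vscale H (l ((g \<bullet> ?S (?S b)) \<bullet> ?S a)) (?T b v)"
        using that by (intro lin_mapD(3)[OF T]) auto
      also have "\<dots> = sw v (\<lambda>y c. vscale H (l ((g \<bullet> ?S (?S b)) \<bullet> ?S a)) (vscale H (d b y) c))"
        using that by (intro lin_map_sw[where U = H and U' = H] lin_scale_right[OF vs] lin_id) (auto intro!: carrier)
      also have "\<dots> = sw v (\<lambda>y c. vscale H (d b y) (vscale H (l (g \<bullet> ?S (a \<bullet> ?S b))) c))"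
        using that g expand_id(2)[OF that(1)]
        by (intro sw_cong) (auto simp: antipode_mult mult(2) vscale_laws[OF vs] mult.commute)
      finally show ?thesis by simp
    qed
    then show ?thesis
      unfolding tsum_sum using h by (intro sum.cong refl sw_cong) auto
  qed
  also have "\<dots> = (\<Sum>b\<in>B. ?T b (sw h (\<lambda>a v. vscale H (l ((g \<bullet> ?S (?S b)) \<bullet> ?S a)) v)))"
    using h by (intro sum.cong refl lin_map_sw[OF T h vs, symmetric]) (auto intro!: carrier)
  also have "\<dots> = (\<Sum>b\<in>B. ?T b 0)"
    using g expand_id(2) by (intro sum.cong refl arg_cong[of _ _ "?T _"] zero) auto
  also have "\<dots> = 0"
    using lin_map_0[OF vs T] by simp
  finally show ?thesis .
qed

text \<open>The functional \<open>f\<close> can be recovered from the integrals of its products with the dual basis, since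
  \<open>S(x\<^sub>2) S\<^sup>2(x\<^sub>1) = \<epsilon>(x)\<close>.  For the counit in the place of \<open>f\<close>, the integrals of \<open>S c\<close> sum up to
  \<open>\<epsilon>(1) = 1\<close>, so they cannot all vanish.\<close>

lemma ex_nonzero_integral: "\<exists>f g. lin_map H ground_vs f \<and> g \<in> vcar H \<and> integral f g \<noteq> 0"
proof (rule ccontr)
  assume "\<not> ?thesis"
  then have zero: "integral f g = 0" if "lin_map H ground_vs f" "g \<in> vcar H" for f g using that by blast
  let ?S = "antipode H" and ?e = "counit H"
  have e: "lin_map H ground_vs ?e" by (rule lin_counit)
  let ?f = "\<lambda>c x. sw x (\<lambda>a b. d c a * ?e b)"
  have lf: "lin_map H ground_vs (?f c)" if "c \<in> B" for c
    using that by (auto intro!: lin_rules lin_comp[OF lin_d] lin_comp[OF e])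
  have tw: "(\<Sum>c\<in>B. twist (?f c) (?S c) x) = vscale H (?e x) \<one>\<^bsub>H\<^esub>" if x: "x \<in> vcar H" for x
  proof -
    have "(\<Sum>c\<in>B. twist (?f c) (?S c) x)
      = (\<Sum>c\<in>B. sw x (\<lambda>a v. sw v (\<lambda>y b. vscale H (d c y) (vscale H (?e b) (?S c \<bullet> ?S (?S a))))))"
    proof (intro sum.cong refl)
      fix c assume c: "c \<in> B"
      then have cH: "c \<in> vcar H" by (rule expand_id(2))
      show "twist (?f c) (?S c) x
        = sw x (\<lambda>a v. sw v (\<lambda>y b. vscale H (d c y) (vscale H (?e b) (?S c \<bullet> ?S (?S a)))))"
        unfolding twist_def[OF lf[OF c]]
      proof (rule sw_cong[OF x])
        fix a v assume av: "a \<in> vcar H" "v \<in> vcar H"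
        let ?w = "?S c \<bullet> ?S (?S a)"
        have "vscale H (?f c v) ?w = sw v (\<lambda>y b. vscale H (d c y * ?e b) ?w)"
          using av cH
          by (intro lin_map_sw[where U = ground_vs and U' = H and f = "\<lambda>s. vscale H s ?w"] lin_scale_left lin_id
              is_vspace_ground vs) (auto simp: ground_vs_def)
        then show "vscale H (?f c v) ?w = sw v (\<lambda>y b. vscale H (d c y) (vscale H (?e b) ?w))"
          by (simp add: vscale_laws[OF vs])
      qed
    qed
    also have "\<dots> = sw x (\<lambda>a v. sw v (\<lambda>y b. \<Sum>c\<in>B. vscale H (d c y) (vscale H (?e b) (?S c \<bullet> ?S (?S a)))))"
      by (simp add: tsum_sum)
    also have "\<dots> = sw x (\<lambda>a v. sw v (\<lambda>y b. vscale H (?e b) (?S y \<bullet> ?S (?S a))))"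
      using x by (intro sw_cong expand[where U = H]) (auto intro!: lin_rules)
    also have "\<dots> = sw x (\<lambda>u b. sw u (\<lambda>a y. vscale H (?e b) (?S y \<bullet> ?S (?S a))))"
      using x by (intro coassoc[OF _ vs, symmetric]) (auto intro!: lin_rules simp: carrier)
    also have "\<dots> = sw x (\<lambda>u b. sw u (\<lambda>a y. vscale H (?e b) (?S (?S a \<bullet> y))))"
      using x by (intro sw_cong) (auto simp: antipode_mult)
    also have "\<dots> = sw x (\<lambda>u b. vscale H (?e u) (vscale H (?e b) \<one>\<^bsub>H\<^esub>))"
      using x
      by (intro sw_cong trans[OF antipode_left[where U = H and f = "\<lambda>w. vscale H (?e _) (?S w)"]])
        (auto intro!: lin_rules simp: antipode_one)
    also have "\<dots> = vscale H (?e x) \<one>\<^bsub>H\<^esub>"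
      using x by (intro counit_left[where U = H]) (auto intro!: lin_rules)
    finally show ?thesis .
  qed
  have "0 = (\<Sum>c\<in>B. integral (?f c) (?S c))"
    using zero lf expand_id(2) by simp
  also have "\<dots> = trace (\<lambda>x. \<Sum>c\<in>B. twist (?f c) (?S c) x)"
    unfolding integral_def[OF lf]
    using expand_id(2) by (subst trace_sum) (auto intro!: twist_in[OF lf] simp: integral_def[OF lf])
  also have "\<dots> = trace (\<lambda>x. vscale H (?e x) \<one>\<^bsub>H\<^esub>)"
    using tw by (intro trace_cong) simp
  also have "\<dots> = (\<Sum>b\<in>B. d b \<one>\<^bsub>H\<^esub> * ?e b)"
    unfolding trace_def using lin_mapD(3)[OF lin_d one_in]
    by (intro sum.cong) (auto simp: ground_vs_def mult.commute)
  also have "\<dots> = 1"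
    using expand_ground[OF e one_in] by simp
  finally show False by simp
qed

lemma antipode_kernel:
  assumes h: "h \<in> vcar H" and Sh: "antipode H h = 0"
  shows "h = 0"
proof -
  obtain f g where f: "lin_map H ground_vs f" and g: "g \<in> vcar H" and ne: "integral f g \<noteq> 0"
    using ex_nonzero_integral by blast
  interpret V: vector_space "vscale H" using vs by (simp add: is_vspace_def)
  have "vscale H (integral f g) h = 0"
    by (rule integral_kills_antipode_kernel[OF lin_integral[OF f] integral_invariant[OF f] g h Sh])
  then show ?thesis using ne by simp
qed

end

lemma antipode_inj: "inj_on (antipode H) (vcar H)"
proof (rule inj_onI)
  fix x y assume xy: "x \<in> vcar H" "y \<in> vcar H" and eq: "antipode H x = antipode H y"
  obtain B d where dual: "dual_bases H L (\<lambda>h \<theta>. \<theta> h) B d" using ex_dual_bases by blast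
  interpret V: vector_space "vscale H" using vs by (simp add: is_vspace_def)
  have my: "vscale H (- 1) y \<in> vcar H" by (rule carrier(3)[OF xy(2)])
  have "antipode H (x + vscale H (- 1) y) = antipode H x + vscale H (- 1) (antipode H y)"
    unfolding lin_mapD(2)[OF lin_antipode xy(1) my] lin_mapD(3)[OF lin_antipode xy(2)] ..
  then have "antipode H (x + vscale H (- 1) y) = 0" by (simp only: eq V.scale_minus_left V.scale_one) simp
  then have "x + vscale H (- 1) y = 0"
    by (rule antipode_kernel[OF dual carrier(2)[OF xy(1) my]])
  then show "x = y" by (simp only: V.scale_minus_left V.scale_one) simp
qed

lemma antipode_surj: "antipode H ` vcar H = vcar H"
proof
  show "antipode H ` vcar H \<subseteq> vcar H" by auto
  interpret V: vector_space "vscale H" using vs by (simp add: is_vspace_def)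
  obtain B d where dual: "dual_bases H L (\<lambda>h \<theta>. \<theta> h) B d" using ex_dual_bases by blast
  note ex = expand_id[OF dual]
  have indep: "V.independent B" and span: "V.span B = vcar H" using dual by (auto simp: dual_bases_def)
  let ?S = "antipode H"
  have injB: "inj_on ?S B" by (rule inj_on_subset[OF antipode_inj]) (use ex(2) in auto)
  have sum: "?S (\<Sum>b\<in>B. vscale H (u b) b) = (\<Sum>b\<in>B. vscale H (u b) (?S b))" for u
    using lin_map_sum[OF vs lin_antipode, of B "\<lambda>b. vscale H (u b) b"] lin_mapD(3)[OF lin_antipode] ex(2)
    by (simp add: carrier)
  have indS: "V.independent (?S ` B)"
  proof (rule V.independent_if_scalars_zero)
    fix u x assume z: "(\<Sum>x\<in>?S ` B. vscale H (u x) x) = 0" and x: "x \<in> ?S ` B"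
    then obtain b where b: "b \<in> B" "x = ?S b" by blast
    have z': "?S (\<Sum>b\<in>B. vscale H (u (?S b)) b) = 0"
      using z unfolding sum sum.reindex[OF injB] comp_def .
    have "(\<Sum>b\<in>B. vscale H (u (?S b)) b) \<in> vcar H"
      by (rule sum_in[OF vs]) (rule carrier(3)[OF ex(2)])
    then have "(\<Sum>b\<in>B. vscale H (u (?S b)) b) = 0"
      using z' by (rule antipode_kernel[OF dual])
    from V.independentD[OF indep ex(1) subset_refl this b(1)] show "u x = 0"
      unfolding b(2) .
  qed (use ex(1) in simp)
  show "vcar H \<subseteq> ?S ` vcar H"
  proof
    fix y assume y: "y \<in> vcar H"
    have "y \<in> V.span (?S ` B)"
    proof (rule ccontr)
      assume n: "y \<notin> V.span (?S ` B)"
      then have "V.independent (insert y (?S ` B))" using indS V.independent_insert by auto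
      moreover have "insert y (?S ` B) \<subseteq> V.span B" using y ex(2) span by auto
      ultimately have "card (insert y (?S ` B)) \<le> card B"
        using V.independent_span_bound[OF ex(1)] by blast
      moreover have "y \<notin> ?S ` B" using n V.span_base by blast
      ultimately show False using ex(1) card_image[OF injB] by simp
    qed
    then obtain u where "y = (\<Sum>x\<in>?S ` B. vscale H (u x) x)"
      unfolding V.span_finite[OF finite_imageI[OF ex(1)]] by blast
    then have "y = ?S (\<Sum>b\<in>B. vscale H (u (?S b)) b)" unfolding sum sum.reindex[OF injB] comp_def .
    moreover have "(\<Sum>b\<in>B. vscale H (u (?S b)) b) \<in> vcar H"
      by (rule sum_in[OF vs]) (rule carrier(3)[OF ex(2)])
    ultimately show "y \<in> ?S ` vcar H" by blast
  qed
qed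

lemma antipode_bij: "bij_betw (antipode H) (vcar H) (vcar H)"
  using antipode_inj antipode_surj by (simp add: bij_betw_def)

end

section \<open>Functoriality of tensor products\<close>

lemma tlift_fun_cong:
  assumes "\<And>v w. v \<in> vcar V \<Longrightarrow> w \<in> vcar W \<Longrightarrow> F v w = G v w"
  shows "tlift V W F t = tlift V W G t"
proof -
  have "(\<Sum>(v, w)\<leftarrow>ps. F v w) = (\<Sum>(v, w)\<leftarrow>ps. G v w)" if "set ps \<subseteq> vcar V \<times> vcar W" for ps
    using that assms by (intro arg_cong[of _ _ sum_list] map_cong) auto
  then show ?thesis unfolding tlift_def by (intro arg_cong[of _ _ The] ext) metis
qed

lemma tmap_fun_cong:
  assumes "\<And>v. v \<in> vcar V \<Longrightarrow> f v = f' v" "\<And>w. w \<in> vcar W \<Longrightarrow> g w = g' w"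
  shows "tmap V W V' W' f g t = tmap V W V' W' f' g' t"
  unfolding tmap_def using assms by (intro tlift_fun_cong) simp

lemma tmap_space_cong:
  assumes "vcar V = vcar A" "vscale V = vscale A" "vcar W = vcar B" "vscale W = vscale B"
    "vcar V' = vcar A'" "vscale V' = vscale A'" "vcar W' = vcar B'" "vscale W' = vscale B'"
  shows "tmap V W V' W' f g t = tmap A B A' B' f g t"
  unfolding tmap_def
  by (simp add: tlift_cong[OF assms(1-4)] ten_cong[OF assms(5-8)])

context
  fixes V :: "('k::field, 'a::ab_group_add, 'm) vspace_scheme"
    and W :: "('k, 'b::ab_group_add, 'n) vspace_scheme"
    and V' :: "('k, 'c::ab_group_add, 'p) vspace_scheme"
    and W' :: "('k, 'd::ab_group_add, 'q) vspace_scheme"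
    and f g
  assumes V: "is_vspace V" and W: "is_vspace W" and V': "is_vspace V'" and W': "is_vspace W'"
    and f: "lin_map V V' f" and g: "lin_map W W' g"
begin

lemma tmap_bilin: "bilin_map V W (tensor_vs V' W') (\<lambda>v w. f v \<otimes>\<^bsub>V',W'\<^esub> g w)"
  using lin_mapD(1)[OF f] lin_mapD(1)[OF g]
  by (intro bilin_mapI lin_ten_left lin_ten_right V' W' f g)

lemma lin_tmap: "lin_map (tensor_vs V W) (tensor_vs V' W') (tmap V W V' W' f g)"
  unfolding tmap_def by (rule tlift_lin_map[OF V W is_vspace_tensor_vs tmap_bilin])

lemma tmap_in: "t \<in> vcar (tensor_vs V W) \<Longrightarrow> tmap V W V' W' f g t \<in> vcar (tensor_vs V' W')"
  by (rule lin_mapD(1)[OF lin_tmap])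

lemma tmap_ten: "v \<in> vcar V \<Longrightarrow> w \<in> vcar W \<Longrightarrow> tmap V W V' W' f g (v \<otimes>\<^bsub>V,W\<^esub> w) = f v \<otimes>\<^bsub>V',W'\<^esub> g w"
  unfolding tmap_def by (rule tlift_ten[OF V W is_vspace_tensor_vs tmap_bilin])

end

lemma tmap_inverse:
  assumes "is_vspace V" "is_vspace W" "is_vspace V'" "is_vspace W'"
    "lin_map V V' f" "lin_map W W' g" "lin_map V' V f'" "lin_map W' W g'"
    and "\<And>v. v \<in> vcar V \<Longrightarrow> f' (f v) = v" "\<And>w. w \<in> vcar W \<Longrightarrow> g' (g w) = w"
    and t: "t \<in> vcar (tensor_vs V W)"
  shows "tmap V' W' V W f' g' (tmap V W V' W' f g t) = t"
  by (rule lin_map_tensor_eq[OF assms(1,2) lin_comp[OF lin_tmap[OF assms(3,4,1,2,7,8)] lin_tmap[OF assms(1-6)]] lin_id _ t])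
    (use assms in \<open>simp add: tmap_ten lin_mapD(1)[OF assms(5)] lin_mapD(1)[OF assms(6)]\<close>)

context
  fixes V :: "('k::field, 'a::ab_group_add, 'm) vspace_scheme"
    and W :: "('k, 'b::ab_group_add, 'n) vspace_scheme"
  assumes V: "is_vspace V" and W: "is_vspace W"
begin

lemma tflip_bilin: "bilin_map V W (tensor_vs W V) (\<lambda>v w. w \<otimes>\<^bsub>W,V\<^esub> v)"
  by (intro bilin_mapI lin_ten_left lin_ten_right V W lin_id)

lemma lin_tflip: "lin_map (tensor_vs V W) (tensor_vs W V) (tflip V W)"
  unfolding tflip_def by (rule tlift_lin_map[OF V W is_vspace_tensor_vs tflip_bilin])

lemma tflip_ten: "v \<in> vcar V \<Longrightarrow> w \<in> vcar W \<Longrightarrow> tflip V W (v \<otimes>\<^bsub>V,W\<^esub> w) = w \<otimes>\<^bsub>W,V\<^esub> v"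
  unfolding tflip_def by (rule tlift_ten[OF V W is_vspace_tensor_vs tflip_bilin])

lemma tflip_in: "t \<in> vcar (tensor_vs V W) \<Longrightarrow> tflip V W t \<in> vcar (tensor_vs W V)"
  by (rule lin_mapD(1)[OF lin_tflip])

end

lemma tflip_tflip:
  assumes "is_vspace V" "is_vspace W" "t \<in> vcar (tensor_vs V W)"
  shows "tflip W V (tflip V W t) = t"
  by (rule lin_map_tensor_eq[OF assms(1,2) lin_comp[OF lin_tflip[OF assms(2,1)] lin_tflip[OF assms(1,2)]] lin_id _ assms(3)])
    (simp add: tflip_ten assms)

context
  fixes U :: "('k::field, 'a::ab_group_add, 'm) vspace_scheme"
    and V :: "('k, 'b::ab_group_add, 'n) vspace_scheme"
    and W :: "('k, 'c::ab_group_add, 'p) vspace_scheme"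
  assumes U: "is_vspace U" and V: "is_vspace V" and W: "is_vspace W"
begin

private lemma bilin_inner: "w \<in> vcar W \<Longrightarrow>
    bilin_map U V (tensor_vs U (tensor_vs V W)) (\<lambda>u v. u \<otimes>\<^bsub>U,tensor_vs V W\<^esub> (v \<otimes>\<^bsub>V,W\<^esub> w))"
  "u \<in> vcar U \<Longrightarrow>
    bilin_map V W (tensor_vs (tensor_vs U V) W) (\<lambda>v w. (u \<otimes>\<^bsub>U,V\<^esub> v) \<otimes>\<^bsub>tensor_vs U V,W\<^esub> w)"
  by (intro bilin_mapI lin_ten_left lin_ten_right U V W is_vspace_tensor_vs lin_id ten_in | assumption)+

private lemma bilin_outer: "bilin_map (tensor_vs U V) W (tensor_vs U (tensor_vs V W))
    (\<lambda>t w. tlift U V (\<lambda>u v. u \<otimes>\<^bsub>U,tensor_vs V W\<^esub> (v \<otimes>\<^bsub>V,W\<^esub> w)) t)"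
proof (rule bilin_mapI)
  fix t assume t: "t \<in> vcar (tensor_vs U V)"
  show "lin_map W (tensor_vs U (tensor_vs V W)) (\<lambda>w. tlift U V (\<lambda>u v. u \<otimes>\<^bsub>U,tensor_vs V W\<^esub> (v \<otimes>\<^bsub>V,W\<^esub> w)) t)"
    by (subst lin_map_cong[OF W tlift_tsum[OF U V t is_vspace_tensor_vs bilin_inner(1)]], assumption)
      (intro lin_tsum_param[OF is_vspace_tensor_vs U V t] lin_ten_right U V W is_vspace_tensor_vs lin_id)
qed (rule tlift_lin_map[OF U V is_vspace_tensor_vs bilin_inner(1)])

private lemma bilin_outer_inv: "bilin_map U (tensor_vs V W) (tensor_vs (tensor_vs U V) W)
    (\<lambda>u t. tlift V W (\<lambda>v w. (u \<otimes>\<^bsub>U,V\<^esub> v) \<otimes>\<^bsub>tensor_vs U V,W\<^esub> w) t)"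
proof (rule bilin_mapI)
  fix t assume t: "t \<in> vcar (tensor_vs V W)"
  show "lin_map U (tensor_vs (tensor_vs U V) W) (\<lambda>u. tlift V W (\<lambda>v w. (u \<otimes>\<^bsub>U,V\<^esub> v) \<otimes>\<^bsub>tensor_vs U V,W\<^esub> w) t)"
    by (subst lin_map_cong[OF U tlift_tsum[OF V W t is_vspace_tensor_vs bilin_inner(2)]], assumption)
      (intro lin_tsum_param[OF is_vspace_tensor_vs V W t] lin_ten_left U V W is_vspace_tensor_vs lin_id)
qed (rule tlift_lin_map[OF V W is_vspace_tensor_vs bilin_inner(2)])

lemma lin_tassoc: "lin_map (tensor_vs (tensor_vs U V) W) (tensor_vs U (tensor_vs V W)) (tassoc U V W)"
  unfolding tassoc_def by (rule tlift_lin_map[OF is_vspace_tensor_vs W is_vspace_tensor_vs bilin_outer])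

lemma lin_tassoc_inv:
  "lin_map (tensor_vs U (tensor_vs V W)) (tensor_vs (tensor_vs U V) W) (tassoc_inv U V W)"
  unfolding tassoc_inv_def by (rule tlift_lin_map[OF U is_vspace_tensor_vs is_vspace_tensor_vs bilin_outer_inv])

lemma tassoc_ten:
  assumes "u \<in> vcar U" "v \<in> vcar V" "w \<in> vcar W"
  shows "tassoc U V W ((u \<otimes>\<^bsub>U,V\<^esub> v) \<otimes>\<^bsub>tensor_vs U V,W\<^esub> w) = u \<otimes>\<^bsub>U,tensor_vs V W\<^esub> (v \<otimes>\<^bsub>V,W\<^esub> w)"
  unfolding tassoc_def
    tlift_ten[OF is_vspace_tensor_vs W is_vspace_tensor_vs bilin_outer ten_in[OF U V assms(1,2)] assms(3)]
    tlift_ten[OF U V is_vspace_tensor_vs bilin_inner(1)[OF assms(3)] assms(1,2)] ..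

lemma tassoc_inv_ten:
  assumes "u \<in> vcar U" "v \<in> vcar V" "w \<in> vcar W"
  shows "tassoc_inv U V W (u \<otimes>\<^bsub>U,tensor_vs V W\<^esub> (v \<otimes>\<^bsub>V,W\<^esub> w)) = (u \<otimes>\<^bsub>U,V\<^esub> v) \<otimes>\<^bsub>tensor_vs U V,W\<^esub> w"
  unfolding tassoc_inv_def
    tlift_ten[OF U is_vspace_tensor_vs is_vspace_tensor_vs bilin_outer_inv assms(1) ten_in[OF V W assms(2,3)]]
    tlift_ten[OF V W is_vspace_tensor_vs bilin_inner(2)[OF assms(1)] assms(2,3)] ..

lemma tassoc_inv_tassoc:
  assumes t: "t \<in> vcar (tensor_vs (tensor_vs U V) W)"
  shows "tassoc_inv U V W (tassoc U V W t) = t"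
proof (rule lin_map_tensor_eq[OF is_vspace_tensor_vs W lin_comp[OF lin_tassoc_inv lin_tassoc] lin_id _ t])
  fix s w assume s: "s \<in> vcar (tensor_vs U V)" and w: "w \<in> vcar W"
  have l: "lin_map (tensor_vs U V) (tensor_vs (tensor_vs U V) W) (\<lambda>s. s \<otimes>\<^bsub>tensor_vs U V,W\<^esub> w)"
    using w by (intro lin_ten_left is_vspace_tensor_vs W lin_id)
  show "tassoc_inv U V W (tassoc U V W (s \<otimes>\<^bsub>tensor_vs U V,W\<^esub> w)) = s \<otimes>\<^bsub>tensor_vs U V,W\<^esub> w"
    by (rule lin_map_tensor_eq[OF U V lin_comp[OF lin_comp[OF lin_tassoc_inv lin_tassoc] l] l _ s])
      (simp add: tassoc_ten tassoc_inv_ten w)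
qed

lemma tassoc_tassoc_inv:
  assumes t: "t \<in> vcar (tensor_vs U (tensor_vs V W))"
  shows "tassoc U V W (tassoc_inv U V W t) = t"
proof (rule lin_map_tensor_eq[OF U is_vspace_tensor_vs lin_comp[OF lin_tassoc lin_tassoc_inv] lin_id _ t])
  fix u s assume s: "s \<in> vcar (tensor_vs V W)" and u: "u \<in> vcar U"
  have l: "lin_map (tensor_vs V W) (tensor_vs U (tensor_vs V W)) (\<lambda>s. u \<otimes>\<^bsub>U,tensor_vs V W\<^esub> s)"
    using u by (intro lin_ten_right is_vspace_tensor_vs U lin_id)
  show "tassoc U V W (tassoc_inv U V W (u \<otimes>\<^bsub>U,tensor_vs V W\<^esub> s)) = u \<otimes>\<^bsub>U,tensor_vs V W\<^esub> s"
    by (rule lin_map_tensor_eq[OF V W lin_comp[OF lin_comp[OF lin_tassoc lin_tassoc_inv] l] l _ s])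
      (simp add: tassoc_ten tassoc_inv_ten u)
qed

end

section \<open>Opposite coactions\<close>

text \<open>Only multiplicativity involves the products, and reversing those of \<open>K\<close> and of \<open>Y\<close> reverses that of the tensor
  product.  The algebra \<open>K'\<close> is described by its operations, because a Hopf algebra and its double opposite
  need not have equal antipodes outside of the carrier.\<close>

lemma left_coaction_op:
  fixes K :: "('k::field, 'a::ab_group_add, 'm) hopf_scheme"
    and K' :: "('k, 'a, 'm') hopf_scheme"
    and Y :: "('k, 'y::ab_group_add, 'n) alg_scheme"
  assumes K: "algebra K" and Y: "algebra Y" and co: "left_coaction K Y \<alpha>"
    and K': "vcar K' = vcar K" "vscale K' = vscale K" "\<one>\<^bsub>K'\<^esub> = \<one>\<^bsub>K\<^esub>" "comult K' = comult K"
      "counit K' = counit K" "\<And>x y. x \<cdot>\<^bsub>K'\<^esub> y = y \<cdot>\<^bsub>K\<^esub> x"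
    and eq: "\<And>y. y \<in> vcar Y \<Longrightarrow> \<alpha>' y = \<alpha> y"
  shows "left_coaction K' (alg_op Y) \<alpha>'"
proof -
  let ?T = "tensor_alg K Y" and ?T' = "tensor_alg K' (alg_op Y)" and ?Y = "alg_op Y"
  note vs = algebraD(1)[OF K] algebraD(1)[OF Y]
  have K'alg: "algebra K'"
    using K unfolding algebra_def bilin_map_def lin_map_def is_vspace_def by (simp add: K')
  have Yalg: "algebra ?Y" by (rule algebra_alg_op[OF Y])
  have ten: "v \<otimes>\<^bsub>K',?Y\<^esub> w = v \<otimes>\<^bsub>K,Y\<^esub> w" for v w by (rule ten_cong) (simp_all add: K')
  have tvs: "tensor_vs K' ?Y = tensor_vs K Y" by (rule tensor_vs_cong) (simp_all add: K')
  have tvs2: "tensor_vs K' K' = tensor_vs K K" by (rule tensor_vs_cong) (simp_all add: K')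
  have ts: "tsum K' ?Y = tsum K Y" by (rule tsum_space_cong) (simp_all add: K')
  have tl: "tlift K' ?Y = tlift K Y" by (rule tlift_cong) (simp_all add: K')
  have hom: "alg_hom Y ?T \<alpha>" using co by (simp add: left_coaction_def)
  have in_: "\<alpha> y \<in> vcar (tensor_vs K Y)" if "y \<in> vcar Y" for y
    using hom that by (auto simp: alg_hom_def lin_map_def)
  have mult: "s \<cdot>\<^bsub>?T'\<^esub> t = t \<cdot>\<^bsub>?T\<^esub> s" if "s \<in> vcar (tensor_vs K Y)" "t \<in> vcar (tensor_vs K Y)" for s t
    using that
    by (subst tensor_mult[OF bilin_algebra[OF K'alg] bilin_algebra[OF Yalg]])
      (simp_all add: tvs ts ten K' tensor_mult[OF bilin_algebra[OF K] bilin_algebra[OF Y]] tsum_swap[of K Y s])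
  have "lin_map Y (tensor_vs K Y) \<alpha>'"
    using hom by (subst lin_map_cong[OF vs(2) eq]) (auto simp: alg_hom_def lin_map_tensor_alg)
  then have "lin_map ?Y ?T' \<alpha>'"
    unfolding lin_map_tensor_alg tvs by (simp add: lin_map_def)
  then have "alg_hom ?Y ?T' \<alpha>'"
    using hom algebraD(3,7)[OF Y] by (simp add: alg_hom_def eq mult in_ ten K')
  moreover have "tmap K' ?Y K' (tensor_vs K' ?Y) id \<alpha>' (\<alpha>' y)
      = tassoc K' K' ?Y (tmap K' ?Y (tensor_vs K' K') ?Y (comult K') id (\<alpha>' y))" if y: "y \<in> vcar Y" for y
  proof -
    have "tmap K' ?Y K' (tensor_vs K' ?Y) id \<alpha>' (\<alpha>' y) = tmap K Y K (tensor_vs K Y) id \<alpha>' (\<alpha>' y)"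
      by (rule tmap_space_cong) (simp_all add: K' tvs)
    also have "\<dots> = tmap K Y K (tensor_vs K Y) id \<alpha> (\<alpha> y)"
      unfolding eq[OF y] by (rule tmap_fun_cong) (simp_all add: eq)
    also have "\<dots> = tassoc K K Y (tmap K Y (tensor_vs K K) Y (comult K) id (\<alpha> y))"
      using co y by (simp add: left_coaction_def)
    also have "tmap K Y (tensor_vs K K) Y (comult K) id (\<alpha> y)
        = tmap K' ?Y (tensor_vs K' K') ?Y (comult K') id (\<alpha>' y)"
      unfolding eq[OF y] K'(4) by (rule tmap_space_cong) (simp_all add: K' tvs2)
    also have "tassoc K K Y = tassoc K' K' ?Y"
    proof -
      have 1: "tlift (tensor_vs K' K') ?Y = tlift (tensor_vs K K) Y" "tlift K' K' = tlift K K"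
        by (rule tlift_cong; simp add: K' tvs2)+
      have 2: "u \<otimes>\<^bsub>K',tensor_vs K' ?Y\<^esub> t = u \<otimes>\<^bsub>K,tensor_vs K Y\<^esub> t" for u t
        by (rule ten_cong) (simp_all add: K' tvs)
      show ?thesis unfolding tassoc_def fun_eq_iff 1 2 ten by simp
    qed
    finally show ?thesis .
  qed
  moreover have "tlift K' ?Y (\<lambda>k x. vscale ?Y (counit K' k) x) (\<alpha>' y) = y" if "y \<in> vcar Y" for y
    using co that by (simp add: left_coaction_def eq tl K')
  ultimately show ?thesis unfolding left_coaction_def by simp
qed

section \<open>The Yetter--Drinfeld condition and the flip\<close>

lemma alg_Ad_eq:
  assumes "algebra A" "is_inverse A w w'"
  shows "alg_Ad A w z = (w \<cdot>\<^bsub>A\<^esub> z) \<cdot>\<^bsub>A\<^esub> w'"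
proof -
  have "(THE w'. is_inverse A w w') = w'"
  proof (rule the_equality)
    fix u assume "is_inverse A w u"
    then show "u = w'"
      using assms left_inverse_eq_right_inverse[OF assms(1), of u w w'] by (simp add: is_inverse_def)
  qed (rule assms(2))
  then show ?thesis by (simp add: alg_Ad_def)
qed

lemma tensor_op_space:
  "v \<otimes>\<^bsub>hopf_op K,L\<^esub> w = v \<otimes>\<^bsub>K,L\<^esub> w" "tensor_vs (hopf_op K) L = tensor_vs K L"
  "tsum (hopf_op K) L = tsum K L"
  by (rule ten_cong tensor_vs_cong tsum_space_cong; simp)+

lemma algebra_op_tensor: "algebra K \<Longrightarrow> algebra L \<Longrightarrow> algebra (tensor_alg (hopf_op K) L)"
  by (intro algebra_tensor_alg algebra_hopf_op)

text \<open>On pure tensors, \<open>k' k \<otimes> \<theta> \<theta>'\<close> is flipped to \<open>\<theta> \<theta>' \<otimes> k' k\<close>, the product in reversed order.\<close>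

lemma tflip_antihom:
  fixes K :: "('k::field, 'a::ab_group_add, 'm) hopf_scheme"
    and L :: "('k, 'b::ab_group_add, 'n) hopf_scheme"
  assumes K: "algebra K" and L: "algebra L"
    and s: "s \<in> vcar (tensor_vs K L)" and t: "t \<in> vcar (tensor_vs K L)"
  shows "tflip K L (s \<cdot>\<^bsub>tensor_alg (hopf_op K) L\<^esub> t) = tflip K L t \<cdot>\<^bsub>tensor_alg (hopf_op L) K\<^esub> tflip K L s"
proof -
  let ?A = "tensor_alg (hopf_op K) L" and ?A' = "tensor_alg (hopf_op L) K"
  note vs = algebraD(1)[OF K] algebraD(1)[OF L]
  note sp = tensor_op_space
  note bK = bilin_algebra[OF algebra_hopf_op[OF K]] bilin_algebra[OF L]
    and bL = bilin_algebra[OF algebra_hopf_op[OF L]] bilin_algebra[OF K]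
  note l = bilin_mapD(1,2)[OF tensor_mult_bilin_map[OF bK], unfolded sp]
    and l' = bilin_mapD(1,2)[OF tensor_mult_bilin_map[OF bL], unfolded sp]
  note pure = tensor_mult_ten[OF bK, unfolded sp, simplified] tensor_mult_ten[OF bL, unfolded sp, simplified]
  note fl = lin_tflip[OF vs]
  note inn = ten_in[OF vs] ten_in[OF vs(2,1)] algebraD(7)[OF K] algebraD(7)[OF L] tflip_in[OF vs]
  show ?thesis
  proof (rule lin_map_tensor_eq[OF vs lin_comp[OF fl l(2)[OF t]] lin_comp[OF l'(1)[OF tflip_in[OF vs t]] fl] _ s])
    fix a b assume ab: "a \<in> vcar K" "b \<in> vcar L"
    show "tflip K L ((a \<otimes>\<^bsub>K,L\<^esub> b) \<cdot>\<^bsub>?A\<^esub> t) = tflip K L t \<cdot>\<^bsub>?A'\<^esub> tflip K L (a \<otimes>\<^bsub>K,L\<^esub> b)"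
      by (rule lin_map_tensor_eq[OF vs lin_comp[OF fl l(1)[OF ten_in[OF vs ab]]]
            lin_comp[OF l'(2)[OF tflip_in[OF vs ten_in[OF vs ab]]] fl] _ t])
        (simp add: pure ab tflip_ten[OF vs] inn)
  qed
qed

lemma is_inverse_tflip:
  assumes K: "algebra K" and L: "algebra L"
    and inv: "is_inverse (tensor_alg (hopf_op K) L) U V"
  shows "is_inverse (tensor_alg (hopf_op L) K) (tflip K L U) (tflip K L V)"
proof -
  note vs = algebraD(1)[OF K] algebraD(1)[OF L]
  note sp = tensor_op_space
  have UV: "U \<in> vcar (tensor_vs K L)" "V \<in> vcar (tensor_vs K L)"
    using inv by (auto simp: is_inverse_def sp)
  then show ?thesis
    using inv algebraD(3)[OF K] algebraD(3)[OF L]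
    by (simp add: is_inverse_def sp tflip_in[OF vs] tflip_ten[OF vs] flip: tflip_antihom[OF K L])
qed

text \<open>The data \<open>(K, L, U)\<close> and \<open>(L, K, flip U)\<close> determine each other in the same way, so this implication yields
  its own converse.\<close>

lemma yd_equation_flip:
  fixes K :: "('k::field, 'a::ab_group_add, 'm) hopf_scheme"
    and L :: "('k, 'b::ab_group_add, 'n) hopf_scheme"
    and Y :: "('k, 'y::ab_group_add, 'p) alg_scheme"
  assumes K: "algebra K" and L: "algebra L" and Y: "is_vspace Y"
    and inv: "is_inverse (tensor_alg (hopf_op K) L) U V"
    and Q: "Q \<in> vcar (tensor_vs K (tensor_vs L Y))"
    and P: "P = tassoc L K Y (tmap (tensor_vs K L) Y (tensor_vs L K) Y (tflip K L) id
        (tmap (tensor_vs K L) Y (tensor_vs K L) Y (alg_Ad (tensor_alg (hopf_op K) L) U) id (tassoc_inv K L Y Q)))"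
  shows "Q = tassoc K L Y (tmap (tensor_vs L K) Y (tensor_vs K L) Y (tflip L K) id
        (tmap (tensor_vs L K) Y (tensor_vs L K) Y (alg_Ad (tensor_alg (hopf_op L) K) (tflip K L U)) id (tassoc_inv L K Y P)))"
proof -
  let ?A = "tensor_alg (hopf_op K) L" and ?A' = "tensor_alg (hopf_op L) K"
  let ?T = "tensor_vs K L" and ?T' = "tensor_vs L K"
  note vs = algebraD(1)[OF K] algebraD(1)[OF L]
  note sp = tensor_op_space
  note A = algebra_op_tensor[OF K L] and A' = algebra_op_tensor[OF L K]
  note inv' = is_inverse_tflip[OF K L inv]
  have UV: "U \<in> vcar ?T" "V \<in> vcar ?T" using inv by (auto simp: is_inverse_def sp)
  have lin_Ad: "lin_map ?T ?T (alg_Ad ?A U)"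
  proof -
    have "lin_map ?A ?A (alg_Ad ?A U)"
      unfolding alg_Ad_eq[OF A inv, abs_def] using UV
      by (intro lin_mult_left lin_mult_right bilin_algebra A lin_id) (auto simp: sp)
    then show ?thesis by (rule lin_map_space_cong[THEN iffD1, rotated 4]) (simp_all add: sp)
  qed
  have lin_Ad': "lin_map ?T' ?T' (alg_Ad ?A' (tflip K L U))"
  proof -
    have "lin_map ?A' ?A' (alg_Ad ?A' (tflip K L U))"
      unfolding alg_Ad_eq[OF A' inv', abs_def] using UV
      by (intro lin_mult_left lin_mult_right bilin_algebra A' lin_id) (auto simp: sp tflip_in[OF vs])
    then show ?thesis by (rule lin_map_space_cong[THEN iffD1, rotated 4]) (simp_all add: sp)
  qed
  \<comment> \<open>In the opposite algebra, conjugation by the flipped element is conjugation by the inverse.\<close>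
  have undo: "tflip L K (alg_Ad ?A' (tflip K L U) (tflip K L (alg_Ad ?A U z))) = z" if z: "z \<in> vcar ?T" for z
  proof -
    let ?w = "(U \<cdot>\<^bsub>?A\<^esub> z) \<cdot>\<^bsub>?A\<^esub> V"
    have in_: "U \<in> vcar ?A" "V \<in> vcar ?A" "z \<in> vcar ?A" using UV z by (simp_all add: sp)
    note AD = algebraD(3-7)[OF A]
    have "tflip L K (alg_Ad ?A' (tflip K L U) (tflip K L ?w)) = V \<cdot>\<^bsub>?A\<^esub> (?w \<cdot>\<^bsub>?A\<^esub> U)"
    proof -
      have w: "?w \<in> vcar ?T" "?w \<cdot>\<^bsub>?A\<^esub> U \<in> vcar ?T" "V \<cdot>\<^bsub>?A\<^esub> (?w \<cdot>\<^bsub>?A\<^esub> U) \<in> vcar ?T"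
        using AD(5) in_ by (auto simp: sp)
      show ?thesis
        unfolding alg_Ad_eq[OF A' inv']
        by (simp add: w UV tflip_tflip[OF vs] flip: tflip_antihom[OF K L])
    qed
    also have "\<dots> = (V \<cdot>\<^bsub>?A\<^esub> U) \<cdot>\<^bsub>?A\<^esub> (z \<cdot>\<^bsub>?A\<^esub> (V \<cdot>\<^bsub>?A\<^esub> U))"
      using in_ AD(2,5) by metis
    also have "\<dots> = z" using inv in_ AD(3,4) by (simp add: is_inverse_def)
    finally show ?thesis by (simp add: alg_Ad_eq[OF A inv])
  qed
  let ?R = "tassoc_inv K L Y Q"
  have R: "?R \<in> vcar (tensor_vs ?T Y)" by (rule lin_mapD(1)[OF lin_tassoc_inv[OF vs Y] Q])
  note lid = lin_id[of Y, folded id_def]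
  note m1 = tmap_in[OF is_vspace_tensor_vs Y is_vspace_tensor_vs Y lin_Ad lid R]
  note m2 = tmap_in[OF is_vspace_tensor_vs Y is_vspace_tensor_vs Y lin_tflip[OF vs] lid m1]
  note lAd = lin_tmap[OF is_vspace_tensor_vs Y is_vspace_tensor_vs Y lin_Ad lid]
  note lAd' = lin_tmap[OF is_vspace_tensor_vs Y is_vspace_tensor_vs Y lin_Ad' lid]
  note lf = lin_tmap[OF is_vspace_tensor_vs Y is_vspace_tensor_vs Y lin_tflip[OF vs] lid]
  note lf' = lin_tmap[OF is_vspace_tensor_vs Y is_vspace_tensor_vs Y lin_tflip[OF vs(2,1)] lid]
  note tm = tmap_ten[OF is_vspace_tensor_vs Y is_vspace_tensor_vs Y lin_Ad lid]
    tmap_ten[OF is_vspace_tensor_vs Y is_vspace_tensor_vs Y lin_Ad' lid]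
    tmap_ten[OF is_vspace_tensor_vs Y is_vspace_tensor_vs Y lin_tflip[OF vs] lid]
    tmap_ten[OF is_vspace_tensor_vs Y is_vspace_tensor_vs Y lin_tflip[OF vs(2,1)] lid]
  have "tmap ?T' Y ?T Y (tflip L K) id (tmap ?T' Y ?T' Y (alg_Ad ?A' (tflip K L U)) id
      (tmap ?T Y ?T' Y (tflip K L) id (tmap ?T Y ?T Y (alg_Ad ?A U) id ?R))) = ?R"
    by (rule lin_map_tensor_eq[OF is_vspace_tensor_vs Y
          lin_comp[OF lf' lin_comp[OF lAd' lin_comp[OF lf lAd]]] lin_id _ R])
      (simp add: tm lin_mapD(1)[OF lin_Ad] lin_mapD(1)[OF lin_Ad'] tflip_in[OF vs] undo)
  then show ?thesis
    unfolding P tassoc_inv_tassoc[OF vs(2,1) Y m2] by (simp add: tassoc_tassoc_inv[OF vs Y Q])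
qed

section \<open>The braided commutation relation\<close>

lemmas lin_pscale_left = lin_scale_left[OF is_vspace_tensor_vs, unfolded vscale_tensor_vs]
  and lin_pscale_right = lin_scale_right[OF is_vspace_tensor_vs, unfolded vscale_tensor_vs]

lemma lin_tsum_arg:
  assumes "is_vspace V" "is_vspace W" "is_vspace U" "lin_map Z (tensor_vs V W) g" "bilin_map V W U F"
  shows "lin_map Z U (\<lambda>x. tsum V W (g x) F)"
  by (rule lin_comp[OF lin_tsum[OF assms(1-3,5)] assms(4)])

lemma pscale_in: "t \<in> vcar (tensor_vs V W) \<Longrightarrow> pscale c t \<in> vcar (tensor_vs V W)"
  using is_vspace_carrier(3)[OF is_vspace_tensor_vs, of t V W c] by simp

text \<open>The facts on a Hopf algebra \<open>K\<close>, its dual \<open>L\<close> and their pairing that the commutation relation rests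
  on.  They hold for a finite-dimensional Hopf algebra and its dual in either order.\<close>

locale pairing =
  fixes K :: "('k::field, 'a::ab_group_add, 'm) hopf_scheme"
    and L :: "('k, 'b::ab_group_add, 'n) hopf_scheme"
    and p :: "'a \<Rightarrow> 'b \<Rightarrow> 'k"
  assumes algK: "algebra K" and algL: "algebra L"
    and comultK: "lin_map K (tensor_vs K K) (comult K)" "comult K \<one>\<^bsub>K\<^esub> = \<one>\<^bsub>K\<^esub> \<otimes>\<^bsub>K,K\<^esub> \<one>\<^bsub>K\<^esub>"
    and comultL: "lin_map L (tensor_vs L L) (comult L)" "comult L \<one>\<^bsub>L\<^esub> = \<one>\<^bsub>L\<^esub> \<otimes>\<^bsub>L,L\<^esub> \<one>\<^bsub>L\<^esub>"
    and p: "bilin_map K L ground_vs p" "p \<one>\<^bsub>K\<^esub> \<one>\<^bsub>L\<^esub> = 1"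
    and lin_S: "lin_map L L (antipode L)"
    and bij_S: "bij_betw (antipode L) (vcar L) (vcar L)"
    and comult_S: "\<And>\<theta>. \<theta> \<in> vcar L \<Longrightarrow>
      comult L (antipode L \<theta>) = tsum L L (comult L \<theta>) (\<lambda>a b. antipode L b \<otimes>\<^bsub>L,L\<^esub> antipode L a)"
begin

abbreviation ten_KL :: "'a \<Rightarrow> 'b \<Rightarrow> ('k, 'a, 'b) tensor" (infixr \<open>\<otimes>\<close> 70) where
  "k \<otimes> \<theta> \<equiv> k \<otimes>\<^bsub>K,L\<^esub> \<theta>"

lemmas KL_vs = algebraD(1)[OF algK] algebraD(1)[OF algL]
lemmas KL_in = algebraD(3,7)[OF algK] algebraD(3,7)[OF algL] lin_mapD(1)[OF comultK(1)] lin_mapD(1)[OF comultL(1)]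
  lin_mapD(1)[OF lin_S] ten_in[OF KL_vs] pscale_in
lemmas lin_KL = bilin_mapI lin_id lin_mult_left[OF bilin_algebra[OF algK]] lin_mult_right[OF bilin_algebra[OF algK]]
  lin_mult_left[OF bilin_algebra[OF algL]] lin_mult_right[OF bilin_algebra[OF algL]]
  lin_ten_left lin_ten_right lin_pscale_left lin_pscale_right
  lin_tsum_param lin_tsum_arg lin_comp[OF comultK(1)] lin_comp[OF comultL(1)] lin_comp[OF lin_S]
  lin_comp[OF bilin_mapD(1)[OF p(1)]] lin_comp[OF bilin_mapD(2)[OF p(1)]] is_vspace_tensor_vs KL_vs

text \<open>The product of \<open>k # \<theta>\<close> and \<open>k' # \<theta>'\<close> in the Heisenberg algebra.\<close>

definition smash :: "'a \<Rightarrow> 'b \<Rightarrow> 'a \<Rightarrow> 'b \<Rightarrow> ('k, 'a, 'b) tensor" where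
  "smash k \<theta> k' \<theta>' = tsum K K (comult K k') (\<lambda>k1 k2. tsum L L (comult L \<theta>) (\<lambda>\<theta>1 \<theta>2.
     pscale (p k2 \<theta>1) ((k \<cdot>\<^bsub>K\<^esub> k1) \<otimes> (\<theta>2 \<cdot>\<^bsub>L\<^esub> \<theta>'))))"

lemma lin_smash:
  assumes "k \<in> vcar K" "\<theta> \<in> vcar L" "k' \<in> vcar K" "\<theta>' \<in> vcar L"
  shows "lin_map K (tensor_vs K L) (\<lambda>x. smash x \<theta> k' \<theta>')" "lin_map L (tensor_vs K L) (\<lambda>x. smash k x k' \<theta>')"
    "lin_map K (tensor_vs K L) (\<lambda>x. smash k \<theta> x \<theta>')" "lin_map L (tensor_vs K L) (\<lambda>x. smash k \<theta> k' x)"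
  unfolding smash_def using assms by (auto intro!: lin_KL simp: KL_in)

lemma heisenberg_simps [simp]:
  "vcar (heisenberg_alg K L p) = vcar (tensor_vs K L)" "vscale (heisenberg_alg K L p) = pscale"
  by (simp_all add: heisenberg_alg_def)

lemma bilin_smash:
  assumes "k \<in> vcar K" "\<theta> \<in> vcar L"
  shows "bilin_map K L (tensor_vs K L) (smash k \<theta>)"
  using assms by (intro bilin_mapI lin_smash)

lemma bilin_smash2:
  assumes "t \<in> vcar (tensor_vs K L)"
  shows "bilin_map K L (tensor_vs K L) (\<lambda>k \<theta>. tsum K L t (smash k \<theta>))"
  using assms by (intro bilin_mapI lin_tsum_param KL_vs is_vspace_tensor_vs lin_smash)

lemma heisenberg_mult:
  assumes s: "s \<in> vcar (tensor_vs K L)" and t: "t \<in> vcar (tensor_vs K L)"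
  shows "s \<cdot>\<^bsub>heisenberg_alg K L p\<^esub> t = tsum K L s (\<lambda>k \<theta>. tsum K L t (\<lambda>k' \<theta>'. smash k \<theta> k' \<theta>'))"
proof -
  have 1: "tlift K K (\<lambda>k1 k2. tlift L L (\<lambda>\<theta>1 \<theta>2.
        pscale (p k2 \<theta>1) ((k \<cdot>\<^bsub>K\<^esub> k1) \<otimes> (\<theta>2 \<cdot>\<^bsub>L\<^esub> \<theta>'))) (comult L \<theta>)) (comult K k') = smash k \<theta> k' \<theta>'"
    if "k \<in> vcar K" "\<theta> \<in> vcar L" "k' \<in> vcar K" "\<theta>' \<in> vcar L" for k \<theta> k' \<theta>'
  proof -
    have "tlift L L (\<lambda>\<theta>1 \<theta>2. pscale (p k2 \<theta>1) ((k \<cdot>\<^bsub>K\<^esub> k1) \<otimes> (\<theta>2 \<cdot>\<^bsub>L\<^esub> \<theta>'))) (comult L \<theta>)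
      = tsum L L (comult L \<theta>) (\<lambda>\<theta>1 \<theta>2. pscale (p k2 \<theta>1) ((k \<cdot>\<^bsub>K\<^esub> k1) \<otimes> (\<theta>2 \<cdot>\<^bsub>L\<^esub> \<theta>')))"
      if "k1 \<in> vcar K" "k2 \<in> vcar K" for k1 k2
      using that \<open>k \<in> vcar K\<close> \<open>\<theta> \<in> vcar L\<close> \<open>\<theta>' \<in> vcar L\<close>
      by (intro tlift_tsum[where U = "tensor_vs K L"]) (auto intro!: lin_KL simp: KL_in)
    then have "tlift K K (\<lambda>k1 k2. tlift L L (\<lambda>\<theta>1 \<theta>2.
        pscale (p k2 \<theta>1) ((k \<cdot>\<^bsub>K\<^esub> k1) \<otimes> (\<theta>2 \<cdot>\<^bsub>L\<^esub> \<theta>'))) (comult L \<theta>)) (comult K k')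
      = tlift K K (\<lambda>k1 k2. tsum L L (comult L \<theta>) (\<lambda>\<theta>1 \<theta>2. 
        pscale (p k2 \<theta>1) ((k \<cdot>\<^bsub>K\<^esub> k1) \<otimes> (\<theta>2 \<cdot>\<^bsub>L\<^esub> \<theta>')))) (comult K k')"
      by (rule tlift_fun_cong)
    also have "\<dots> = smash k \<theta> k' \<theta>'"
      unfolding smash_def using that
      by (intro tlift_tsum[where U = "tensor_vs K L"]) (auto intro!: lin_KL simp: KL_in)
    finally show ?thesis .
  qed
  have "s \<cdot>\<^bsub>heisenberg_alg K L p\<^esub> t = tlift K L (\<lambda>k \<theta>. tlift K L (\<lambda>k' \<theta>'. smash k \<theta> k' \<theta>') t) s"
    unfolding heisenberg_alg_def by (simp, intro tlift_fun_cong 1)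
  also have "\<dots> = tlift K L (\<lambda>k \<theta>. tsum K L t (\<lambda>k' \<theta>'. smash k \<theta> k' \<theta>')) s"
    by (intro tlift_fun_cong tlift_tsum[OF KL_vs t is_vspace_tensor_vs[of K L]] bilin_smash)
  also have "\<dots> = tsum K L s (\<lambda>k \<theta>. tsum K L t (\<lambda>k' \<theta>'. smash k \<theta> k' \<theta>'))"
    by (intro tlift_tsum[OF KL_vs s is_vspace_tensor_vs[of K L]] bilin_smash2[OF t])
  finally show ?thesis .
qed

lemma bilin_algebra_heisenberg: "bilin_algebra (heisenberg_alg K L p)"
proof -
  let ?E = "heisenberg_alg K L p" and ?T = "tensor_vs K L"
  have "bilin_map ?T ?T ?T (amult ?E)"
  proof (rule bilin_mapI)
    fix t assume t: "t \<in> vcar ?T"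
    show "lin_map ?T ?T (\<lambda>s. s \<cdot>\<^bsub>?E\<^esub> t)"
      by (subst lin_map_cong[OF is_vspace_tensor_vs heisenberg_mult], assumption, rule t)
        (rule lin_tsum[OF KL_vs is_vspace_tensor_vs bilin_smash2[OF t]])
    show "lin_map ?T ?T (\<lambda>s. t \<cdot>\<^bsub>?E\<^esub> s)"
      by (subst lin_map_cong[OF is_vspace_tensor_vs heisenberg_mult], rule t, assumption)
        (intro lin_tsum_param[OF is_vspace_tensor_vs KL_vs t] lin_tsum[OF KL_vs is_vspace_tensor_vs] bilin_smash)
  qed
  then have "bilin_map ?E ?E ?E (amult ?E)"
    unfolding bilin_map_def lin_map_def by simp
  moreover have "is_vspace ?E"
    using is_vspace_tensor_vs[of K L] is_vspace_cong[of ?E ?T] by simp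
  ultimately show ?thesis by (simp add: bilin_algebra_def)
qed

lemma heisenberg_mult_ten:
  assumes "k \<in> vcar K" "\<theta> \<in> vcar L" "k' \<in> vcar K" "\<theta>' \<in> vcar L"
  shows "(k \<otimes> \<theta>) \<cdot>\<^bsub>heisenberg_alg K L p\<^esub> (k' \<otimes> \<theta>') = smash k \<theta> k' \<theta>'"
proof -
  note t = ten_in[OF KL_vs assms(1,2)] ten_in[OF KL_vs assms(3,4)]
  show ?thesis
    unfolding heisenberg_mult[OF t]
      tsum_pure[OF KL_vs is_vspace_tensor_vs bilin_smash2[OF t(2)] assms(1,2)]
      tsum_pure[OF KL_vs is_vspace_tensor_vs bilin_smash[OF assms(1,2)] assms(3,4)] ..
qed

lemma smash_left_right:
  assumes "k \<in> vcar K" "\<theta> \<in> vcar L"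
  shows "smash k \<one>\<^bsub>L\<^esub> \<one>\<^bsub>K\<^esub> \<theta> = k \<otimes> \<theta>"
proof -
  let ?F = "\<lambda>k2 k1 \<theta>1 \<theta>2. pscale (p k2 \<theta>1) ((k \<cdot>\<^bsub>K\<^esub> k1) \<otimes> (\<theta>2 \<cdot>\<^bsub>L\<^esub> \<theta>))"
  have inner: "tsum L L (\<one>\<^bsub>L\<^esub> \<otimes>\<^bsub>L,L\<^esub> \<one>\<^bsub>L\<^esub>) (?F k2 k1) = ?F k2 k1 \<one>\<^bsub>L\<^esub> \<one>\<^bsub>L\<^esub>"
    if "k1 \<in> vcar K" "k2 \<in> vcar K" for k1 k2
    using that assms by (intro tsum_pure[where U = "tensor_vs K L"]) (auto intro!: lin_KL simp: KL_in)
  have "smash k \<one>\<^bsub>L\<^esub> \<one>\<^bsub>K\<^esub> \<theta> = tsum L L (\<one>\<^bsub>L\<^esub> \<otimes>\<^bsub>L,L\<^esub> \<one>\<^bsub>L\<^esub>) (?F \<one>\<^bsub>K\<^esub> \<one>\<^bsub>K\<^esub>)"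
    unfolding smash_def comultK(2) comultL(2) using assms
    by (intro tsum_pure[where U = "tensor_vs K L"]) (auto intro!: lin_KL simp: KL_in ten_in[OF KL_vs(2,2)])
  also have "\<dots> = ?F \<one>\<^bsub>K\<^esub> \<one>\<^bsub>K\<^esub> \<one>\<^bsub>L\<^esub> \<one>\<^bsub>L\<^esub>"
    by (rule inner) (simp_all add: KL_in)
  also have "\<dots> = k \<otimes> \<theta>"
    using assms algebraD(5,6)[OF algK] algebraD(5,6)[OF algL]
    by (simp add: p(2)) (simp add: pscale_def)
  finally show ?thesis .
qed

text \<open>In \<open>(1 # S\<theta>)(k # 1)\<close> the antipode can be moved past the coproduct of \<open>\<theta>\<close>.\<close>

lemma smash_right_left:
  assumes k: "k \<in> vcar K" and \<theta>: "\<theta> \<in> vcar L"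
  shows "smash \<one>\<^bsub>K\<^esub> (antipode L \<theta>) k \<one>\<^bsub>L\<^esub>
    = tsum K K (comult K k) (\<lambda>k1 k2. tsum L L (comult L \<theta>) (\<lambda>\<theta>1 \<theta>2.
        pscale (p k2 (antipode L \<theta>2)) (k1 \<otimes> antipode L \<theta>1)))"
proof -
  let ?S = "antipode L"
  have "tsum L L (comult L (?S \<theta>)) (\<lambda>\<theta>1 \<theta>2. pscale (p k2 \<theta>1) ((\<one>\<^bsub>K\<^esub> \<cdot>\<^bsub>K\<^esub> k1) \<otimes> (\<theta>2 \<cdot>\<^bsub>L\<^esub> \<one>\<^bsub>L\<^esub>)))
    = tsum L L (comult L \<theta>) (\<lambda>\<theta>1 \<theta>2. pscale (p k2 (?S \<theta>2)) (k1 \<otimes> ?S \<theta>1))"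
    if k12: "k1 \<in> vcar K" "k2 \<in> vcar K" for k1 k2
  proof -
    let ?F = "\<lambda>\<theta>1 \<theta>2. pscale (p k2 \<theta>1) ((\<one>\<^bsub>K\<^esub> \<cdot>\<^bsub>K\<^esub> k1) \<otimes> (\<theta>2 \<cdot>\<^bsub>L\<^esub> \<one>\<^bsub>L\<^esub>))"
    have F: "bilin_map L L (tensor_vs K L) ?F" using k12 by (auto intro!: lin_KL simp: KL_in)
    have "tsum L L (comult L (?S \<theta>)) ?F = tsum L L (comult L \<theta>) (\<lambda>a b. tsum L L (?S b \<otimes>\<^bsub>L,L\<^esub> ?S a) ?F)"
      unfolding comult_S[OF \<theta>] using \<theta>
      by (intro tsum_tsum[OF KL_vs(2,2) _ KL_vs(2,2) is_vspace_tensor_vs F])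
        (auto simp: KL_in intro!: ten_in KL_vs)
    also have "\<dots> = tsum L L (comult L \<theta>) (\<lambda>a b. ?F (?S b) (?S a))"
      using \<theta>
      by (intro tsum_cong[OF KL_vs(2,2)] tsum_pure[OF KL_vs(2,2) is_vspace_tensor_vs F]) (auto simp: KL_in)
    also have "\<dots> = tsum L L (comult L \<theta>) (\<lambda>\<theta>1 \<theta>2. pscale (p k2 (?S \<theta>2)) (k1 \<otimes> ?S \<theta>1))"
      using \<theta> k12
      by (intro tsum_cong[OF KL_vs(2,2)]) (auto simp: KL_in algebraD(5)[OF algK] algebraD(6)[OF algL])
    finally show ?thesis .
  qed
  then show ?thesis
    unfolding smash_def using k by (intro tsum_cong[OF KL_vs(1,1)]) (auto simp: KL_in)
qed

text \<open>The two products are computed on pure tensors by \<open>smash_left_right\<close> and \<open>smash_right_left\<close>.  Both are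
  images under the antipode of \<open>L\<close> in the second leg, an injective map, of the two sides of the new equation.\<close>

lemma braided_commute_iff:
  fixes Y :: "('k, 'y::ab_group_add, 'q) alg_scheme"
  assumes Y: "algebra Y" and s: "s \<in> vcar (tensor_vs K Y)" and t: "t \<in> vcar (tensor_vs L Y)"
  defines "E \<equiv> heisenberg_alg K L p" and "M \<equiv> tensor_alg (heisenberg_alg K L p) (alg_op Y)"
  defines "a \<equiv> tmap (hopf_op K) Y E (alg_op Y) (\<lambda>k. k \<otimes> \<one>\<^bsub>L\<^esub>) id s"
    and "b \<equiv> tmap L Y E (alg_op Y) (\<lambda>\<theta>. \<one>\<^bsub>K\<^esub> \<otimes> antipode L \<theta>) id t"
  shows "a \<cdot>\<^bsub>M\<^esub> b = b \<cdot>\<^bsub>M\<^esub> a \<longleftrightarrow>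
    tsum K Y s (\<lambda>k u. tsum L Y t (\<lambda>\<theta> v. (k \<otimes> \<theta>) \<otimes>\<^bsub>tensor_vs K L,Y\<^esub> (v \<cdot>\<^bsub>Y\<^esub> u)))
    = tsum K Y s (\<lambda>k u. tsum L Y t (\<lambda>\<theta> v. tsum K K (comult K k) (\<lambda>k1 k2. tsum L L (comult L \<theta>) (\<lambda>\<theta>1 \<theta>2.
        pscale (p k2 (antipode L \<theta>2)) (k1 \<otimes> \<theta>1))) \<otimes>\<^bsub>tensor_vs K L,Y\<^esub> (u \<cdot>\<^bsub>Y\<^esub> v)))"
    (is "_ \<longleftrightarrow> ?Z1 = ?Z2")
proof -
  let ?T = "tensor_vs K L" and ?S = "antipode L" and ?Y = "alg_op Y"
  let ?W = "tensor_vs ?T Y"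
  note Yv = algebraD(1)[OF Y]
  have ten: "v \<otimes>\<^bsub>E,?Y\<^esub> w = v \<otimes>\<^bsub>?T,Y\<^esub> w" for v w unfolding E_def by (rule ten_cong) simp_all
  have tvs: "tensor_vs E ?Y = ?W" unfolding E_def by (rule tensor_vs_cong) simp_all
  have bE: "bilin_algebra E" unfolding E_def by (rule bilin_algebra_heisenberg)
  have bY: "bilin_algebra ?Y" by (rule bilin_algebra[OF algebra_alg_op[OF Y]])
  have M: "M = tensor_alg E ?Y" by (simp add: M_def E_def)
  have vE: "vcar E = vcar ?T" by (simp add: E_def)
  note lM = bilin_mapD(1,2)[OF tensor_mult_bilin_map[OF bE bY], unfolded tvs, folded M]
  note pure = tensor_mult_ten[OF bE bY, unfolded ten, folded M, simplified, unfolded vE]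
  note W_in = ten_in[OF is_vspace_tensor_vs[of K L] Yv]
  have a: "a = tsum K Y s (\<lambda>k u. (k \<otimes> \<one>\<^bsub>L\<^esub>) \<otimes>\<^bsub>?T,Y\<^esub> u)"
  proof -
    have "a = tmap K Y ?T Y (\<lambda>k. k \<otimes> \<one>\<^bsub>L\<^esub>) id s"
      unfolding a_def by (rule tmap_space_cong) (simp_all add: E_def)
    also have "\<dots> = tsum K Y s (\<lambda>k u. (k \<otimes> \<one>\<^bsub>L\<^esub>) \<otimes>\<^bsub>?T,Y\<^esub> id u)"
      by (intro tmap_tsum KL_vs Yv s is_vspace_tensor_vs lin_id[folded id_def])
        (auto intro!: lin_KL simp: KL_in)
    finally show ?thesis by simp
  qed
  have b: "b = tsum L Y t (\<lambda>\<theta> v. (\<one>\<^bsub>K\<^esub> \<otimes> ?S \<theta>) \<otimes>\<^bsub>?T,Y\<^esub> v)"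
  proof -
    have "b = tmap L Y ?T Y (\<lambda>\<theta>. \<one>\<^bsub>K\<^esub> \<otimes> ?S \<theta>) id t"
      unfolding b_def by (rule tmap_space_cong) (simp_all add: E_def)
    also have "\<dots> = tsum L Y t (\<lambda>\<theta> v. (\<one>\<^bsub>K\<^esub> \<otimes> ?S \<theta>) \<otimes>\<^bsub>?T,Y\<^esub> id v)"
      by (intro tmap_tsum KL_vs Yv t is_vspace_tensor_vs lin_id[folded id_def])
        (auto intro!: lin_KL simp: KL_in)
    finally show ?thesis by simp
  qed
  have bin: "b \<in> vcar ?W"
    unfolding b by (auto intro!: tsum_in KL_vs Yv s t is_vspace_tensor_vs W_in simp: KL_in)
  note lid = lin_id[of Y, folded id_def]
  note lST = lin_tmap[OF KL_vs KL_vs lin_id[of K, folded id_def] lin_S]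
  define \<Phi> where "\<Phi> = tmap ?T Y ?T Y (tmap K L K L id ?S) id"
  have l\<Phi>: "lin_map ?W ?W \<Phi>"
    unfolding \<Phi>_def by (rule lin_tmap[OF is_vspace_tensor_vs Yv is_vspace_tensor_vs Yv lST lid])
  have \<Phi>: "\<Phi> (r \<otimes>\<^bsub>?T,Y\<^esub> w) = tmap K L K L id ?S r \<otimes>\<^bsub>?T,Y\<^esub> w" if "r \<in> vcar ?T" "w \<in> vcar Y" for r w
    unfolding \<Phi>_def using tmap_ten[OF is_vspace_tensor_vs Yv is_vspace_tensor_vs Yv lST lid that] by simp
  have ST: "tmap K L K L id ?S (k \<otimes> \<theta>) = k \<otimes> ?S \<theta>" if "k \<in> vcar K" "\<theta> \<in> vcar L" for k \<theta>
    using tmap_ten[OF KL_vs KL_vs lin_id[of K, folded id_def] lin_S that] by simp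
  have inj: "x = y" if "\<Phi> x = \<Phi> y" "x \<in> vcar ?W" "y \<in> vcar ?W" for x y
  proof -
    let ?R = "inv_into (vcar L) ?S"
    have RS: "?R (?S \<theta>) = \<theta>" if "\<theta> \<in> vcar L" for \<theta>
      using bij_S that by (simp add: bij_betw_def inv_into_f_f)
    have lR: "lin_map L L ?R" by (rule lin_inv_into[OF KL_vs(2) lin_S bij_S])
    note lRT = lin_tmap[OF KL_vs KL_vs lin_id[of K, folded id_def] lR]
    have "tmap ?T Y ?T Y (tmap K L K L id ?R) id (\<Phi> z) = z" if "z \<in> vcar ?W" for z
      unfolding \<Phi>_def
      by (intro tmap_inverse[OF is_vspace_tensor_vs Yv is_vspace_tensor_vs Yv lST lid lRT lid _ _ that]
          tmap_inverse[OF KL_vs KL_vs lin_id[of K, folded id_def] lin_S lin_id[of K, folded id_def] lR])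
        (auto simp: RS)
    then show ?thesis using that by metis
  qed
  let ?m = "\<lambda>k \<theta>. tsum K K (comult K k) (\<lambda>k1 k2. tsum L L (comult L \<theta>) (\<lambda>\<theta>1 \<theta>2.
        pscale (p k2 (?S \<theta>2)) (k1 \<otimes> \<theta>1)))"
  have m_in: "?m k \<theta> \<in> vcar ?T" if "k \<in> vcar K" "\<theta> \<in> vcar L" for k \<theta>
    using that by (auto intro!: tsum_in[where U = ?T] KL_vs is_vspace_tensor_vs simp: KL_in)
  have m: "tmap K L K L id ?S (?m k \<theta>) = smash \<one>\<^bsub>K\<^esub> (?S \<theta>) k \<one>\<^bsub>L\<^esub>"
    if kt: "k \<in> vcar K" "\<theta> \<in> vcar L" for k \<theta>
  proof -
    have "tmap K L K L id ?S (?m k \<theta>) = tsum K K (comult K k) (\<lambda>k1 k2. tmap K L K L id ?S 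
       (tsum L L (comult L \<theta>) (\<lambda>\<theta>1 \<theta>2. pscale (p k2 (?S \<theta>2)) (k1 \<otimes> \<theta>1))))"
      using kt by (intro lin_map_tsum[OF lST KL_vs(1,1) _ is_vspace_tensor_vs])
        (auto intro!: tsum_in[where U = ?T] KL_vs is_vspace_tensor_vs simp: KL_in)
    also have "\<dots> = tsum K K (comult K k) (\<lambda>k1 k2. tsum L L (comult L \<theta>) (\<lambda>\<theta>1 \<theta>2. tmap K L K L id ?S 
       (pscale (p k2 (?S \<theta>2)) (k1 \<otimes> \<theta>1))))"
      using kt by (intro tsum_cong[OF KL_vs(1,1)] lin_map_tsum[OF lST KL_vs(2,2) _ is_vspace_tensor_vs])
        (auto simp: KL_in)
    also have "\<dots> = tsum K K (comult K k) (\<lambda>k1 k2. tsum L L (comult L \<theta>) (\<lambda>\<theta>1 \<theta>2. 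
       pscale (p k2 (?S \<theta>2)) (k1 \<otimes> ?S \<theta>1)))"
      using kt by (intro tsum_cong KL_vs) (auto simp: KL_in lin_mapD(3)[OF lST, simplified] ST)
    finally show ?thesis using smash_right_left[OF kt] by simp
  qed
  have ab: "a \<cdot>\<^bsub>M\<^esub> b = \<Phi> ?Z1"
  proof -
    have "a \<cdot>\<^bsub>M\<^esub> b = tsum K Y s (\<lambda>k u. ((k \<otimes> \<one>\<^bsub>L\<^esub>) \<otimes>\<^bsub>?T,Y\<^esub> u) \<cdot>\<^bsub>M\<^esub> b)"
      unfolding a by (intro lin_map_tsum[OF lM(2)[OF bin] KL_vs(1) Yv s is_vspace_tensor_vs]) (auto simp: KL_in W_in)
    also have "\<dots> = tsum K Y s (\<lambda>k u. tsum L Y t (\<lambda>\<theta> v.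
        ((k \<otimes> \<one>\<^bsub>L\<^esub>) \<otimes>\<^bsub>?T,Y\<^esub> u) \<cdot>\<^bsub>M\<^esub> ((\<one>\<^bsub>K\<^esub> \<otimes> ?S \<theta>) \<otimes>\<^bsub>?T,Y\<^esub> v)))"
      unfolding b
      by (intro tsum_cong[OF KL_vs(1) Yv s] lin_map_tsum[OF lM(1) KL_vs(2) Yv t is_vspace_tensor_vs]) (auto simp: KL_in W_in)
    also have "\<dots> = tsum K Y s (\<lambda>k u. tsum L Y t (\<lambda>\<theta> v. (k \<otimes> ?S \<theta>) \<otimes>\<^bsub>?T,Y\<^esub> (v \<cdot>\<^bsub>Y\<^esub> u)))"
      by (intro tsum_cong[OF KL_vs(1) Yv s] tsum_cong[OF KL_vs(2) Yv t])
        (simp add: pure KL_in E_def heisenberg_mult_ten smash_left_right)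
    also have "\<dots> = tsum K Y s (\<lambda>k u. tsum L Y t (\<lambda>\<theta> v. \<Phi> ((k \<otimes> \<theta>) \<otimes>\<^bsub>?T,Y\<^esub> (v \<cdot>\<^bsub>Y\<^esub> u))))"
      by (intro tsum_cong[OF KL_vs(1) Yv s] tsum_cong[OF KL_vs(2) Yv t])
        (simp add: KL_in \<Phi> ST algebraD(7)[OF Y])
    also have "\<dots> = tsum K Y s (\<lambda>k u. \<Phi> (tsum L Y t (\<lambda>\<theta> v. (k \<otimes> \<theta>) \<otimes>\<^bsub>?T,Y\<^esub> (v \<cdot>\<^bsub>Y\<^esub> u))))"
      by (intro tsum_cong[OF KL_vs(1) Yv s] lin_map_tsum[OF l\<Phi> KL_vs(2) Yv t is_vspace_tensor_vs, symmetric])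
        (simp add: KL_in W_in algebraD(7)[OF Y])
    also have "\<dots> = \<Phi> ?Z1"
      by (intro lin_map_tsum[OF l\<Phi> KL_vs(1) Yv s is_vspace_tensor_vs, symmetric] tsum_in KL_vs Yv t is_vspace_tensor_vs)
        (simp add: KL_in W_in algebraD(7)[OF Y])
    finally show ?thesis .
  qed
  have ba: "b \<cdot>\<^bsub>M\<^esub> a = \<Phi> ?Z2"
  proof -
    have "b \<cdot>\<^bsub>M\<^esub> a = tsum K Y s (\<lambda>k u. b \<cdot>\<^bsub>M\<^esub> ((k \<otimes> \<one>\<^bsub>L\<^esub>) \<otimes>\<^bsub>?T,Y\<^esub> u))"
      unfolding a by (intro lin_map_tsum[OF lM(1)[OF bin] KL_vs(1) Yv s is_vspace_tensor_vs]) (auto simp: KL_in W_in)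
    also have "\<dots> = tsum K Y s (\<lambda>k u. tsum L Y t (\<lambda>\<theta> v.
        ((\<one>\<^bsub>K\<^esub> \<otimes> ?S \<theta>) \<otimes>\<^bsub>?T,Y\<^esub> v) \<cdot>\<^bsub>M\<^esub> ((k \<otimes> \<one>\<^bsub>L\<^esub>) \<otimes>\<^bsub>?T,Y\<^esub> u)))"
      unfolding b
      by (intro tsum_cong[OF KL_vs(1) Yv s] lin_map_tsum[OF lM(2) KL_vs(2) Yv t is_vspace_tensor_vs]) (auto simp: KL_in W_in)
    also have "\<dots> = tsum K Y s (\<lambda>k u. tsum L Y t (\<lambda>\<theta> v. smash \<one>\<^bsub>K\<^esub> (?S \<theta>) k \<one>\<^bsub>L\<^esub> \<otimes>\<^bsub>?T,Y\<^esub> (u \<cdot>\<^bsub>Y\<^esub> v)))"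
      by (intro tsum_cong[OF KL_vs(1) Yv s] tsum_cong[OF KL_vs(2) Yv t])
        (simp add: pure KL_in E_def heisenberg_mult_ten)
    also have "\<dots> = tsum K Y s (\<lambda>k u. tsum L Y t (\<lambda>\<theta> v. \<Phi> (?m k \<theta> \<otimes>\<^bsub>?T,Y\<^esub> (u \<cdot>\<^bsub>Y\<^esub> v))))"
      by (intro tsum_cong[OF KL_vs(1) Yv s] tsum_cong[OF KL_vs(2) Yv t])
        (simp add: m_in \<Phi> m algebraD(7)[OF Y])
    also have "\<dots> = tsum K Y s (\<lambda>k u. \<Phi> (tsum L Y t (\<lambda>\<theta> v. ?m k \<theta> \<otimes>\<^bsub>?T,Y\<^esub> (u \<cdot>\<^bsub>Y\<^esub> v))))"
      by (intro tsum_cong[OF KL_vs(1) Yv s] lin_map_tsum[OF l\<Phi> KL_vs(2) Yv t is_vspace_tensor_vs, symmetric])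
        (simp add: m_in W_in algebraD(7)[OF Y])
    also have "\<dots> = \<Phi> ?Z2"
      by (intro lin_map_tsum[OF l\<Phi> KL_vs(1) Yv s is_vspace_tensor_vs, symmetric] tsum_in KL_vs Yv t is_vspace_tensor_vs)
        (simp add: m_in W_in algebraD(7)[OF Y])
    finally show ?thesis .
  qed
  have "?Z1 \<in> vcar ?W" "?Z2 \<in> vcar ?W"
    by (intro tsum_in KL_vs Yv s t is_vspace_tensor_vs W_in m_in algebraD(7)[OF Y] ten_in; assumption)+
  then show ?thesis unfolding ab ba using inj by auto
qed

end

section \<open>Canonical elements\<close>

text \<open>Independence of the dual bases: expanding \<open>b\<close> in the basis \<open>C\<close> and collecting the coefficients of
  \<open>c\<close> turns one canonical element into the other.\<close>

lemma canonical_elt_eq: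
  assumes V: "is_vspace K" "is_vspace L" and p: "bilin_map K L ground_vs p" and D: "dual_bases K L p B d"
  shows "canonical_elt K L p = (\<Sum>b\<in>B. b \<otimes>\<^bsub>K,L\<^esub> d b)"
  unfolding canonical_elt_def
proof (rule the_equality)
  show "\<exists>C e. dual_bases K L p C e \<and> (\<Sum>b\<in>B. b \<otimes>\<^bsub>K,L\<^esub> d b) = (\<Sum>b\<in>C. b \<otimes>\<^bsub>K,L\<^esub> e b)"
    using D by blast
  fix u assume "\<exists>C e. dual_bases K L p C e \<and> u = (\<Sum>c\<in>C. c \<otimes>\<^bsub>K,L\<^esub> e c)"
  then obtain C e where E: "dual_bases K L p C e" and u: "u = (\<Sum>c\<in>C. c \<otimes>\<^bsub>K,L\<^esub> e c)" by blast
  note b = dual_bases_expand[OF V p D] and c = dual_bases_expand[OF V p E]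
  note sc = is_vspace_carrier(3)[OF V(1)] is_vspace_carrier(3)[OF V(2)]
  have "(\<Sum>b\<in>B. b \<otimes>\<^bsub>K,L\<^esub> d b) = (\<Sum>b\<in>B. \<Sum>c\<in>C. pscale (p b (e c)) (c \<otimes>\<^bsub>K,L\<^esub> d b))"
  proof (rule sum.cong[OF refl])
    fix x assume x: "x \<in> B"
    have l: "lin_map K (tensor_vs K L) (\<lambda>k. k \<otimes>\<^bsub>K,L\<^esub> d x)"
      using b(3)[OF x] by (intro lin_ten_left V lin_id)
    have "x \<otimes>\<^bsub>K,L\<^esub> d x = (\<Sum>c\<in>C. vscale K (p x (e c)) c) \<otimes>\<^bsub>K,L\<^esub> d x"
      using c(4)[OF b(2)[OF x]] by simp
    also have "\<dots> = (\<Sum>c\<in>C. vscale K (p x (e c)) c \<otimes>\<^bsub>K,L\<^esub> d x)"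
      by (rule lin_map_sum[OF V(1) l]) (use c(2) sc in auto)
    also have "\<dots> = (\<Sum>c\<in>C. pscale (p x (e c)) (c \<otimes>\<^bsub>K,L\<^esub> d x))"
      using c(2) b(3)[OF x] by (intro sum.cong) (auto simp: ten_linear(3)[OF V])
    finally show "x \<otimes>\<^bsub>K,L\<^esub> d x = (\<Sum>c\<in>C. pscale (p x (e c)) (c \<otimes>\<^bsub>K,L\<^esub> d x))" .
  qed
  also have "\<dots> = (\<Sum>c\<in>C. \<Sum>b\<in>B. pscale (p b (e c)) (c \<otimes>\<^bsub>K,L\<^esub> d b))"
    by (rule sum.swap)
  also have "\<dots> = (\<Sum>c\<in>C. c \<otimes>\<^bsub>K,L\<^esub> e c)"
  proof (rule sum.cong[OF refl])
    fix x assume x: "x \<in> C"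
    have l: "lin_map L (tensor_vs K L) (\<lambda>l. x \<otimes>\<^bsub>K,L\<^esub> l)"
      using c(2)[OF x] by (intro lin_ten_right V lin_id)
    have "x \<otimes>\<^bsub>K,L\<^esub> e x = x \<otimes>\<^bsub>K,L\<^esub> (\<Sum>b\<in>B. vscale L (p b (e x)) (d b))"
      using b(5)[OF c(3)[OF x]] by simp
    also have "\<dots> = (\<Sum>b\<in>B. x \<otimes>\<^bsub>K,L\<^esub> vscale L (p b (e x)) (d b))"
      by (rule lin_map_sum[OF V(2) l]) (use b(3) sc in auto)
    also have "\<dots> = (\<Sum>b\<in>B. pscale (p b (e x)) (x \<otimes>\<^bsub>K,L\<^esub> d b))"
      using c(2)[OF x] b(3) by (intro sum.cong) (auto simp: ten_linear(4)[OF V])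
    finally show "(\<Sum>b\<in>B. pscale (p b (e x)) (x \<otimes>\<^bsub>K,L\<^esub> d b)) = x \<otimes>\<^bsub>K,L\<^esub> e x" by simp
  qed
  finally show "u = (\<Sum>b\<in>B. b \<otimes>\<^bsub>K,L\<^esub> d b)" using u by simp
qed

lemma dual_bases_flip:
  assumes "dual_bases K L p B d"
  shows "dual_bases L K (\<lambda>l k. p k l) (d ` B) (inv_into B d)"
proof -
  have inj: "inj_on d B" using assms by (simp add: dual_bases_def)
  then have "inv_into B d ` (d ` B) = B" by simp
  then show ?thesis
    using assms inj inj_on_inv_into[of "d ` B" d B]
    by (auto simp: dual_bases_def inj_on_eq_iff)
qed

lemma canonical_elt_flip:
  assumes V: "is_vspace K" "is_vspace L" and p: "bilin_map K L ground_vs p" and D: "dual_bases K L p B d"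
  shows "canonical_elt L K (\<lambda>l k. p k l) = tflip K L (canonical_elt K L p)"
proof -
  have p': "bilin_map L K ground_vs (\<lambda>l k. p k l)" using p by (simp add: bilin_map_def)
  have inj: "inj_on d B" using D by (simp add: dual_bases_def)
  note b = dual_bases_expand[OF V p D]
  have "canonical_elt L K (\<lambda>l k. p k l) = (\<Sum>b\<in>B. d b \<otimes>\<^bsub>L,K\<^esub> b)"
    unfolding canonical_elt_eq[OF V(2,1) p' dual_bases_flip[OF D]] sum.reindex[OF inj]
    using inj by (intro sum.cong) auto
  also have "\<dots> = tflip K L (\<Sum>b\<in>B. b \<otimes>\<^bsub>K,L\<^esub> d b)"
    using lin_map_sum[OF is_vspace_tensor_vs lin_tflip[OF V], of B "\<lambda>b. b \<otimes>\<^bsub>K,L\<^esub> d b"] b(2,3)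
    by (simp add: ten_in[OF V] tflip_ten[OF V])
  finally show ?thesis by (simp add: canonical_elt_eq[OF V p D])
qed

section \<open>The dual Hopf algebra\<close>

lemma dual_ops [simp]:
  "\<one>\<^bsub>hopf_dual H\<^esub> = (\<lambda>k. if k \<in> vcar H then counit H k else 0)"
  "antipode (hopf_dual H) = (\<lambda>\<theta> k. if k \<in> vcar H then \<theta> (antipode H k) else 0)"
  by (simp_all add: hopf_dual_def Let_def)

context fd_hopf_alg
begin

lemma dual_mult:
  assumes "\<theta> \<in> vcar L" "\<omega> \<in> vcar L"
  shows "\<theta> \<cdot>\<^bsub>L\<^esub> \<omega> = restr (\<lambda>k. sw k (\<lambda>a b. \<theta> a * \<omega> b))"
proof -
  have "bilin_map H H ground_vs (\<lambda>a b. \<theta> a * \<omega> b)"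
    using assms by (auto intro!: bilin_mapI lin_times_left)
  then have "tlift H H (\<lambda>a b. \<theta> a * \<omega> b) (comult H k) = sw k (\<lambda>a b. \<theta> a * \<omega> b)" if "k \<in> vcar H" for k
    using that by (intro tlift_tsum[where U = ground_vs]) auto
  then show ?thesis by (auto simp: hopf_dual_def Let_def)
qed

lemma algebra_dual: "algebra L"
proof (rule algebra_cong)
  have lin: "lin_map H (ground_alg :: ('a, 'a) alg) f \<longleftrightarrow> lin_map H ground_vs f" for f
    by (rule lin_map_space_cong) (simp_all add: ground_alg_def ground_vs_def)
  show v: "vcar (conv_alg H (ground_alg :: ('a, 'a) alg)) = vcar L"
    by (auto simp: lin)
  show "vscale (conv_alg H (ground_alg :: ('a, 'a) alg)) = vscale L"
    by (auto simp: fun_eq_iff pscale_def ground_alg_def)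
  show "\<one>\<^bsub>conv_alg H (ground_alg :: ('a, 'a) alg)\<^esub> = \<one>\<^bsub>L\<^esub>"
    by (auto simp: fun_eq_iff ground_alg_def)
  show "f \<cdot>\<^bsub>conv_alg H ground_alg\<^esub> g = f \<cdot>\<^bsub>L\<^esub> g"
    if "f \<in> vcar (conv_alg H (ground_alg :: ('a, 'a) alg))" "g \<in> vcar (conv_alg H (ground_alg :: ('a, 'a) alg))" for f g
  proof
    fix k
    show "(f \<cdot>\<^bsub>conv_alg H ground_alg\<^esub> g) k = (f \<cdot>\<^bsub>L\<^esub> g) k"
      using that unfolding v by (cases "k \<in> vcar H") (simp_all add: dual_mult, simp add: ground_alg_def)
  qed
qed (rule algebra_conv[OF algebra_ground])

lemma dual_vs: "is_vspace L"
  by (rule is_vspace_dual)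

lemma dual_lin: "\<theta> \<in> vcar L \<Longrightarrow> lin_map H ground_vs \<theta>"
  by simp

lemma lin_antipode_dual: "lin_map L L (antipode L)"
  by (rule lin_mapI) (auto simp: lin_restr pscale_def intro!: lin_comp[OF _ lin_antipode])

lemma antipode_dual_bij: "bij_betw (antipode L) (vcar L) (vcar L)"
proof -
  have "inj_on (antipode L) (vcar L)"
  proof (rule inj_onI, rule ext)
    fix \<theta> \<omega> k assume t: "\<theta> \<in> vcar L" "\<omega> \<in> vcar L" "antipode L \<theta> = antipode L \<omega>"
    show "\<theta> k = \<omega> k"
    proof (cases "k \<in> vcar H")
      case True
      then obtain h where h: "h \<in> vcar H" "k = antipode H h" using antipode_surj by blast
      then show ?thesis using fun_cong[OF t(3), of h] by simp
    qed (use t in simp)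
  qed
  moreover have "\<theta> \<in> antipode L ` vcar L" if t: "\<theta> \<in> vcar L" for \<theta>
  proof
    let ?R = "inv_into (vcar H) (antipode H)"
    let ?w = "restr (\<lambda>k. \<theta> (?R k))"
    have RS: "?R (antipode H h) = h" if "h \<in> vcar H" for h
      using that antipode_inj by simp
    have "lin_map H ground_vs (\<lambda>k. \<theta> (?R k))"
      by (rule lin_comp[OF dual_lin[OF t] lin_inv_into[OF vs lin_antipode antipode_bij]])
    then show w: "?w \<in> vcar L" by (simp add: lin_restr)
    show "\<theta> = antipode L ?w"
    proof
      fix k show "\<theta> k = antipode L ?w k" using t by (cases "k \<in> vcar H") (simp_all add: RS)
    qed
  qed
  moreover have "antipode L \<theta> \<in> vcar L" if "\<theta> \<in> vcar L" for \<theta>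
    using lin_mapD(1)[OF lin_antipode_dual that] .
  ultimately show ?thesis unfolding bij_betw_def by (intro conjI subset_antisym subsetI) (auto simp del: dual_simps dual_ops)
qed

text \<open>The linear map \<open>h \<mapsto> \<theta>(h) v\<close> that corresponds to the tensor \<open>v \<otimes> \<theta>\<close>.\<close>

definition eval2 :: "('a, 'v::ab_group_add, 'q) vspace_scheme \<Rightarrow> ('a, 'v, 'b \<Rightarrow> 'a) tensor \<Rightarrow> 'b \<Rightarrow> 'v" where
  "eval2 V t h = tsum V L t (\<lambda>v \<theta>. vscale V (\<theta> h) v)"

lemma lin_eval_at: "h \<in> vcar H \<Longrightarrow> lin_map L ground_vs (\<lambda>\<theta>. \<theta> h)"
  using bilin_mapD(1)[OF bilin_evaluation[of H]] .

lemma eval2_bilin: "is_vspace V \<Longrightarrow> h \<in> vcar H \<Longrightarrow> bilin_map V L V (\<lambda>v \<theta>. vscale V (\<theta> h) v)"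
  by (intro bilin_mapI lin_scale_left lin_scale_right lin_eval_at lin_id)

lemma lin_eval2: "is_vspace V \<Longrightarrow> h \<in> vcar H \<Longrightarrow> lin_map (tensor_vs V L) V (\<lambda>t. eval2 V t h)"
  unfolding eval2_def by (intro lin_tsum dual_vs eval2_bilin)

lemma eval2_ten: "is_vspace V \<Longrightarrow> h \<in> vcar H \<Longrightarrow> v \<in> vcar V \<Longrightarrow> \<theta> \<in> vcar L \<Longrightarrow>
    eval2 V (v \<otimes>\<^bsub>V,L\<^esub> \<theta>) h = vscale V (\<theta> h) v"
  unfolding eval2_def by (intro tsum_pure[where U = V] dual_vs eval2_bilin)

lemma tensor_dual_expand:
  assumes V: "is_vspace V" and D: "dual_bases H L (\<lambda>h \<theta>. \<theta> h) B d" and t: "t \<in> vcar (tensor_vs V L)"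
  shows "(\<Sum>b\<in>B. eval2 V t b \<otimes>\<^bsub>V,L\<^esub> d b) = t"
proof (rule lin_map_tensor_eq[OF V dual_vs _ lin_id _ t])
  note b = expand_id[OF D]
  show "lin_map (tensor_vs V L) (tensor_vs V L) (\<lambda>t. \<Sum>b\<in>B. eval2 V t b \<otimes>\<^bsub>V,L\<^esub> d b)"
    by (intro lin_sum is_vspace_tensor_vs lin_ten_left V dual_vs lin_eval2 b(2,3))
  fix v \<theta> assume v: "v \<in> vcar V" and \<theta>: "\<theta> \<in> vcar L"
  have "(\<Sum>b\<in>B. eval2 V (v \<otimes>\<^bsub>V,L\<^esub> \<theta>) b \<otimes>\<^bsub>V,L\<^esub> d b) = (\<Sum>b\<in>B. v \<otimes>\<^bsub>V,L\<^esub> vscale L (\<theta> b) (d b))"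
    using v \<theta> b(2,3) 
    by (intro sum.cong refl) (simp only: eval2_ten[OF V] ten_linear(3,4)[OF V dual_vs])
  also have "\<dots> = v \<otimes>\<^bsub>V,L\<^esub> (\<Sum>b\<in>B. vscale L (\<theta> b) (d b))"
    using lin_ten_right[OF V dual_vs lin_id v]
    by (intro lin_map_sum[OF dual_vs, symmetric]) (auto intro: is_vspace_carrier(3)[OF dual_vs] b(3) simp del: dual_simps)
  finally show "(\<Sum>b\<in>B. eval2 V (v \<otimes>\<^bsub>V,L\<^esub> \<theta>) b \<otimes>\<^bsub>V,L\<^esub> d b) = v \<otimes>\<^bsub>V,L\<^esub> \<theta>"
    by (simp only: b(5)[OF \<theta>])
qed

lemma tensor_dual_eqI:
  assumes V: "is_vspace V" and s: "s \<in> vcar (tensor_vs V L)" and t: "t \<in> vcar (tensor_vs V L)"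
    and eq: "\<And>h. h \<in> vcar H \<Longrightarrow> eval2 V s h = eval2 V t h"
  shows "s = t"
proof -
  obtain B d where D: "dual_bases H L (\<lambda>h \<theta>. \<theta> h) B d" using ex_dual_bases by blast
  have "(\<Sum>b\<in>B. eval2 V s b \<otimes>\<^bsub>V,L\<^esub> d b) = (\<Sum>b\<in>B. eval2 V t b \<otimes>\<^bsub>V,L\<^esub> d b)"
    using eq expand_id(2)[OF D] by simp
  then show ?thesis unfolding tensor_dual_expand[OF V D s] tensor_dual_expand[OF V D t] .
qed

lemma tensor_dual_dual_eqI:
  assumes s: "s \<in> vcar (tensor_vs L L)" and t: "t \<in> vcar (tensor_vs L L)"
    and eq: "\<And>h k. h \<in> vcar H \<Longrightarrow> k \<in> vcar H \<Longrightarrow>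
      tsum L L s (\<lambda>\<omega> \<omega>'. \<omega> h * \<omega>' k) = tsum L L t (\<lambda>\<omega> \<omega>'. \<omega> h * \<omega>' k)"
  shows "s = t"
proof (rule tensor_dual_eqI[OF dual_vs s t], rule ext)
  fix k h assume k: "k \<in> vcar H"
  have e: "eval2 L r k h = tsum L L r (\<lambda>\<omega> \<omega>'. \<omega> h * \<omega>' k)" if "r \<in> vcar (tensor_vs L L)" for r
    unfolding eval2_def tsum_apply by (simp add: pscale_def mult.commute)
  show "eval2 L s k h = eval2 L t k h"
  proof (cases "h \<in> vcar H")
    case True
    then show ?thesis using eq[OF True k] s t by (simp add: e)
  next
    case False
    have "eval2 L s k \<in> vcar L" "eval2 L t k \<in> vcar L"
      using lin_mapD(1)[OF lin_eval2[OF dual_vs k]] s t by blast+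
    then show ?thesis using False by simp
  qed
qed

lemma eval_dual_bilin:
  assumes "h \<in> vcar H" "k \<in> vcar H"
  shows "bilin_map L L ground_vs (\<lambda>\<omega> \<omega>'. \<omega> h * \<omega>' k)"
  using assms by (intro bilin_mapI lin_times_left lin_eval_at)

text \<open>The element \<open>\<Sum>\<^sub>b \<theta>(- b) \<otimes> d\<^sub>b\<close> solves the equations that determine the coproduct of \<open>\<theta>\<close>, and
  evaluations at pairs separate the elements of \<open>L \<otimes> L\<close>.\<close>

lemma comult_dual:
  assumes \<theta>: "\<theta> \<in> vcar L"
  shows comult_dual_in: "comult L \<theta> \<in> vcar (tensor_vs L L)"
    and comult_dual_eval: "h \<in> vcar H \<Longrightarrow> k \<in> vcar H \<Longrightarrow>
      tsum L L (comult L \<theta>) (\<lambda>\<omega> \<omega>'. \<omega> h * \<omega>' k) = \<theta> (h \<bullet> k)"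
proof -
  obtain B d where D: "dual_bases H L (\<lambda>h \<theta>. \<theta> h) B d" using ex_dual_bases by blast
  note b = expand_id[OF D]
  let ?w = "\<lambda>b. restr (\<lambda>h. \<theta> (h \<bullet> b))"
  have w: "?w b \<in> vcar L" if "b \<in> B" for b
    using b(2)[OF that] \<theta> by (auto simp: lin_restr intro!: lin_comp[of H ground_vs \<theta>] lin_rules)
  let ?t = "\<Sum>b\<in>B. ?w b \<otimes>\<^bsub>L,L\<^esub> d b"
  have t: "?t \<in> vcar (tensor_vs L L)"
    by (intro sum_in is_vspace_tensor_vs ten_in dual_vs w b(3))
  have ev: "tsum L L ?t (\<lambda>\<omega> \<omega>'. \<omega> h * \<omega>' k) = \<theta> (h \<bullet> k)" if h: "h \<in> vcar H" and k: "k \<in> vcar H" for h k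
  proof -
    have "tsum L L ?t (\<lambda>\<omega> \<omega>'. \<omega> h * \<omega>' k) = (\<Sum>b\<in>B. tsum L L (?w b \<otimes>\<^bsub>L,L\<^esub> d b) (\<lambda>\<omega> \<omega>'. \<omega> h * \<omega>' k))"
      by (intro lin_map_sum[OF is_vspace_tensor_vs lin_tsum[OF dual_vs dual_vs is_vspace_ground eval_dual_bilin[OF h k]]]
          ten_in dual_vs w b(3))
    also have "\<dots> = (\<Sum>b\<in>B. ?w b h * d b k)"
      by (intro sum.cong refl tsum_pure[OF dual_vs dual_vs is_vspace_ground eval_dual_bilin[OF h k]] w b(3))
    also have "\<dots> = (\<Sum>b\<in>B. d b k * \<theta> (h \<bullet> b))"
      using h by (simp add: mult.commute)
    also have "\<dots> = \<theta> (h \<bullet> k)"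
      using h k \<theta> by (intro expand_ground[OF D]) (auto intro!: lin_comp[of H ground_vs \<theta>] lin_rules)
    finally show ?thesis .
  qed
  define D' where "D' = \<lparr>vcar = vcar L, vscale = pscale\<rparr>"
  have D': "tensor_vs D' D' = tensor_vs L L" "tlift D' D' = tlift L L"
    by (rule tensor_vs_cong tlift_cong; simp add: D'_def)+
  have tl: "tlift L L (\<lambda>\<omega> \<omega>'. \<omega> h * \<omega>' k) s = tsum L L s (\<lambda>\<omega> \<omega>'. \<omega> h * \<omega>' k)"
    if "s \<in> vcar (tensor_vs L L)" "h \<in> vcar H" "k \<in> vcar H" for s h k
    by (rule tlift_tsum[OF dual_vs dual_vs that(1) is_vspace_ground eval_dual_bilin[OF that(2,3)]])
  have "comult L \<theta> = (THE t. t \<in> vcar (tensor_vs L L) \<and>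
       (\<forall>k\<in>vcar H. \<forall>k'\<in>vcar H. tlift L L (\<lambda>\<omega> \<omega>'. \<omega> k * \<omega>' k') t = \<theta> (k \<bullet> k')))"
    unfolding D'(1)[symmetric] D'(2)[symmetric] by (simp add: hopf_dual_def Let_def D'_def)
  also have "\<dots> = ?t"
  proof (rule the_equality)
    show "?t \<in> vcar (tensor_vs L L) \<and>
       (\<forall>k\<in>vcar H. \<forall>k'\<in>vcar H. tlift L L (\<lambda>\<omega> \<omega>'. \<omega> k * \<omega>' k') ?t = \<theta> (k \<bullet> k'))"
      using t by (auto simp: tl ev simp del: dual_simps)
    fix s assume s: "s \<in> vcar (tensor_vs L L) \<and>
       (\<forall>k\<in>vcar H. \<forall>k'\<in>vcar H. tlift L L (\<lambda>\<omega> \<omega>'. \<omega> k * \<omega>' k') s = \<theta> (k \<bullet> k'))"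
    then have sin: "s \<in> vcar (tensor_vs L L)" by blast
    show "s = ?t"
    proof (rule tensor_dual_dual_eqI[OF sin t])
      fix h k assume hk: "h \<in> vcar H" "k \<in> vcar H"
      have "tsum L L s (\<lambda>\<omega> \<omega>'. \<omega> h * \<omega>' k) = \<theta> (h \<bullet> k)"
        unfolding tl[OF sin hk, symmetric] using s hk by blast
      then show "tsum L L s (\<lambda>\<omega> \<omega>'. \<omega> h * \<omega>' k) = tsum L L ?t (\<lambda>\<omega> \<omega>'. \<omega> h * \<omega>' k)"
        unfolding ev[OF hk] .
    qed
  qed
  finally have c: "comult L \<theta> = ?t" .
  show "comult L \<theta> \<in> vcar (tensor_vs L L)" unfolding c by (rule t)
  show "h \<in> vcar H \<Longrightarrow> k \<in> vcar H \<Longrightarrow> tsum L L (comult L \<theta>) (\<lambda>\<omega> \<omega>'. \<omega> h * \<omega>' k) = \<theta> (h \<bullet> k)"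
    unfolding c by (rule ev)
qed

lemma lin_comult_dual: "lin_map L (tensor_vs L L) (comult L)"
proof (rule lin_mapI)
  note lt = lin_tsum[OF dual_vs dual_vs is_vspace_ground eval_dual_bilin]
  note car = is_vspace_carrier[OF dual_vs] is_vspace_carrier[OF is_vspace_tensor_vs]
  fix \<theta> assume \<theta>: "\<theta> \<in> vcar L"
  then show "comult L \<theta> \<in> vcar (tensor_vs L L)" by (rule comult_dual_in)
  show "comult L (vscale L c \<theta>) = vscale (tensor_vs L L) c (comult L \<theta>)" for c
  proof (rule tensor_dual_dual_eqI)
    fix h k assume hk: "h \<in> vcar H" "k \<in> vcar H"
    show "tsum L L (comult L (vscale L c \<theta>)) (\<lambda>\<omega> \<omega>'. \<omega> h * \<omega>' k)
      = tsum L L (vscale (tensor_vs L L) c (comult L \<theta>)) (\<lambda>\<omega> \<omega>'. \<omega> h * \<omega>' k)"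
      unfolding comult_dual_eval[OF car(3)[OF \<theta>] hk] lin_mapD(3)[OF lt[OF hk] comult_dual_in[OF \<theta>]]
        comult_dual_eval[OF \<theta> hk] by (simp add: pscale_def ground_vs_def)
  qed (intro comult_dual_in car \<theta>)+
  fix \<omega> assume \<omega>: "\<omega> \<in> vcar L"
  show "comult L (\<theta> + \<omega>) = comult L \<theta> + comult L \<omega>"
  proof (rule tensor_dual_dual_eqI)
    fix h k assume hk: "h \<in> vcar H" "k \<in> vcar H"
    show "tsum L L (comult L (\<theta> + \<omega>)) (\<lambda>\<omega> \<omega>'. \<omega> h * \<omega>' k)
      = tsum L L (comult L \<theta> + comult L \<omega>) (\<lambda>\<omega> \<omega>'. \<omega> h * \<omega>' k)"
      unfolding comult_dual_eval[OF car(2)[OF \<theta> \<omega>] hk]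
        lin_mapD(2)[OF lt[OF hk] comult_dual_in[OF \<theta>] comult_dual_in[OF \<omega>]]
        comult_dual_eval[OF \<theta> hk] comult_dual_eval[OF \<omega> hk] by simp
  qed (intro comult_dual_in car \<theta> \<omega>)+
qed

lemma comult_dual_one: "comult L \<one>\<^bsub>L\<^esub> = \<one>\<^bsub>L\<^esub> \<otimes>\<^bsub>L,L\<^esub> \<one>\<^bsub>L\<^esub>"
proof (rule tensor_dual_dual_eqI)
  note o = algebraD(3)[OF algebra_dual]
  show "comult L \<one>\<^bsub>L\<^esub> \<in> vcar (tensor_vs L L)" "\<one>\<^bsub>L\<^esub> \<otimes>\<^bsub>L,L\<^esub> \<one>\<^bsub>L\<^esub> \<in> vcar (tensor_vs L L)"
    by (intro comult_dual_in ten_in dual_vs o)+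
  fix h k assume hk: "h \<in> vcar H" "k \<in> vcar H"
  show "tsum L L (comult L \<one>\<^bsub>L\<^esub>) (\<lambda>\<omega> \<omega>'. \<omega> h * \<omega>' k) = tsum L L (\<one>\<^bsub>L\<^esub> \<otimes>\<^bsub>L,L\<^esub> \<one>\<^bsub>L\<^esub>) (\<lambda>\<omega> \<omega>'. \<omega> h * \<omega>' k)"
    unfolding comult_dual_eval[OF o hk] tsum_pure[OF dual_vs dual_vs is_vspace_ground eval_dual_bilin[OF hk] o o]
    using hk by (simp add: counit_mult)
qed

lemma comult_dual_antipode:
  assumes \<theta>: "\<theta> \<in> vcar L"
  shows "comult L (antipode L \<theta>) = tsum L L (comult L \<theta>) (\<lambda>a b. antipode L b \<otimes>\<^bsub>L,L\<^esub> antipode L a)"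
proof (rule tensor_dual_dual_eqI)
  note Sin = lin_mapD(1)[OF lin_antipode_dual]
  show "comult L (antipode L \<theta>) \<in> vcar (tensor_vs L L)"
    by (intro comult_dual_in Sin \<theta>)
  show "tsum L L (comult L \<theta>) (\<lambda>a b. antipode L b \<otimes>\<^bsub>L,L\<^esub> antipode L a) \<in> vcar (tensor_vs L L)"
    by (intro tsum_in[OF dual_vs dual_vs comult_dual_in[OF \<theta>] is_vspace_tensor_vs] ten_in dual_vs Sin)
  fix h k assume hk: "h \<in> vcar H" "k \<in> vcar H"
  have "tsum L L (tsum L L (comult L \<theta>) (\<lambda>a b. antipode L b \<otimes>\<^bsub>L,L\<^esub> antipode L a)) (\<lambda>\<omega> \<omega>'. \<omega> h * \<omega>' k)
    = tsum L L (comult L \<theta>) (\<lambda>a b. tsum L L (antipode L b \<otimes>\<^bsub>L,L\<^esub> antipode L a) (\<lambda>\<omega> \<omega>'. \<omega> h * \<omega>' k))"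
    by (intro tsum_tsum[OF dual_vs dual_vs comult_dual_in[OF \<theta>] dual_vs dual_vs is_vspace_ground eval_dual_bilin[OF hk]]
        ten_in dual_vs Sin)
  also have "\<dots> = tsum L L (comult L \<theta>) (\<lambda>a b. antipode L b h * antipode L a k)"
    by (intro tsum_cong[OF dual_vs dual_vs comult_dual_in[OF \<theta>]]
        tsum_pure[OF dual_vs dual_vs is_vspace_ground eval_dual_bilin[OF hk]] Sin)
  also have "\<dots> = tsum L L (comult L \<theta>) (\<lambda>\<omega> \<omega>'. \<omega> (antipode H k) * \<omega>' (antipode H h))"
    using hk by (simp add: mult.commute)
  also have "\<dots> = \<theta> (antipode H (h \<bullet> k))"
    using hk by (simp add: comult_dual_eval[OF \<theta>] antipode_mult)
  also have "\<dots> = tsum L L (comult L (antipode L \<theta>)) (\<lambda>\<omega> \<omega>'. \<omega> h * \<omega>' k)"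
    unfolding comult_dual_eval[OF Sin[OF \<theta>] hk] using hk by simp
  finally show "tsum L L (comult L (antipode L \<theta>)) (\<lambda>\<omega> \<omega>'. \<omega> h * \<omega>' k)
    = tsum L L (tsum L L (comult L \<theta>) (\<lambda>a b. antipode L b \<otimes>\<^bsub>L,L\<^esub> antipode L a)) (\<lambda>\<omega> \<omega>'. \<omega> h * \<omega>' k)" ..
qed

lemma pairing_dual: "pairing H L (\<lambda>h \<theta>. \<theta> h)"
  by unfold_locales
    (use alg algebra_dual lin_comult comult_one lin_comult_dual comult_dual_one bilin_evaluation[of H]
      lin_antipode_dual antipode_dual_bij comult_dual_antipode in \<open>auto simp del: dual_ops(2) dual_simps\<close>)

lemma pairing_dual_flip: "pairing L H (\<lambda>\<theta> h. \<theta> h)"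
proof -
  have "bilin_map L H ground_vs (\<lambda>\<theta> h. \<theta> h)"
    using bilin_evaluation[of H] by (simp add: bilin_map_def)
  then show ?thesis
    by unfold_locales
      (use alg algebra_dual lin_comult comult_one lin_comult_dual comult_dual_one 
        lin_antipode antipode_bij comult_antipode in \<open>auto simp del: dual_ops(2) dual_simps\<close>)
qed

text \<open>Under \<open>eval2\<close> the canonical element is the identity map and the product is convolution with values in
  \<open>H\<^sup>o\<^sup>p\<close>.  The inverse of the antipode is a convolution inverse: applying \<open>S\<close> to \<open>S\<inverse>(h\<^sub>2) h\<^sub>1\<close>
  gives \<open>S(h\<^sub>1) h\<^sub>2\<close>.\<close>

lemma canonical_elt_invertible: "\<exists>V. is_inverse (tensor_alg (hopf_op H) L) (canonical_elt (hopf_op H) L (\<lambda>h \<theta>. \<theta> h)) V"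
proof -
  let ?A = "tensor_alg (hopf_op H) L" and ?R = "inv_into (vcar H) (antipode H)"
  obtain B d where D: "dual_bases H L (\<lambda>h \<theta>. \<theta> h) B d" using ex_dual_bases by blast
  note b = expand_id[OF D]
  note sp = tensor_op_space
  have vop: "is_vspace (hopf_op H)" using algebraD(1)[OF algebra_hopf_op[OF alg]] .
  have R: "?R h \<in> vcar H" "antipode H (?R h) = h" "?R (antipode H h) = h" if "h \<in> vcar H" for h
    using that antipode_surj antipode_inj by (auto simp: inv_into_into f_inv_into_f)
  have D': "dual_bases (hopf_op H) L (\<lambda>h \<theta>. \<theta> h) B d" using D by (simp add: dual_bases_def)
  have bil: "bilin_map (hopf_op H) L ground_vs (\<lambda>h \<theta>. \<theta> h)"
    using bilin_evaluation[of H] by (simp add: bilin_map_def lin_map_def)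
  have U: "canonical_elt (hopf_op H) L (\<lambda>h \<theta>. \<theta> h) = (\<Sum>b\<in>B. b \<otimes>\<^bsub>H,L\<^esub> d b)" (is "?U = _")
    unfolding canonical_elt_eq[OF vop dual_vs bil D'] sp ..
  define V where "V = (\<Sum>b\<in>B. ?R b \<otimes>\<^bsub>H,L\<^esub> d b)"
  have Uin: "?U \<in> vcar (tensor_vs H L)" and Vin: "V \<in> vcar (tensor_vs H L)"
    unfolding U V_def by (intro sum_in is_vspace_tensor_vs ten_in vs dual_vs b R; assumption)+
  have lR: "lin_map H H ?R" by (rule lin_inv_into[OF vs lin_antipode antipode_bij])
  have ev_sum: "eval2 H (\<Sum>b\<in>B. F b \<otimes>\<^bsub>H,L\<^esub> d b) h = F h" if F: "lin_map H H F" and h: "h \<in> vcar H" for F h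
  proof -
    have "eval2 H (\<Sum>b\<in>B. F b \<otimes>\<^bsub>H,L\<^esub> d b) h = (\<Sum>b\<in>B. eval2 H (F b \<otimes>\<^bsub>H,L\<^esub> d b) h)"
      by (intro lin_map_sum[OF is_vspace_tensor_vs lin_eval2[OF vs h]] ten_in vs dual_vs b lin_mapD(1)[OF F])
    also have "\<dots> = (\<Sum>b\<in>B. vscale H (d b h) (F b))"
      by (intro sum.cong refl eval2_ten vs h b lin_mapD(1)[OF F])
    also have "\<dots> = F h" by (rule expand[OF D F h])
    finally show ?thesis .
  qed
  note bA = bilin_algebra[OF algebra_hopf_op[OF alg]] bilin_algebra[OF algebra_dual]
  note lA = bilin_mapD(1,2)[OF tensor_mult_bilin_map[OF bA], unfolded sp]
  note A_in = algebraD(7)[OF algebra_op_tensor[OF alg algebra_dual], simplified, unfolded sp]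
  \<comment> \<open>Evaluating the second leg turns the product into the convolution product with values in the opposite algebra.\<close>
  have ev_mult: "eval2 H (s \<cdot>\<^bsub>?A\<^esub> t) h = sw h (\<lambda>a b. eval2 H t b \<bullet> eval2 H s a)"
    if s: "s \<in> vcar (tensor_vs H L)" and t: "t \<in> vcar (tensor_vs H L)" and h: "h \<in> vcar H" for s t h
  proof -
    note le = lin_eval2[OF vs h]
    have l1: "lin_map (tensor_vs H L) H (\<lambda>s. sw h (\<lambda>a b. eval2 H t b \<bullet> eval2 H s a))"
      if "t \<in> vcar (tensor_vs H L)" for t
      using that h by (intro lin_sw_param vs lin_mult_right[OF balg] lin_eval2) (simp_all add: lin_mapD(1)[OF lin_eval2[OF vs]])
    have l2: "lin_map (tensor_vs H L) H (\<lambda>t. sw h (\<lambda>a b. eval2 H t b \<bullet> eval2 H s a))"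
      if "s \<in> vcar (tensor_vs H L)" for s
      using that h by (intro lin_sw_param vs lin_mult_left[OF balg] lin_eval2) (simp_all add: lin_mapD(1)[OF lin_eval2[OF vs]])
    show ?thesis
    proof (rule lin_map_tensor_eq[OF vs dual_vs lin_comp[OF le lA(2)[OF t]] l1[OF t] _ s])
      fix k \<theta> assume k: "k \<in> vcar H" and \<theta>: "\<theta> \<in> vcar L"
      note kt = ten_in[OF vs dual_vs k \<theta>]
      show "eval2 H ((k \<otimes>\<^bsub>H,L\<^esub> \<theta>) \<cdot>\<^bsub>?A\<^esub> t) h = sw h (\<lambda>a b. eval2 H t b \<bullet> eval2 H (k \<otimes>\<^bsub>H,L\<^esub> \<theta>) a)"
      proof (rule lin_map_tensor_eq[OF vs dual_vs lin_comp[OF le lA(1)[OF kt]] l2[OF kt] _ t])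
        fix l \<omega> assume l: "l \<in> vcar H" and \<omega>: "\<omega> \<in> vcar L"
        have "(k \<otimes>\<^bsub>H,L\<^esub> \<theta>) \<cdot>\<^bsub>?A\<^esub> (l \<otimes>\<^bsub>H,L\<^esub> \<omega>) = (l \<bullet> k) \<otimes>\<^bsub>H,L\<^esub> (\<theta> \<cdot>\<^bsub>L\<^esub> \<omega>)"
          using tensor_mult_ten[OF bA, unfolded sp, of k \<theta> l \<omega>] k l \<theta> \<omega> by (simp del: dual_simps)
        then have "eval2 H ((k \<otimes>\<^bsub>H,L\<^esub> \<theta>) \<cdot>\<^bsub>?A\<^esub> (l \<otimes>\<^bsub>H,L\<^esub> \<omega>)) h = vscale H ((\<theta> \<cdot>\<^bsub>L\<^esub> \<omega>) h) (l \<bullet> k)"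
          using eval2_ten[OF vs h] k l algebraD(7)[OF algebra_dual \<theta> \<omega>] by (simp del: dual_simps)
        also have "\<dots> = vscale H (sw h (\<lambda>a b. \<theta> a * \<omega> b)) (l \<bullet> k)"
          using h by (simp add: dual_mult[OF \<theta> \<omega>])
        also have "\<dots> = sw h (\<lambda>a b. vscale H (\<theta> a * \<omega> b) (l \<bullet> k))"
          using h k l
          by (intro lin_map_sw[where U = ground_vs and U' = H and f = "\<lambda>s. vscale H s (l \<bullet> k)"] lin_scale_left lin_id
              is_vspace_ground vs) (auto simp: ground_vs_def)
        also have "\<dots> = sw h (\<lambda>a b. eval2 H (l \<otimes>\<^bsub>H,L\<^esub> \<omega>) b \<bullet> eval2 H (k \<otimes>\<^bsub>H,L\<^esub> \<theta>) a)"
          using h k l \<theta> \<omega>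
          by (intro sw_cong) (auto simp: eval2_ten[OF vs] mult(6,7) carrier vscale_laws[OF vs] simp del: dual_simps)
        finally show "eval2 H ((k \<otimes>\<^bsub>H,L\<^esub> \<theta>) \<cdot>\<^bsub>?A\<^esub> (l \<otimes>\<^bsub>H,L\<^esub> \<omega>)) h
          = sw h (\<lambda>a b. eval2 H (l \<otimes>\<^bsub>H,L\<^esub> \<omega>) b \<bullet> eval2 H (k \<otimes>\<^bsub>H,L\<^esub> \<theta>) a)" .
      qed
    qed
  qed
  have one: "eval2 H (\<one>\<^bsub>H\<^esub> \<otimes>\<^bsub>H,L\<^esub> \<one>\<^bsub>L\<^esub>) h = vscale H (counit H h) \<one>\<^bsub>H\<^esub>" if "h \<in> vcar H" for h
    using eval2_ten[OF vs that one_in algebraD(3)[OF algebra_dual]] that by simp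
  have evU: "eval2 H ?U h = h" and evV: "eval2 H V h = ?R h" if "h \<in> vcar H" for h
    using ev_sum[OF lin_id that] ev_sum[OF lR that] by (simp_all add: U V_def)
  have Sinj: "x = y" if "x \<in> vcar H" "y \<in> vcar H" "antipode H x = antipode H y" for x y
    using that antipode_inj by (auto dest: inj_onD)
  have S_one: "antipode H (vscale H (counit H h) \<one>\<^bsub>H\<^esub>) = vscale H (counit H h) \<one>\<^bsub>H\<^esub>" for h
    using lin_mapD(3)[OF lin_antipode one_in] by (simp add: antipode_one)
  have UV: "?U \<cdot>\<^bsub>?A\<^esub> V = \<one>\<^bsub>H\<^esub> \<otimes>\<^bsub>H,L\<^esub> \<one>\<^bsub>L\<^esub>"
  proof (rule tensor_dual_eqI[OF vs A_in[OF Uin Vin]])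
    fix h assume h: "h \<in> vcar H"
    have "antipode H (sw h (\<lambda>a b. ?R b \<bullet> a)) = sw h (\<lambda>a b. antipode H (?R b \<bullet> a))"
      using h R by (intro lin_map_sw[OF lin_antipode h vs]) auto
    also have "\<dots> = sw h (\<lambda>a b. antipode H a \<bullet> b)"
      using h R by (intro sw_cong) (auto simp: antipode_mult)
    also have "\<dots> = antipode H (vscale H (counit H h) \<one>\<^bsub>H\<^esub>)"
      using antipode_left[OF h lin_id] S_one by simp
    finally have "sw h (\<lambda>a b. ?R b \<bullet> a) = vscale H (counit H h) \<one>\<^bsub>H\<^esub>"
      by (rule Sinj[rotated 2]) (rule sw_in[OF vs h] mult_in R(1) carrier(3) one_in | assumption)+
    moreover have "eval2 H (?U \<cdot>\<^bsub>?A\<^esub> V) h = sw h (\<lambda>a b. ?R b \<bullet> a)"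
      unfolding ev_mult[OF Uin Vin h] using h by (intro sw_cong) (auto simp: evU evV)
    ultimately show "eval2 H (?U \<cdot>\<^bsub>?A\<^esub> V) h = eval2 H (\<one>\<^bsub>H\<^esub> \<otimes>\<^bsub>H,L\<^esub> \<one>\<^bsub>L\<^esub>) h"
      using h by (simp only: one)
  qed (intro ten_in vs dual_vs one_in algebraD(3)[OF algebra_dual])
  have VU: "V \<cdot>\<^bsub>?A\<^esub> ?U = \<one>\<^bsub>H\<^esub> \<otimes>\<^bsub>H,L\<^esub> \<one>\<^bsub>L\<^esub>"
  proof (rule tensor_dual_eqI[OF vs A_in[OF Vin Uin]])
    fix h assume h: "h \<in> vcar H"
    have "antipode H (sw h (\<lambda>a b. b \<bullet> ?R a)) = sw h (\<lambda>a b. antipode H (b \<bullet> ?R a))"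
      using h R by (intro lin_map_sw[OF lin_antipode h vs]) auto
    also have "\<dots> = sw h (\<lambda>a b. a \<bullet> antipode H b)"
      using h R by (intro sw_cong) (auto simp: antipode_mult)
    also have "\<dots> = antipode H (vscale H (counit H h) \<one>\<^bsub>H\<^esub>)"
      using antipode_right[OF h lin_id] S_one by simp
    finally have "sw h (\<lambda>a b. b \<bullet> ?R a) = vscale H (counit H h) \<one>\<^bsub>H\<^esub>"
      by (rule Sinj[rotated 2]) (rule sw_in[OF vs h] mult_in R(1) carrier(3) one_in | assumption)+
    moreover have "eval2 H (V \<cdot>\<^bsub>?A\<^esub> ?U) h = sw h (\<lambda>a b. b \<bullet> ?R a)"
      unfolding ev_mult[OF Vin Uin h] using h by (intro sw_cong) (auto simp: evU evV)
    ultimately show "eval2 H (V \<cdot>\<^bsub>?A\<^esub> ?U) h = eval2 H (\<one>\<^bsub>H\<^esub> \<otimes>\<^bsub>H,L\<^esub> \<one>\<^bsub>L\<^esub>) h"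
      using h by (simp only: one)
  qed (intro ten_in vs dual_vs one_in algebraD(3)[OF algebra_dual])
  have "is_inverse ?A ?U V"
    using Uin Vin UV VU by (simp add: is_inverse_def sp del: dual_ops)
  then show ?thesis by blast
qed

end

section \<open>Opposite Yetter--Drinfeld algebras\<close>

lemma tflip_space_cong:
  assumes "vcar V = vcar A" "vscale V = vscale A" "vcar W = vcar B" "vscale W = vscale B"
  shows "tflip V W = tflip A B"
  unfolding tflip_def fun_eq_iff
  by (simp add: tlift_cong[OF assms] ten_cong[OF assms(3,4,1,2)])

lemma tassoc_space_cong:
  assumes "vcar U = vcar A" "vscale U = vscale A" "vcar V = vcar B" "vscale V = vscale B"
    "vcar W = vcar C" "vscale W = vscale C"
  shows "tassoc U V W = tassoc A B C" "tassoc_inv U V W = tassoc_inv A B C"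
proof -
  have t: "tensor_vs U V = tensor_vs A B" "tensor_vs V W = tensor_vs B C"
    by (rule tensor_vs_cong; simp add: assms)+
  have l: "tlift U V = tlift A B" "tlift (tensor_vs A B) W = tlift (tensor_vs A B) C"
    "tlift V W = tlift B C" "tlift U (tensor_vs B C) = tlift A (tensor_vs B C)"
    by (rule tlift_cong; simp add: assms)+
  have n: "x \<otimes>\<^bsub>U,tensor_vs B C\<^esub> y = x \<otimes>\<^bsub>A,tensor_vs B C\<^esub> y" for x y
    by (rule ten_cong; simp add: assms)
  have n2: "x \<otimes>\<^bsub>V,W\<^esub> y = x \<otimes>\<^bsub>B,C\<^esub> y" for x y by (rule ten_cong; simp add: assms)
  have n3: "x \<otimes>\<^bsub>tensor_vs A B,W\<^esub> y = x \<otimes>\<^bsub>tensor_vs A B,C\<^esub> y" for x y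
    by (rule ten_cong; simp add: assms)
  have n4: "x \<otimes>\<^bsub>U,V\<^esub> y = x \<otimes>\<^bsub>A,B\<^esub> y" for x y by (rule ten_cong; simp add: assms)
  show "tassoc U V W = tassoc A B C" "tassoc_inv U V W = tassoc_inv A B C"
    unfolding tassoc_def tassoc_inv_def t l n n2 n3 n4 by simp_all
qed

text \<open>Opposite algebras have the same underlying spaces, so they are eliminated from all the structure maps
  except the conjugation, the only one that involves a product.\<close>

lemma yetter_drinfeld_iff:
  fixes K :: "('k::field, 'a::ab_group_add, 'm) hopf_scheme"
    and L :: "('k, 'b::ab_group_add, 'n) hopf_scheme"
    and Y Y' :: "('k, 'y::ab_group_add, 'q) alg_scheme"
  assumes Y: "vcar Y' = vcar Y" "vscale Y' = vscale Y"
    and eq: "\<And>y. y \<in> vcar Y \<Longrightarrow> \<alpha>' y = \<alpha> y" "\<And>y. y \<in> vcar Y \<Longrightarrow> \<beta>' y = \<beta> y"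
    and co: "left_coaction (hopf_op K) Y' \<alpha>'" "left_coaction L Y' \<beta>'"
  shows "yetter_drinfeld K L p Y' \<alpha>' \<beta>' \<longleftrightarrow>
    (\<forall>y\<in>vcar Y. tmap L Y L (tensor_vs K Y) id \<alpha> (\<beta> y)
      = tassoc L K Y (tmap (tensor_vs K L) Y (tensor_vs L K) Y (tflip K L) id
          (tmap (tensor_vs K L) Y (tensor_vs K L) Y
            (alg_Ad (tensor_alg (hopf_op K) L) (canonical_elt (hopf_op K) L p)) id
            (tassoc_inv K L Y (tmap K Y K (tensor_vs L Y) id \<beta> (\<alpha> y))))))"
proof -
  let ?A = "tensor_alg (hopf_op K) L" and ?T = "tensor_vs K L"
  have tv: "tensor_vs (hopf_op K) L = ?T" "tensor_vs (hopf_op K) Y' = tensor_vs K Y" "tensor_vs L Y' = tensor_vs L Y"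
    "tensor_vs L (hopf_op K) = tensor_vs L K"
    by (rule tensor_vs_cong; simp add: Y)+
  have fl: "tflip (hopf_op K) L = tflip K L" by (rule tflip_space_cong) simp_all
  have as: "tassoc L (hopf_op K) Y' = tassoc L K Y" "tassoc_inv (hopf_op K) L Y' = tassoc_inv K L Y"
    by (rule tassoc_space_cong; simp add: Y)+
  have "tmap L Y' L (tensor_vs K Y) id \<alpha>' (\<beta>' y) = tmap L Y L (tensor_vs K Y) id \<alpha> (\<beta> y)"
    "tmap (hopf_op K) Y' (hopf_op K) (tensor_vs L Y) id \<beta>' (\<alpha>' y) = tmap K Y K (tensor_vs L Y) id \<beta> (\<alpha> y)"
    if "y \<in> vcar Y" for y
  proof -
    have "tmap L Y' L (tensor_vs K Y) id \<alpha>' (\<beta>' y) = tmap L Y L (tensor_vs K Y) id \<alpha>' (\<beta>' y)"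
      by (rule tmap_space_cong) (simp_all add: Y)
    then show "tmap L Y' L (tensor_vs K Y) id \<alpha>' (\<beta>' y) = tmap L Y L (tensor_vs K Y) id \<alpha> (\<beta> y)"
      using tmap_fun_cong[of L id id Y \<alpha>' \<alpha> L "tensor_vs K Y" "\<beta> y"] eq that by simp
    have "tmap (hopf_op K) Y' (hopf_op K) (tensor_vs L Y) id \<beta>' (\<alpha>' y) = tmap K Y K (tensor_vs L Y) id \<beta>' (\<alpha>' y)"
      by (rule tmap_space_cong) (simp_all add: Y)
    then show "tmap (hopf_op K) Y' (hopf_op K) (tensor_vs L Y) id \<beta>' (\<alpha>' y) = tmap K Y K (tensor_vs L Y) id \<beta> (\<alpha> y)"
      using tmap_fun_cong[of K id id Y \<beta>' \<beta> K "tensor_vs L Y" "\<alpha> y"] eq that by simp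
  qed
  moreover have "tmap ?A Y' (tensor_vs L K) Y' f id t = tmap ?T Y (tensor_vs L K) Y f id t"
    "tmap ?A Y' ?A Y' g id s = tmap ?T Y ?T Y g id s" for f g t s
    by (rule tmap_space_cong; simp add: Y tv)+
  ultimately show ?thesis
    using co by (simp add: yetter_drinfeld_def Let_def Y tv fl as)
qed

context fd_hopf_alg
begin

context
  fixes X :: "('a, 'x::ab_group_add) alg"
    and \<alpha> :: "'x \<Rightarrow> ('a, 'b, 'x) tensor"
    and \<beta> :: "'x \<Rightarrow> ('a, 'b \<Rightarrow> 'a, 'x) tensor"
  assumes X: "algebra X"
    and \<alpha>: "left_coaction (hopf_op H) X \<alpha>"
    and \<beta>: "left_coaction L X \<beta>"
begin

lemma lin_alpha: "lin_map X (tensor_vs H X) \<alpha>"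
proof -
  have "tensor_vs (hopf_op H) X = tensor_vs H X" by (rule tensor_vs_cong) simp_all
  then show ?thesis using \<alpha> by (simp add: left_coaction_def alg_hom_def lin_map_tensor_alg)
qed

lemma lin_beta: "lin_map X (tensor_vs L X) \<beta>"
  using \<beta> by (simp add: left_coaction_def alg_hom_def lin_map_tensor_alg)

lemma alpha_in: "x \<in> vcar X \<Longrightarrow> \<alpha> x \<in> vcar (tensor_vs H X)"
  and beta_in: "x \<in> vcar X \<Longrightarrow> \<beta> x \<in> vcar (tensor_vs L X)"
  using lin_mapD(1)[OF lin_alpha] lin_mapD(1)[OF lin_beta] by auto

lemma beta_op_eq:
  assumes x: "x \<in> vcar X"
  shows "beta_op H X \<beta> x = \<beta> x"
proof -
  have bij: "bij_betw (antipode L) (vcar L) (vcar L)" by (rule antipode_dual_bij)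
  have 1: "coop_coaction L X \<beta> x = tmap L X L X (antipode L) id (\<beta> x)"
    unfolding coop_coaction_def by (rule tmap_space_cong) simp_all
  have 2: "beta_op H X \<beta> x
      = tmap L X L X (inv_into (vcar L) (antipode L)) id (coop_coaction L X \<beta> x)"
    unfolding beta_op_def by (rule tmap_space_cong) simp_all
  show ?thesis
    unfolding 2 1
    by (rule tmap_inverse[OF dual_vs algebraD(1)[OF X] dual_vs algebraD(1)[OF X] lin_antipode_dual
        lin_id[folded id_def] lin_inv_into[OF dual_vs lin_antipode_dual bij] lin_id[folded id_def]
        _ _ beta_in[OF x]]) (erule bij_betw_inv_into_left[OF bij], simp)
qed

lemma alpha_op_eq:
  assumes x: "x \<in> vcar X"
  shows "alpha_op H X \<alpha> x = \<alpha> x"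
proof -
  let ?R = "inv_into (vcar H) (antipode H)"
  have 1: "coop_coaction (hopf_op H) X \<alpha> x = tmap H X H X ?R id (\<alpha> x)"
    unfolding coop_coaction_def by (subst tmap_space_cong[of _ H _ X _ H _ X]) (simp_all add: hopf_op_def)
  have 2: "alpha_op H X \<alpha> x = tmap H X H X (antipode H) id (coop_coaction (hopf_op H) X \<alpha> x)"
    unfolding alpha_op_def by (rule tmap_space_cong) simp_all
  show ?thesis
    unfolding 2 1
    by (rule tmap_inverse[OF vs algebraD(1)[OF X] vs algebraD(1)[OF X] lin_inv_into[OF vs lin_antipode antipode_bij]
        lin_id[folded id_def] lin_antipode lin_id[folded id_def] _ _ alpha_in[OF x]])
      (erule bij_betw_inv_into_right[OF antipode_bij], simp)
qed

lemma beta_op_coaction: "left_coaction (hopf_op L) (alg_op X) (beta_op H X \<beta>)"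
  by (rule left_coaction_op[OF algebra_dual X \<beta>]) (simp_all add: beta_op_eq del: dual_simps dual_ops)

lemma alpha_op_coaction: "left_coaction H (alg_op X) (alpha_op H X \<alpha>)"
  by (rule left_coaction_op[OF algebra_hopf_op[OF alg] X \<alpha>]) (simp_all add: alpha_op_eq)

lemma beta_op_tlift:
  assumes x: "x \<in> vcar X"
  shows "beta_op H X \<beta> x = tlift L X (\<lambda>\<omega> y. \<omega> \<otimes>\<^bsub>hopf_op L,alg_op X\<^esub> y) (\<beta> x)"
proof -
  note v = dual_vs algebraD(1)[OF X]
  have "tlift L X (\<lambda>\<omega> y. \<omega> \<otimes>\<^bsub>L,X\<^esub> y) (\<beta> x) = \<beta> x"
    using tlift_tsum[OF v beta_in[OF x] is_vspace_tensor_vs bilin_ten[OF v]] tsum_ten[OF v beta_in[OF x]] by simp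
  moreover have "\<omega> \<otimes>\<^bsub>hopf_op L,alg_op X\<^esub> y = \<omega> \<otimes>\<^bsub>L,X\<^esub> y" for \<omega> y
    by (rule ten_cong) simp_all
  ultimately show ?thesis by (simp add: beta_op_eq[OF x])
qed

lemma alpha_op_tlift:
  assumes x: "x \<in> vcar X"
  shows "alpha_op H X \<alpha> x = tlift (hopf_op H) X (\<lambda>h y. h \<otimes>\<^bsub>H,alg_op X\<^esub> y) (\<alpha> x)"
proof -
  note v = vs algebraD(1)[OF X]
  have "tlift H X (\<lambda>\<omega> y. \<omega> \<otimes>\<^bsub>H,X\<^esub> y) (\<alpha> x) = \<alpha> x"
    using tlift_tsum[OF v alpha_in[OF x] is_vspace_tensor_vs bilin_ten[OF v]] tsum_ten[OF v alpha_in[OF x]] by simp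
  moreover have "\<omega> \<otimes>\<^bsub>H,alg_op X\<^esub> y = \<omega> \<otimes>\<^bsub>H,X\<^esub> y" for \<omega> y
    by (rule ten_cong) simp_all
  ultimately show ?thesis by (simp add: alpha_op_eq[OF x] tlift_cong[of "hopf_op H" H X X])
qed

text \<open>Both conditions relate the same two elements \<open>?P x\<close> and \<open>?Q x\<close> below.\<close>

lemma yetter_drinfeld_op:
  "yetter_drinfeld H L (\<lambda>h \<theta>. \<theta> h) X \<alpha> \<beta> \<longleftrightarrow>
   yetter_drinfeld L H (\<lambda>\<theta> h. \<theta> h) (alg_op X) (beta_op H X \<beta>) (alpha_op H X \<alpha>)"
proof -
  note Xv = algebraD(1)[OF X] and LA = algebra_dual
  let ?U = "canonical_elt (hopf_op H) L (\<lambda>h \<theta>. \<theta> h)"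
  obtain B d where D: "dual_bases H L (\<lambda>h \<theta>. \<theta> h) B d" using ex_dual_bases by blast
  have "canonical_elt (hopf_op H) L (\<lambda>h \<theta>. \<theta> h) = canonical_elt H L (\<lambda>h \<theta>. \<theta> h)"
    unfolding canonical_elt_def dual_bases_def tensor_op_space by simp
  moreover have "canonical_elt (hopf_op L) H (\<lambda>\<theta> h. \<theta> h) = canonical_elt L H (\<lambda>\<theta> h. \<theta> h)"
    unfolding canonical_elt_def dual_bases_def tensor_op_space by simp
  ultimately have U': "canonical_elt (hopf_op L) H (\<lambda>\<theta> h. \<theta> h) = tflip H L ?U"
    using canonical_elt_flip[OF vs dual_vs bilin_evaluation D] by simp
  obtain V where V: "is_inverse (tensor_alg (hopf_op H) L) ?U V"
    using canonical_elt_invertible by blast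
  have Uin: "?U \<in> vcar (tensor_vs H L)"
    using V unfolding is_inverse_def by (simp add: tensor_op_space)
  note V' = is_inverse_tflip[OF alg LA V]
  note UU = tflip_tflip[OF vs dual_vs Uin]
  note lid = lin_id[folded id_def]
  let ?P = "\<lambda>x. tmap L X L (tensor_vs H X) id \<alpha> (\<beta> x)" and ?Q = "\<lambda>x. tmap H X H (tensor_vs L X) id \<beta> (\<alpha> x)"
  have P: "?P x \<in> vcar (tensor_vs L (tensor_vs H X))" and Q: "?Q x \<in> vcar (tensor_vs H (tensor_vs L X))"
    if "x \<in> vcar X" for x
    using tmap_in[OF dual_vs Xv dual_vs is_vspace_tensor_vs lid lin_alpha beta_in[OF that]]
      tmap_in[OF vs Xv vs is_vspace_tensor_vs lid lin_beta alpha_in[OF that]] .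
  have YD: "yetter_drinfeld H L (\<lambda>h \<theta>. \<theta> h) X \<alpha> \<beta> \<longleftrightarrow> (\<forall>x\<in>vcar X.
      ?P x = tassoc L H X (tmap (tensor_vs H L) X (tensor_vs L H) X (tflip H L) id
          (tmap (tensor_vs H L) X (tensor_vs H L) X (alg_Ad (tensor_alg (hopf_op H) L) ?U) id
            (tassoc_inv H L X (?Q x)))))"
    by (rule yetter_drinfeld_iff[OF refl refl refl refl \<alpha> \<beta>])
  have YD': "yetter_drinfeld L H (\<lambda>\<theta> h. \<theta> h) (alg_op X) (beta_op H X \<beta>) (alpha_op H X \<alpha>) \<longleftrightarrow> (\<forall>x\<in>vcar X.
      ?Q x = tassoc H L X (tmap (tensor_vs L H) X (tensor_vs H L) X (tflip L H) id
          (tmap (tensor_vs L H) X (tensor_vs L H) X (alg_Ad (tensor_alg (hopf_op L) H) (tflip H L ?U)) id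
            (tassoc_inv L H X (?P x)))))"
    unfolding U'[symmetric]
    by (rule yetter_drinfeld_iff[OF _ _ beta_op_eq alpha_op_eq beta_op_coaction alpha_op_coaction]) simp_all
  show ?thesis
    unfolding YD YD'
    using yd_equation_flip[OF alg LA Xv V Q] yd_equation_flip[OF LA alg Xv V' P, unfolded UU]
    by (intro iffI ballI) blast+
qed

text \<open>The roles of \<open>x\<close> and \<open>y\<close> are exchanged between the two relations.  After \<open>braided_commute_iff\<close>, the flip
  of the first two legs takes the two sides of one equation to those of the other.\<close>

lemma braided_commute_op:
  assumes x: "x \<in> vcar X" and y: "y \<in> vcar X"
  defines "E \<equiv> heisenberg_alg H L (\<lambda>h \<theta>. \<theta> h)" and "E' \<equiv> heisenberg_alg L H (\<lambda>\<theta> h. \<theta> h)"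
  defines "a \<equiv> tmap (hopf_op H) X E (alg_op X) (\<lambda>k. k \<otimes>\<^bsub>H,L\<^esub> \<one>\<^bsub>L\<^esub>) id (\<alpha> x)"
    and "b \<equiv> tmap L X E (alg_op X) (\<lambda>\<theta>. \<one>\<^bsub>H\<^esub> \<otimes>\<^bsub>H,L\<^esub> antipode L \<theta>) id (\<beta> y)"
    and "a' \<equiv> tmap (hopf_op L) (alg_op X) E' (alg_op (alg_op X)) (\<lambda>k. k \<otimes>\<^bsub>L,H\<^esub> \<one>\<^bsub>H\<^esub>) id (\<beta> y)"
    and "b' \<equiv> tmap H (alg_op X) E' (alg_op (alg_op X)) (\<lambda>h. \<one>\<^bsub>L\<^esub> \<otimes>\<^bsub>L,H\<^esub> antipode H h) id (\<alpha> x)"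
  shows "a \<cdot>\<^bsub>tensor_alg E (alg_op X)\<^esub> b = b \<cdot>\<^bsub>tensor_alg E (alg_op X)\<^esub> a \<longleftrightarrow>
    a' \<cdot>\<^bsub>tensor_alg E' (alg_op (alg_op X))\<^esub> b' = b' \<cdot>\<^bsub>tensor_alg E' (alg_op (alg_op X))\<^esub> a'"
proof -
  interpret P: pairing H L "\<lambda>h \<theta>. \<theta> h" by (rule pairing_dual)
  interpret P': pairing L H "\<lambda>\<theta> h. \<theta> h" by (rule pairing_dual_flip)
  let ?s = "\<alpha> x" and ?t = "\<beta> y" and ?T = "tensor_vs H L" and ?T' = "tensor_vs L H"
  note Xv = algebraD(1)[OF X] and s = alpha_in[OF x] and t = beta_in[OF y]
  have sp: "tensor_vs H (alg_op X) = tensor_vs H X" "tensor_vs L (alg_op X) = tensor_vs L X"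
    "tsum H (alg_op X) = tsum H X" "tsum L (alg_op X) = tsum L X"
    by (rule tensor_vs_cong tsum_space_cong; simp)+
  have sp': "u \<otimes>\<^bsub>?T',alg_op X\<^esub> v = u \<otimes>\<^bsub>?T',X\<^esub> v" for u v by (rule ten_cong) simp_all
  let ?m = "\<lambda>h \<theta>. tsum H H (comult H h) (\<lambda>h1 h2. tsum L L (comult L \<theta>) (\<lambda>\<theta>1 \<theta>2.
        pscale (antipode L \<theta>2 h2) (h1 \<otimes>\<^bsub>H,L\<^esub> \<theta>1)))"
  let ?m' = "\<lambda>\<theta> h. tsum L L (comult L \<theta>) (\<lambda>\<theta>1 \<theta>2. tsum H H (comult H h) (\<lambda>h1 h2.
        pscale (\<theta>2 (antipode H h2)) (\<theta>1 \<otimes>\<^bsub>L,H\<^esub> h1)))"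
  let ?Z1 = "tsum H X ?s (\<lambda>h u. tsum L X ?t (\<lambda>\<theta> v. (h \<otimes>\<^bsub>H,L\<^esub> \<theta>) \<otimes>\<^bsub>?T,X\<^esub> (v \<cdot>\<^bsub>X\<^esub> u)))"
  let ?Z2 = "tsum H X ?s (\<lambda>h u. tsum L X ?t (\<lambda>\<theta> v. ?m h \<theta> \<otimes>\<^bsub>?T,X\<^esub> (u \<cdot>\<^bsub>X\<^esub> v)))"
  let ?Z1' = "tsum L X ?t (\<lambda>\<theta> v. tsum H X ?s (\<lambda>h u. (\<theta> \<otimes>\<^bsub>L,H\<^esub> h) \<otimes>\<^bsub>?T',X\<^esub> (v \<cdot>\<^bsub>X\<^esub> u)))"
  let ?Z2' = "tsum L X ?t (\<lambda>\<theta> v. tsum H X ?s (\<lambda>h u. ?m' \<theta> h \<otimes>\<^bsub>?T',X\<^esub> (u \<cdot>\<^bsub>X\<^esub> v)))"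
  have 1: "a \<cdot>\<^bsub>tensor_alg E (alg_op X)\<^esub> b = b \<cdot>\<^bsub>tensor_alg E (alg_op X)\<^esub> a \<longleftrightarrow> ?Z1 = ?Z2"
    unfolding a_def b_def E_def by (rule P.braided_commute_iff[OF X s t])
  have 2: "a' \<cdot>\<^bsub>tensor_alg E' (alg_op (alg_op X))\<^esub> b' = b' \<cdot>\<^bsub>tensor_alg E' (alg_op (alg_op X))\<^esub> a' \<longleftrightarrow> ?Z1' = ?Z2'"
    unfolding a'_def b'_def E'_def
    using P'.braided_commute_iff[OF algebra_alg_op[OF X], unfolded sp, OF t s]
    by (simp only: sp' alg_op_simps)
  define \<Psi> where "\<Psi> = tmap ?T X ?T' X (tflip H L) id"
  note lid = lin_id[of X, folded id_def]
  have l\<Psi>: "lin_map (tensor_vs ?T X) (tensor_vs ?T' X) \<Psi>"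
    unfolding \<Psi>_def by (rule lin_tmap[OF is_vspace_tensor_vs Xv is_vspace_tensor_vs Xv lin_tflip[OF vs dual_vs] lid])
  have \<Psi>: "\<Psi> (r \<otimes>\<^bsub>?T,X\<^esub> w) = tflip H L r \<otimes>\<^bsub>?T',X\<^esub> w" if "r \<in> vcar ?T" "w \<in> vcar X" for r w
    using tmap_ten[OF is_vspace_tensor_vs Xv is_vspace_tensor_vs Xv lin_tflip[OF vs dual_vs] lid that]
    by (simp add: \<Psi>_def)
  have inj: "u = v" if "\<Psi> u = \<Psi> v" "u \<in> vcar (tensor_vs ?T X)" "v \<in> vcar (tensor_vs ?T X)" for u v
  proof -
    have "tmap ?T' X ?T X (tflip L H) id (\<Psi> z) = z" if "z \<in> vcar (tensor_vs ?T X)" for z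
      unfolding \<Psi>_def
      by (rule tmap_inverse[OF is_vspace_tensor_vs Xv is_vspace_tensor_vs Xv lin_tflip[OF vs dual_vs] lid
            lin_tflip[OF dual_vs vs] lid _ _ that]) (erule tflip_tflip[OF vs dual_vs], simp)
    then show ?thesis using that by metis
  qed
  have mult_X: "u \<cdot>\<^bsub>X\<^esub> v \<in> vcar X" if "u \<in> vcar X" "v \<in> vcar X" for u v
    using algebraD(7)[OF X that] .
  have m_in: "?m h \<theta> \<in> vcar ?T" if "h \<in> vcar H" "\<theta> \<in> vcar L" for h \<theta>
    using that by (intro tsum_in[where U = ?T] vs dual_vs is_vspace_tensor_vs comult_in comult_dual_in pscale_in ten_in)
  have flip_m: "tflip H L (?m h \<theta>) = ?m' \<theta> h" if h: "h \<in> vcar H" and \<theta>: "\<theta> \<in> vcar L" for h \<theta>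
  proof -
    note lf = lin_tflip[OF vs dual_vs]
    have "tflip H L (?m h \<theta>) = tsum H H (comult H h) (\<lambda>h1 h2. tflip H L (tsum L L (comult L \<theta>) (\<lambda>\<theta>1 \<theta>2.
        pscale (antipode L \<theta>2 h2) (h1 \<otimes>\<^bsub>H,L\<^esub> \<theta>1))))"
      by (intro lin_map_tsum[OF lf vs vs comult_in[OF h] is_vspace_tensor_vs] tsum_in[where U = ?T]
          dual_vs is_vspace_tensor_vs comult_dual_in[OF \<theta>] pscale_in ten_in vs)
    also have "\<dots> = tsum H H (comult H h) (\<lambda>h1 h2. tsum L L (comult L \<theta>) (\<lambda>\<theta>1 \<theta>2. tflip H L (
        pscale (antipode L \<theta>2 h2) (h1 \<otimes>\<^bsub>H,L\<^esub> \<theta>1))))"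
      by (intro tsum_cong[OF vs vs comult_in[OF h]] lin_map_tsum[OF lf dual_vs dual_vs comult_dual_in[OF \<theta>]
            is_vspace_tensor_vs] pscale_in ten_in vs dual_vs)
    also have "\<dots> = tsum H H (comult H h) (\<lambda>h1 h2. tsum L L (comult L \<theta>) (\<lambda>\<theta>1 \<theta>2.
        pscale (\<theta>2 (antipode H h2)) (\<theta>1 \<otimes>\<^bsub>L,H\<^esub> h1)))"
      by (intro tsum_cong[OF vs vs comult_in[OF h]] tsum_cong[OF dual_vs dual_vs comult_dual_in[OF \<theta>]])
        (simp add: lin_mapD(3)[OF lf, unfolded vscale_tensor_vs] ten_in[OF vs dual_vs] tflip_ten[OF vs dual_vs] del: dual_simps)
    also have "\<dots> = ?m' \<theta> h" by (rule tsum_swap)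
    finally show ?thesis .
  qed
  have push: "\<Psi> (tsum H X ?s (\<lambda>h u. tsum L X ?t (\<lambda>\<theta> v. F h \<theta> \<otimes>\<^bsub>?T,X\<^esub> G u v)))
      = tsum L X ?t (\<lambda>\<theta> v. tsum H X ?s (\<lambda>h u. F' \<theta> h \<otimes>\<^bsub>?T',X\<^esub> G u v))"
    and push_in: "tsum H X ?s (\<lambda>h u. tsum L X ?t (\<lambda>\<theta> v. F h \<theta> \<otimes>\<^bsub>?T,X\<^esub> G u v)) \<in> vcar (tensor_vs ?T X)"
    if F: "\<And>h \<theta>. h \<in> vcar H \<Longrightarrow> \<theta> \<in> vcar L \<Longrightarrow> F h \<theta> \<in> vcar ?T"
      "\<And>h \<theta>. h \<in> vcar H \<Longrightarrow> \<theta> \<in> vcar L \<Longrightarrow> tflip H L (F h \<theta>) = F' \<theta> h"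
      and G: "\<And>u v. u \<in> vcar X \<Longrightarrow> v \<in> vcar X \<Longrightarrow> G u v \<in> vcar X" for F F' G
  proof -
    show "tsum H X ?s (\<lambda>h u. tsum L X ?t (\<lambda>\<theta> v. F h \<theta> \<otimes>\<^bsub>?T,X\<^esub> G u v)) \<in> vcar (tensor_vs ?T X)"
      by (intro tsum_in vs dual_vs Xv s t is_vspace_tensor_vs ten_in F G)
    have "\<Psi> (tsum H X ?s (\<lambda>h u. tsum L X ?t (\<lambda>\<theta> v. F h \<theta> \<otimes>\<^bsub>?T,X\<^esub> G u v)))
      = tsum H X ?s (\<lambda>h u. \<Psi> (tsum L X ?t (\<lambda>\<theta> v. F h \<theta> \<otimes>\<^bsub>?T,X\<^esub> G u v)))"
      by (intro lin_map_tsum[OF l\<Psi> vs Xv s is_vspace_tensor_vs] tsum_in dual_vs Xv t is_vspace_tensor_vs ten_in F G)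
    also have "\<dots> = tsum H X ?s (\<lambda>h u. tsum L X ?t (\<lambda>\<theta> v. \<Psi> (F h \<theta> \<otimes>\<^bsub>?T,X\<^esub> G u v)))"
      by (intro tsum_cong[OF vs Xv s] lin_map_tsum[OF l\<Psi> dual_vs Xv t is_vspace_tensor_vs] is_vspace_tensor_vs Xv ten_in F G)
    also have "\<dots> = tsum H X ?s (\<lambda>h u. tsum L X ?t (\<lambda>\<theta> v. F' \<theta> h \<otimes>\<^bsub>?T',X\<^esub> G u v))"
      by (intro tsum_cong[OF vs Xv s] tsum_cong[OF dual_vs Xv t]) (simp add: \<Psi> F G del: dual_simps)
    also have "\<dots> = tsum L X ?t (\<lambda>\<theta> v. tsum H X ?s (\<lambda>h u. F' \<theta> h \<otimes>\<^bsub>?T',X\<^esub> G u v))"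
      by (rule tsum_swap)
    finally show "\<Psi> (tsum H X ?s (\<lambda>h u. tsum L X ?t (\<lambda>\<theta> v. F h \<theta> \<otimes>\<^bsub>?T,X\<^esub> G u v))) = \<dots>" .
  qed
  have Z1: "\<Psi> ?Z1 = ?Z1'"
    by (rule push[of "\<lambda>h \<theta>. h \<otimes>\<^bsub>H,L\<^esub> \<theta>" "\<lambda>\<theta> h. \<theta> \<otimes>\<^bsub>L,H\<^esub> h" "\<lambda>u v. v \<cdot>\<^bsub>X\<^esub> u"])
      (assumption | rule ten_in vs dual_vs tflip_ten mult_X)+
  have Z1_in: "?Z1 \<in> vcar (tensor_vs ?T X)"
    by (rule push_in[of "\<lambda>h \<theta>. h \<otimes>\<^bsub>H,L\<^esub> \<theta>" "\<lambda>\<theta> h. \<theta> \<otimes>\<^bsub>L,H\<^esub> h" "\<lambda>u v. v \<cdot>\<^bsub>X\<^esub> u"])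
      (assumption | rule refl ten_in vs dual_vs tflip_ten mult_X)+
  have Z2: "\<Psi> ?Z2 = ?Z2'"
    by (rule push[of ?m ?m' "\<lambda>u v. u \<cdot>\<^bsub>X\<^esub> v", OF m_in flip_m mult_X])
  have Z2_in: "?Z2 \<in> vcar (tensor_vs ?T X)"
    by (rule push_in[of ?m ?m' "\<lambda>u v. u \<cdot>\<^bsub>X\<^esub> v", OF m_in flip_m mult_X])
  show ?thesis
    unfolding 1 2
  proof
    assume "?Z1 = ?Z2"
    then have "\<Psi> ?Z1 = \<Psi> ?Z2" by (rule arg_cong)
    then show "?Z1' = ?Z2'" unfolding Z1 Z2 .
  next
    assume "?Z1' = ?Z2'"
    then have "\<Psi> ?Z1 = \<Psi> ?Z2" unfolding Z1 Z2 .
    then show "?Z1 = ?Z2" by (rule inj[OF _ Z1_in Z2_in])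
  qed
qed

lemma braided_commutative_op:
  "braided_commutative H L (\<lambda>h \<theta>. \<theta> h) X \<alpha> \<beta> \<longleftrightarrow>
   braided_commutative L H (\<lambda>\<theta> h. \<theta> h) (alg_op X) (beta_op H X \<beta>) (alpha_op H X \<alpha>)"
proof -
  have flip: "(\<forall>x\<in>A. \<forall>y\<in>A. C x y) \<longleftrightarrow> (\<forall>y\<in>A. \<forall>x\<in>A. C' y x)"
    if "\<And>x y. x \<in> A \<Longrightarrow> y \<in> A \<Longrightarrow> C x y \<longleftrightarrow> C' y x" for A :: "'x set" and C C'
    using that by blast
  show ?thesis
    unfolding braided_commutative_def Let_def yetter_drinfeld_op[symmetric] alg_op_simps(1)
    by (rule conj_cong[OF refl], rule flip) (simp only: beta_op_eq alpha_op_eq, rule braided_commute_op)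
qed

end

end

theorem proposition4p42:
  fixes H :: "('k::field, 'h::ab_group_add) hopf"
    and X :: "('k, 'x::ab_group_add) alg"
    and \<alpha> :: "'x \<Rightarrow> ('k, 'h, 'x) tensor"
    and \<beta> :: "'x \<Rightarrow> ('k, 'h \<Rightarrow> 'k, 'x) tensor"
  assumes "hopf_algebra H" and "finite_dim H" and "algebra X"
    and "left_coaction (hopf_op H) X \<alpha>"
    and "left_coaction (hopf_dual H) X \<beta>"
  shows "(\<forall>x\<in>vcar X. beta_op H X \<beta> x
           = tlift (hopf_dual H) X (\<lambda>\<omega> y. \<omega> \<otimes>\<^bsub>hopf_op (hopf_dual H),alg_op X\<^esub> y) (\<beta> x)) \<and>
     (\<forall>x\<in>vcar X. alpha_op H X \<alpha> x
           = tlift (hopf_op H) X (\<lambda>h y. h \<otimes>\<^bsub>H,alg_op X\<^esub> y) (\<alpha> x)) \<and>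
     left_coaction (hopf_op (hopf_dual H)) (alg_op X) (beta_op H X \<beta>) \<and>
     left_coaction H (alg_op X) (alpha_op H X \<alpha>) \<and>
     (yetter_drinfeld H (hopf_dual H) (\<lambda>h \<theta>. \<theta> h) X \<alpha> \<beta> \<longleftrightarrow>
         yetter_drinfeld (hopf_dual H) H (\<lambda>\<theta> h. \<theta> h) (alg_op X) (beta_op H X \<beta>) (alpha_op H X \<alpha>)) \<and>
     (braided_commutative H (hopf_dual H) (\<lambda>h \<theta>. \<theta> h) X \<alpha> \<beta> \<longleftrightarrow>
         braided_commutative (hopf_dual H) H (\<lambda>\<theta> h. \<theta> h) (alg_op X) (beta_op H X \<beta>) (alpha_op H X \<alpha>))"
proof -
  interpret fd_hopf_alg H
    using assms(1,2) by unfold_locales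
  note op = assms(3-5)
  show ?thesis
    using beta_op_tlift[OF op] alpha_op_tlift[OF op] beta_op_coaction[OF op] alpha_op_coaction[OF op]
      yetter_drinfeld_op[OF op] braided_commutative_op[OF op]
    by blast
qed

end
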